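(* Let $\Gamma_1$ and $\Gamma_2$ be two given circles with centres $O_1$ and $O_2$ and radii $r_1$ and $r_2$. Then, by a match-stick construction following Postulates i, ii and iii below, one can determine whether $\Gamma_1$ and $\Gamma_2$ intersect. If they do, one can construct their intersection points.
   Context: We work in the Euclidean plane with a fixed unit of length. A match-stick (or stick) is a closed line segment of length exactly $1$; its endpoints are called its extremities. A match-stick construction is a finite sequence of steps, starting from given objects, each permitted by the following postulates ("given" means initially given or obtained in an earlier step): Postulate i. One may lay a match-stick through any two given points at distance equal to or less than the unit, where one or even two of the points may be chosen as extremity of the stick segment. This procedure also permits us to determine whether the distance of two given points is strictly less than, equal to, or strictly greater than the unit. Postulate ii. One may choose an arbitrary point on a given stick segment, and it can be chosen such that it is none of the extremities. Postulate iii. From a given point, one may use a match-stick as a unitary ruler. This ruler does not leave a trace, but can be used to determine a point with unit distance to the given point and relatively to a given set of match-sticks (for instance, the points of given sticks at distance exactly $1$ from the given point, or that there are none). No two match-sticks can be used as a compass at the same time. Intersection points of laid sticks count as constructed points. As usual for geometric constructions, "arbitrary" choices are auxiliary: the constructed object must not depend on them. A circle is given by its centre and one of its points (the circle itself is not drawn); its radius is an arbitrary positive real number. The two circles are understood to be different circles. *)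

theory Defs
  imports "HOL-Analysis.Analysis"
begin

text \<open>The Euclidean plane is the type of complex numbers with its usual metric. A match-stick is
  represented by the pair of its extremities; the stick itself is the closed segment between them.\<close>

type_synonym point = complex
type_synonym stick = "point \<times> point"

definition segment :: "stick \<Rightarrow> point set" where
  "segment s = closed_segment (fst s) (snd s)"

datatype config = Config (points: "point list") (sticks: "stick list")

definition given_point :: "config \<Rightarrow> nat \<Rightarrow> point \<Rightarrow> bool" where
  "given_point c i p \<longleftrightarrow> i < length (points c) \<and> points c ! i = p"

definition given_stick :: "config \<Rightarrow> nat \<Rightarrow> stick \<Rightarrow> bool" where
  "given_stick c k s \<longleftrightarrow> k < length (sticks c) \<and> sticks c ! k = s"

definition given_sticks :: "config \<Rightarrow> nat list \<Rightarrow> stick set \<Rightarrow> bool" where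
  "given_sticks c ks S \<longleftrightarrow>
     (\<forall>k\<in>set ks. k < length (sticks c)) \<and> S = (\<lambda>k. sticks c ! k) ` set ks"

fun extend :: "config \<Rightarrow> point list \<Rightarrow> stick list \<Rightarrow> config" where
  "extend (Config ps ss) ps' ss' = Config (ps @ ps') (ss @ ss')"

text \<open>Instructions address the objects obtained so far only by their position in the configuration,
  so a construction has no access to coordinates. All it ever learns is the observation returned
  by each instruction.\<close>

datatype instruction =
    Compare nat nat
  | Lay nat nat bool bool
  | Choose nat bool
  | Ruler_Free nat "nat list"
  | Ruler_On nat "nat list"
  | Intersect nat nat

datatype observation = Done | Shorter | Unit_Length | Longer | Found nat

definition compare_unit :: "real \<Rightarrow> observation" where
  "compare_unit d = (if d < 1 then Shorter else if d = 1 then Unit_Length else Longer)"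

text \<open>The possible results of an instruction. More than one result means an arbitrary choice, which
  the construction does not control; the empty set means that the instruction is not permitted.
    \<^item> \<open>Compare\<close> compares a distance with the unit; \<open>Lay\<close> lays a stick through two
      points. The flags of \<open>Lay\<close> tell which of the two points are chosen as extremities; if neither is, the position of the stick along the line is arbitrary.
      The points have to be distinct; for points more than a unit apart, or if both flags are set
      and the distance is not the unit, there is no such stick. The extremities of a laid stick
      become given points.
    \<^item> \<open>Choose\<close> takes an arbitrary point of a stick; the flag asks for a point that is no extremity.
    \<^item> \<open>Ruler_Free\<close> and \<open>Ruler_On\<close> use a single stick as unitary ruler, relative to a
      finite set of given sticks: an arbitrary point at unit distance that avoids these sticks (any point at unit distance if
      there are none), respectively all points of these sticks at unit distance, in arbitrary order.
    \<^item> \<open>Intersect\<close> yields the common point of two sticks; sticks that are disjoint or overlap in a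
      whole segment yield none.\<close>

fun outcomes :: "instruction \<Rightarrow> config \<Rightarrow> (observation \<times> config) set" where
  "outcomes (Compare i j) c =
     {(compare_unit (dist p q), c) | p q. given_point c i p \<and> given_point c j q}"
| "outcomes (Lay i j ext_i ext_j) c =
     {(Done, extend c [a, b] [(a, b)]) | a b p q.
        given_point c i p \<and> given_point c j q \<and> p \<noteq> q \<and>
        dist a b = 1 \<and> p \<in> segment (a, b) \<and> q \<in> segment (a, b) \<and>
        (ext_i \<longrightarrow> p = a) \<and> (ext_j \<longrightarrow> q = b)}"
| "outcomes (Choose k no_ext) c =
     {(Done, extend c [x] []) | x s.
        given_stick c k s \<and> x \<in> segment s \<and> (no_ext \<longrightarrow> x \<noteq> fst s \<and> x \<noteq> snd s)}"
| "outcomes (Ruler_Free i ks) c =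
     {(Done, extend c [x] []) | x p S.
        given_point c i p \<and> given_sticks c ks S \<and> dist p x = 1 \<and> x \<notin> (\<Union>s\<in>S. segment s)}"
| "outcomes (Ruler_On i ks) c =
     {(Found (length xs), extend c xs []) | xs p S.
        given_point c i p \<and> given_sticks c ks S \<and>
        distinct xs \<and> set xs = {x \<in> (\<Union>s\<in>S. segment s). dist p x = 1}}"
| "outcomes (Intersect k l) c =
     {(Found 1, extend c [x] []) | x s t.
        given_stick c k s \<and> given_stick c l t \<and> segment s \<inter> segment t = {x}} \<union>
     {(Found 0, c) | s t.
        given_stick c k s \<and> given_stick c l t \<and> (\<nexists>x. segment s \<inter> segment t = {x})}"

text \<open>A construction chooses each instruction according to the observations made before. It has to
  be a codatatype: the same construction serves all initial data, and the number of steps may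
  depend on these data (for instance on how far apart two given points are), so that no bound on
  the depth of the tree can exist. That each individual run is finite is part of \<open>achieves\<close>.\<close>

codatatype 'r construction =
    Finish 'r
  | Step instruction "observation \<Rightarrow> 'r construction"

text \<open>Started in configuration \<open>c\<close>, the construction only takes permitted steps, stops after finitely
  many of them, and ends with a result satisfying \<open>Q\<close>, no matter how the arbitrary choices are made.\<close>

inductive achieves ::
  "('r \<Rightarrow> config \<Rightarrow> bool) \<Rightarrow> 'r construction \<Rightarrow> config \<Rightarrow> bool" for Q where
  finish: "Q r c \<Longrightarrow> achieves Q (Finish r) c"
| step: "outcomes ins c \<noteq> {} \<Longrightarrow>
    (\<And>obs c'. (obs, c') \<in> outcomes ins c \<Longrightarrow> achieves Q (K obs) c') \<Longrightarrow>
    achieves Q (Step ins K) c"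

text \<open>The result consists of the verdict whether the circles intersect and of the positions of the
  constructed intersection points.\<close>

definition solves_circles :: "point set \<Rightarrow> point set \<Rightarrow> bool \<times> nat list \<Rightarrow> config \<Rightarrow> bool" where
  "solves_circles \<Gamma>1 \<Gamma>2 r c \<longleftrightarrow>
     (fst r \<longleftrightarrow> \<Gamma>1 \<inter> \<Gamma>2 \<noteq> {}) \<and>
     (\<Gamma>1 \<inter> \<Gamma>2 \<noteq> {} \<longrightarrow>
       (\<forall>i\<in>set (snd r). i < length (points c)) \<and>
       (\<lambda>i. points c ! i) ` set (snd r) = \<Gamma>1 \<inter> \<Gamma>2)"

end

theory Submission
  imports Defs "HOL-Library.Monad_Syntax"
begin

text \<open>A circle is never drawn, and the ruler only meets sticks that have been laid, so two circles
  cannot be intersected directly. The construction turns the question into arithmetic instead: it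
  builds a Cartesian frame out of sticks, measures the coordinates of the four given points,
  evaluates the formulas for the common points of two circles (field operations, sign tests and
  one square root), and turns the resulting coordinates back into points.

  \<^bold>\<open>Frame.\<close> Among any seven directions at a point, two enclose an angle below 60 degrees
  (\<open>close_pair_on_circle\<close>), which yields an isosceles triangle with unit legs and a base shorter
  than the unit. A stick and its mirror image cross on its altitude, and this gives a right angle
  and then a unit square (\<open>triangle_square\<close>). After that perpendiculars come for free:
  the unit circle around a point of the bottom side touches the line of the top side vertically
  above that point. Extending the sides covers the plane with a lattice of unit
  squares, and the same tangency carries a point of one bottom side to any other cell.

  \<^bold>\<open>Arithmetic.\<close> A stick joins only points within the unit, so all calculation takes place in one
  square. A real \<open>X\<close> is the point with abscissa \<open>1 / 2 + X / 2 ^ k\<close> of the bottom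
  side, where the exponent \<open>k\<close> is known to the construction as a plain natural number; no real is
  out of reach then. With three equidistant horizontal lines, joining and intersecting gives means
  and reflections, hence sums and differences. One perspectivity (\<open>fourth_proportional\<close>) gives
  products and inverses. The unit circle around \<open>(x, 0)\<close> meets the left side at height
  \<open>sqrt (1 - x\<^sup>2)\<close>, which is enough for all square roots (\<open>square_root\<close>), because
  heights can be converted back into abscissas by two further unit circles and squaring
  (\<open>of_ordinate\<close>).

  \<^bold>\<open>Searching.\<close> How far the given points are from the frame, how large a coordinate is and how
  small a divisor is cannot be known in advance. These quantities are found by trying all
  candidates in turn (\<open>search\<close>): each such loop ends, although no bound on its length is uniform.

  \<^bold>\<open>Programs.\<close> The building blocks take programs that construct points, not positions of points, as
  arguments, and \<open>computes c m x\<close> says that the program \<open>m\<close> yields the point \<open>x\<close> when it is started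
  in any extension of the configuration \<open>c\<close>. Such facts are stable while the configuration grows,
  so geometric reasoning never has to track positions. Evaluating an argument repeatedly is
  harmless, because the resulting point is independent of the arbitrary choices made on the way.\<close>

section \<open>Running constructions\<close>

text \<open>Configurations only grow during a construction; this order is what makes facts about
  given objects persistent.\<close>
definition extends :: "config \<Rightarrow> config \<Rightarrow> bool" (infix "\<sqsubseteq>" 50) where
  "c \<sqsubseteq> c' \<longleftrightarrow> (\<exists>ps ss. c' = extend c ps ss)"

lemma extends_refl [simp]: "c \<sqsubseteq> c"
  unfolding extends_def by (cases c) (metis append_Nil2 extend.simps)

lemma extends_trans [trans]: "c \<sqsubseteq> c' \<Longrightarrow> c' \<sqsubseteq> c'' \<Longrightarrow> c \<sqsubseteq> c''"
  unfolding extends_def by (cases c) (metis append.assoc extend.simps)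

lemma extends_extend [simp]: "c \<sqsubseteq> extend c ps ss"
  unfolding extends_def by blast

lemma given_point_mono: "given_point c i p \<Longrightarrow> c \<sqsubseteq> c' \<Longrightarrow> given_point c' i p"
  unfolding extends_def given_point_def by (cases c) (auto simp: nth_append)

lemma given_stick_mono: "given_stick c i s \<Longrightarrow> c \<sqsubseteq> c' \<Longrightarrow> given_stick c' i s"
  unfolding extends_def given_stick_def by (cases c) (auto simp: nth_append)

lemma points_mono: "points c \<noteq> [] \<Longrightarrow> c \<sqsubseteq> c' \<Longrightarrow> points c' \<noteq> []"
  unfolding extends_def by (cases c) auto

lemma points_nonempty: "given_point c i p \<Longrightarrow> points c \<noteq> []"
  by (auto simp: given_point_def)

lemma given_point_iff: "given_point c i p \<Longrightarrow> given_point c i q \<longleftrightarrow> q = p"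
  by (auto simp: given_point_def)

lemma given_stick_iff: "given_stick c i s \<Longrightarrow> given_stick c i t \<longleftrightarrow> t = s"
  by (auto simp: given_stick_def)

text \<open>New objects are appended, so a program that keeps these two lengths can predict the
  positions of the objects it is about to obtain.\<close>
definition counts :: "config \<Rightarrow> nat \<times> nat" where
  "counts c = (length (points c), length (sticks c))"

lemma points_extend [simp]: "points (extend c ps ss) = points c @ ps"
  by (cases c) simp

lemma sticks_extend [simp]: "sticks (extend c ps ss) = sticks c @ ss"
  by (cases c) simp

text \<open>Since constructions are codata, sequential composition is corecursive: it replaces the
  leaves of the tree.\<close>
primcorec seq :: "'a construction \<Rightarrow> ('a \<Rightarrow> 'b construction) \<Rightarrow> 'b construction" where
  "seq m f = (case m of Finish a \<Rightarrow> f a | Step i K \<Rightarrow> Step i (\<lambda>obs. seq (K obs) f))"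

lemma seq_simps [simp]:
  "seq (Finish a) f = f a"
  "seq (Step i K) f = Step i (\<lambda>obs. seq (K obs) f)"
   apply (subst seq.code, simp)
  apply (subst seq.code, simp)
  done

lemma achieves_mono: "achieves Q K c \<Longrightarrow> (\<And>r c'. Q r c' \<Longrightarrow> Q' r c') \<Longrightarrow> achieves Q' K c"
  by (induction rule: achieves.induct) (auto intro: achieves.intros)

lemma achieves_seq:
  "achieves P m c \<Longrightarrow> (\<And>r c'. P r c' \<Longrightarrow> achieves Q (f r) c') \<Longrightarrow> achieves Q (seq m f) c"
  by (induction rule: achieves.induct) (auto intro: achieves.intros)

text \<open>A program is started with the current numbers of points and sticks and passes on the
  updated numbers together with its result.\<close>
type_synonym 'a prog = "nat \<times> nat \<Rightarrow> ('a \<times> nat \<times> nat) construction"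

definition give :: "'a \<Rightarrow> 'a prog" where
  "give a = (\<lambda>n. Finish (a, n))"

definition bind :: "'a prog \<Rightarrow> ('a \<Rightarrow> 'b prog) \<Rightarrow> 'b prog" where
  "bind m f = (\<lambda>n. seq (m n) (\<lambda>(a, n'). f a n'))"

adhoc_overloading Monad_Syntax.bind \<rightleftharpoons> bind

text \<open>The quantification over all extensions \<open>c'\<close> makes the statement
  persistent, so that a program may be run later than, or more often than, at the configuration
  where it was analysed.\<close>
definition ensures :: "config \<Rightarrow> 'a prog \<Rightarrow> ('a \<Rightarrow> config \<Rightarrow> bool) \<Rightarrow> bool" where
  "ensures c m Q \<longleftrightarrow> (\<forall>c'. c \<sqsubseteq> c' \<longrightarrow>
     achieves (\<lambda>(a, n) c''. n = counts c'' \<and> c' \<sqsubseteq> c'' \<and> Q a c'') (m (counts c')) c')"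

lemma ensures_give: "(\<And>c'. c \<sqsubseteq> c' \<Longrightarrow> Q a c') \<Longrightarrow> ensures c (give a) Q"
  unfolding ensures_def give_def by (auto intro: achieves.finish)

lemma ensures_mono: "ensures c m Q \<Longrightarrow> c \<sqsubseteq> c' \<Longrightarrow> ensures c' m Q"
  unfolding ensures_def using extends_trans by blast

lemma ensures_bind:
  assumes m: "ensures c m Q"
    and f: "\<And>a c'. c \<sqsubseteq> c' \<Longrightarrow> Q a c' \<Longrightarrow> ensures c' (f a) R"
  shows "ensures c (m \<bind> f) R"
  unfolding ensures_def
proof (intro allI impI)
  fix c' assume c': "c \<sqsubseteq> c'"
  with m have "achieves (\<lambda>(a, n) c''. n = counts c'' \<and> c' \<sqsubseteq> c'' \<and> Q a c'') (m (counts c')) c'"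
    unfolding ensures_def by blast
  moreover have "achieves (\<lambda>(a, n) c''. n = counts c'' \<and> c' \<sqsubseteq> c'' \<and> R a c'') (case r of (a, n) \<Rightarrow> f a n) c''"
    if r: "case r of (a, n) \<Rightarrow> n = counts c'' \<and> c' \<sqsubseteq> c'' \<and> Q a c''" for r c''
  proof -
    obtain a n where Pair: "r = (a, n)" by (cases r)
    with r have n: "n = counts c''" and c'': "c' \<sqsubseteq> c''" and Q: "Q a c''"
      by auto
    have "ensures c'' (f a) R"
      using f extends_trans[OF c' c''] Q .
    then have "achieves (\<lambda>(a, n) c3. n = counts c3 \<and> c'' \<sqsubseteq> c3 \<and> R a c3) (f a n) c''"
      unfolding ensures_def n by simp
    then show ?thesis
      unfolding Pair prod.case by (rule achieves_mono) (use c'' extends_trans in auto)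
  qed
  ultimately show "achieves (\<lambda>(a, n) c''. n = counts c'' \<and> c' \<sqsubseteq> c'' \<and> R a c'') ((m \<bind> f) (counts c')) c'"
    unfolding bind_def using achieves_seq by (smt (verit) case_prod_unfold)
qed

text \<open>A round that ends without a result is followed by the next one. The dummy comparison
  of a point with itself guards the corecursive call; without a step in between, an endless
  sequence of empty rounds would have no meaning as a construction.\<close>
primcorec iterate :: "('s \<Rightarrow> ('s + 'a) construction) \<Rightarrow> ('s + 'a) construction \<Rightarrow> 'a construction" where
  "iterate body m = (case m of
      Finish r \<Rightarrow> (case r of
          Inl s \<Rightarrow> Step (Compare 0 0) (\<lambda>_. iterate body (body s))
        | Inr a \<Rightarrow> Finish a)
    | Step i K \<Rightarrow> Step i (\<lambda>obs. iterate body (K obs)))"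

lemma iterate_simps [simp]:
  "iterate body (Finish (Inl s)) = Step (Compare 0 0) (\<lambda>_. iterate body (body s))"
  "iterate body (Finish (Inr a)) = Finish a"
  "iterate body (Step i K) = Step i (\<lambda>obs. iterate body (K obs))"
    apply (subst iterate.code, simp)
   apply (subst iterate.code, simp)
  apply (subst iterate.code, simp)
  done

lemma achieves_iterate:
  assumes "achieves P m c"
    and "\<And>a c'. P (Inr a) c' \<Longrightarrow> Q a c'"
    and "\<And>s c'. P (Inl s) c' \<Longrightarrow> points c' \<noteq> [] \<and> achieves Q (iterate body (body s)) c'"
  shows "achieves Q (iterate body m) c"
  using assms(1)
proof (induction rule: achieves.induct)
  case (finish r c)
  show ?case
  proof (cases r)
    case (Inl s)
    with finish assms(3) have *: "points c \<noteq> []" "achieves Q (iterate body (body s)) c" by auto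
    show ?thesis
      unfolding Inl iterate_simps
    proof (rule achieves.step)
      show "outcomes (Compare 0 0) c \<noteq> {}"
        using * by (auto simp: given_point_def)
    qed (use * in auto)
  qed (use finish assms(2) in \<open>auto intro: achieves.finish\<close>)
qed (auto intro: achieves.intros)

text \<open>The candidates \<open>0, 1, 2, \<dots>\<close> are tried in turn until the body
  returns a result.\<close>
definition search :: "(nat \<Rightarrow> 'a option prog) \<Rightarrow> 'a prog" where
  "search body = (\<lambda>n. let run = (\<lambda>(k, n). seq (body k n)
        (\<lambda>(r, n'). Finish (case r of None \<Rightarrow> Inl (Suc k, n') | Some a \<Rightarrow> Inr (a, n'))))
      in iterate run (run (0, n)))"

text \<open>Every round terminates, and round \<open>N\<close> at the latest returns a result, so
  the induction is on the number of rounds left before \<open>N\<close>. Which \<open>N\<close>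
  does it depends on the data; the program does not mention it.\<close>
lemma ensures_search:
  assumes pt: "points c \<noteq> []"
    and body: "\<And>k. ensures c (body k) (\<lambda>r c'. case r of None \<Rightarrow> k \<noteq> N | Some a \<Rightarrow> Q a c')"
  shows "ensures c (search body) Q"
  unfolding ensures_def
proof (intro allI impI)
  fix c0 assume c0: "c \<sqsubseteq> c0"
  define run where "run = (\<lambda>(k, n). seq (body k n)
        (\<lambda>(r, n'). Finish (case r of None \<Rightarrow> Inl (Suc k, n') | Some a \<Rightarrow> Inr (a, n'))))"
  define G where "G = (\<lambda>(a, n) c''. n = counts c'' \<and> c0 \<sqsubseteq> c'' \<and> Q a c'')"
  have step: "achieves (\<lambda>r c''. c1 \<sqsubseteq> c'' \<and> (case r of Inl (k', n') \<Rightarrow> k' = Suc k \<and> n' = counts c'' \<and> k \<noteq> N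
        | Inr (a, n') \<Rightarrow> n' = counts c'' \<and> Q a c'')) (run (k, counts c1)) c1"
    if c1: "c \<sqsubseteq> c1" for k c1
  proof -
    have "achieves (\<lambda>(r, n) c''. n = counts c'' \<and> c1 \<sqsubseteq> c'' \<and> (case r of None \<Rightarrow> k \<noteq> N | Some a \<Rightarrow> Q a c''))
        (body k (counts c1)) c1"
      using body[of k] c1 unfolding ensures_def by blast
    then show ?thesis
      unfolding run_def prod.case
      by (rule achieves_seq) (auto intro!: achieves.finish split: option.splits)
  qed
  have "achieves G (iterate run (run (N - d, counts c1))) c1" if "c0 \<sqsubseteq> c1" "d \<le> N" for d c1
    using that
  proof (induction d arbitrary: c1)
    case 0
    have c1: "c \<sqsubseteq> c1" using c0 0 extends_trans by blast
    show ?case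
      using step[OF c1, of "N - 0"]
      by (rule achieves_iterate) (use 0 in \<open>auto simp: G_def intro: extends_trans\<close>)
  next
    case (Suc d)
    have c1: "c \<sqsubseteq> c1" using c0 Suc extends_trans by blast
    show ?case
      using step[OF c1, of "N - Suc d"]
    proof (rule achieves_iterate, goal_cases)
      case (1 a c')
      then show ?case using Suc by (auto simp: G_def intro: extends_trans)
    next
      case (2 s c')
      then have s: "s = (N - d, counts c')" and c': "c1 \<sqsubseteq> c'"
        using Suc by (auto split: prod.splits)
      have "points c' \<noteq> []"
        using pt c1 c' points_mono by blast
      then show ?case
        unfolding s using Suc c' extends_trans by auto
    qed
  qed
  from this[of c0 N] show "achieves (\<lambda>(a, n) c''. n = counts c'' \<and> c0 \<sqsubseteq> c'' \<and> Q a c'') (search body (counts c0)) c0"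
    unfolding search_def Let_def G_def run_def by simp
qed

section \<open>Single instructions\<close>

definition compare :: "nat \<Rightarrow> nat \<Rightarrow> observation prog" where
  "compare i j = (\<lambda>n. Step (Compare i j) (\<lambda>obs. Finish (obs, n)))"

text \<open>The first point is always chosen as extremity: then the position of the stick is
  determined by the two points. The far extremity is the second of the two points that are added,
  hence the position \<open>n + 1\<close>.\<close>
definition lay :: "nat \<Rightarrow> nat \<Rightarrow> (nat \<times> nat) prog" where
  "lay i j = (\<lambda>(n, k). Step (Lay i j True False) (\<lambda>_. Finish ((n + 1, k), (n + 2, k + 1))))"

definition pick :: "nat \<Rightarrow> nat prog" where
  "pick s = (\<lambda>(n, k). Step (Choose s True) (\<lambda>_. Finish (n, (n + 1, k))))"

definition free_end :: "nat \<Rightarrow> nat list \<Rightarrow> nat prog" where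
  "free_end i ks = (\<lambda>(n, k). Step (Ruler_Free i ks) (\<lambda>_. Finish (n, (n + 1, k))))"

definition ruler :: "nat \<Rightarrow> nat list \<Rightarrow> nat list prog" where
  "ruler i ks = (\<lambda>(n, k). Step (Ruler_On i ks) (\<lambda>obs.
     case obs of Found r \<Rightarrow> Finish ([n..<n + r], (n + r, k)) | _ \<Rightarrow> Finish ([], (n, k))))"

text \<open>Meant for sticks that are known to meet in a single point, so the observation carries
  no information.\<close>
definition intersection :: "nat \<Rightarrow> nat \<Rightarrow> nat prog" where
  "intersection s t = (\<lambda>(n, k). Step (Intersect s t) (\<lambda>_. Finish (n, (n + 1, k))))"

lemma ensures_compare:
  assumes "given_point c i p" "given_point c j q"
  shows "ensures c (compare i j) (\<lambda>obs _. obs = compare_unit (dist p q))"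
  unfolding ensures_def compare_def
proof (intro allI impI achieves.step, goal_cases)
  case (1 c')
  then have "given_point c' i p" "given_point c' j q"
    using assms by (auto dest: given_point_mono)
  then show ?case by auto
next
  case (2 c' obs c'')
  have "given_point c' i p" "given_point c' j q"
    using assms 2(1) by (auto dest: given_point_mono)
  with 2(2) have "obs = compare_unit (dist p q)" "c'' = c'"
    by (auto simp: given_point_iff)
  then show ?case by (auto intro!: achieves.finish)
qed

text \<open>Sticks are parametrised by their direction, which turns membership into a condition on
  one real number.\<close>
lemma segment_ray: "segment (p, p + w) = {p + a *\<^sub>R w | a. 0 \<le> a \<and> a \<le> 1}"
  unfolding segment_def closed_segment_def by (auto simp: algebra_simps)

text \<open>A second stick from \<open>p\<close> through the same point would have to point in the
  same direction with the same length; hence the outcome is unique.\<close>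
lemma ensures_lay:
  assumes p: "given_point c i p" and q: "given_point c j (p + a *\<^sub>R w)"
    and w: "norm w = 1" and a: "0 < a" "a \<le> 1"
  shows "ensures c (lay i j) (\<lambda>(b, k) c'. given_point c' b (p + w) \<and> given_stick c' k (p, p + w))"
  unfolding ensures_def
proof (intro allI impI)
  fix c' assume c': "c \<sqsubseteq> c'"
  have p': "given_point c' i p" and q': "given_point c' j (p + a *\<^sub>R w)"
    using p q c' by (auto dest: given_point_mono)
  have d: "dist p (p + w) = 1"
    using w by (simp add: dist_norm)
  have seg: "p \<in> segment (p, p + w)" "p + a *\<^sub>R w \<in> segment (p, p + w)"
    unfolding segment_ray using a by (auto intro: exI[of _ a] exI[of _ 0])
  have "w \<noteq> 0" using w by auto
  have ne: "p \<noteq> p + a *\<^sub>R w" using a \<open>w \<noteq> 0\<close> by auto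
  have uniq: "y = p + w" if y: "dist p y = 1" "p + a *\<^sub>R w \<in> segment (p, y)" for y
  proof -
    have "segment (p, p + (y - p)) = {p + a *\<^sub>R (y - p) | a. 0 \<le> a \<and> a \<le> 1}"
      by (rule segment_ray)
    with y obtain b where b: "a *\<^sub>R w = b *\<^sub>R (y - p)" "0 \<le> b" by auto
    have "a = norm (a *\<^sub>R w)" using a w by simp
    also have "\<dots> = norm (b *\<^sub>R (y - p))" using b by simp
    also have "\<dots> = b" using y b by (simp add: dist_norm norm_minus_commute)
    finally have "b = a" by simp
    with b a have "w = y - p" by simp
    then show ?thesis by simp
  qed
  have "outcomes (Lay i j True False) c' = {(Done, extend c' [p, y] [(p, y)]) | y.
      dist p y = 1 \<and> p \<in> segment (p, y) \<and> p + a *\<^sub>R w \<in> segment (p, y)}"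
    using ne by (auto simp: given_point_iff[OF p'] given_point_iff[OF q'])
  also have "\<dots> = {(Done, extend c' [p, p + w] [(p, p + w)])}"
    using d seg uniq by blast
  finally have "outcomes (Lay i j True False) c' = {(Done, extend c' [p, p + w] [(p, p + w)])}" .
  then show "achieves (\<lambda>(r, n) c''. n = counts c'' \<and> c' \<sqsubseteq> c'' \<and>
      (case r of (b, k) \<Rightarrow> \<lambda>c'. given_point c' b (p + w) \<and> given_stick c' k (p, p + w)) c'')
      (lay i j (counts c')) c'"
    unfolding lay_def counts_def
    by (auto intro!: achieves.step achieves.finish simp: counts_def given_point_def given_stick_def nth_append)
qed

lemma ensures_pick:
  assumes "given_stick c k (p, p + w)" and w: "w \<noteq> 0"
  shows "ensures c (pick k) (\<lambda>i c'. \<exists>a. 0 < a \<and> a < 1 \<and> given_point c' i (p + a *\<^sub>R w))"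
  unfolding ensures_def
proof (intro allI impI)
  fix c' assume c': "c \<sqsubseteq> c'"
  have s: "given_stick c' k (p, p + w)"
    using assms c' by (auto dest: given_stick_mono)
  have eq: "outcomes (Choose k True) c' = {(Done, extend c' [p + a *\<^sub>R w] []) | a. 0 < a \<and> a < 1}"
    (is "?L = ?R")
  proof (intro equalityI subsetI)
    fix r assume "r \<in> ?L"
    then obtain x where x: "r = (Done, extend c' [x] [])" "x \<in> segment (p, p + w)" "x \<noteq> p" "x \<noteq> p + w"
      using s by (auto simp: given_stick_iff)
    then obtain a where a: "x = p + a *\<^sub>R w" "0 \<le> a" "a \<le> 1" unfolding segment_ray by auto
    then have "a \<noteq> 0" "a \<noteq> 1" using x by auto
    then show "r \<in> ?R" using x a by (auto intro!: exI[of _ a])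
  next
    fix r assume "r \<in> ?R"
    then obtain a where a: "r = (Done, extend c' [p + a *\<^sub>R w] [])" "0 < a" "a < 1" by auto
    have "p + a *\<^sub>R w \<in> segment (p, p + w)" unfolding segment_ray using a by (auto intro!: exI[of _ a])
    moreover have "a *\<^sub>R w \<noteq> 1 *\<^sub>R w" using a w by (subst scaleR_cancel_right) auto
    ultimately show "r \<in> ?L" using a s w by (auto simp: given_stick_iff)
  qed
  have "(1/2::real) > 0 \<and> (1/2::real) < 1" by simp
  then have ne: "outcomes (Choose k True) c' \<noteq> {}" unfolding eq by blast
  show "achieves (\<lambda>(r, n) c''. n = counts c'' \<and> c' \<sqsubseteq> c'' \<and>
      (\<exists>a. 0 < a \<and> a < 1 \<and> given_point c'' r (p + a *\<^sub>R w)))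
      (pick k (counts c')) c'"
    unfolding pick_def counts_def prod.case
  proof (rule achieves.step[OF ne])
    fix obs c'' assume "(obs, c'') \<in> outcomes (Choose k True) c'"
    then show "achieves (\<lambda>(r, n) c''. n = (length (points c''), length (sticks c'')) \<and> c' \<sqsubseteq> c'' \<and>
      (\<exists>a. 0 < a \<and> a < 1 \<and> given_point c'' r (p + a *\<^sub>R w)))
      (Finish (length (points c'), length (points c') + 1, length (sticks c'))) c''"
      unfolding eq by (auto intro!: achieves.finish simp: given_point_def)
  qed
qed

lemma given_sticks_list:
  assumes "list_all2 (given_stick c) ks ss"
  shows "given_sticks c ks S \<longleftrightarrow> S = set ss"
  using assms
proof (induction arbitrary: S rule: list_all2_induct)
  case Nil
  then show ?case by (simp add: given_sticks_def)
next
  case (Cons x xs y ys)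
  then show ?case by (auto simp: given_sticks_def given_stick_def)
qed

lemma ensures_ruler:
  assumes p: "given_point c i p"
    and ks: "list_all2 (given_stick c) ks ss"
    and fin: "finite {x \<in> (\<Union>s\<in>set ss. segment s). dist p x = 1}"
  shows "ensures c (ruler i ks) (\<lambda>is c'. \<exists>xs. distinct xs \<and>
      set xs = {x \<in> (\<Union>s\<in>set ss. segment s). dist p x = 1} \<and> list_all2 (given_point c') is xs)"
    (is "ensures c _ (\<lambda>is c'. \<exists>xs. distinct xs \<and> set xs = ?X \<and> _ c' is xs)")
  unfolding ensures_def
proof (intro allI impI)
  fix c' assume c': "c \<sqsubseteq> c'"
  have p': "given_point c' i p" using p c' by (rule given_point_mono)
  have "list_all2 (given_stick c') ks ss"
    using ks by (rule list_all2_mono) (rule given_stick_mono[OF _ c'])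
  note ss = given_sticks_list[OF this]
  have eq: "outcomes (Ruler_On i ks) c' = {(Found (length xs), extend c' xs []) | xs. distinct xs \<and> set xs = ?X}"
    using p' ss by (auto simp: given_point_iff)
  obtain xs where "distinct xs" "set xs = ?X"
    using finite_distinct_list[OF fin] by blast
  then have ne: "outcomes (Ruler_On i ks) c' \<noteq> {}" unfolding eq by blast
  show "achieves (\<lambda>(is, n) c''. n = counts c'' \<and> c' \<sqsubseteq> c'' \<and>
      (\<exists>xs. distinct xs \<and> set xs = ?X \<and> list_all2 (given_point c'') is xs)) (ruler i ks (counts c')) c'"
    unfolding ruler_def counts_def prod.case
  proof (rule achieves.step[OF ne], goal_cases)
    case (1 obs c'')
    then obtain xs where xs: "obs = Found (length xs)" "c'' = extend c' xs []" "distinct xs" "set xs = ?X"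
      unfolding eq by blast
    have "list_all2 (given_point c'') [length (points c')..<length (points c') + length xs] xs"
      unfolding xs by (auto simp: list_all2_conv_all_nth given_point_def)
    then show ?case using xs by (auto intro!: achieves.finish)
  qed
qed

lemma ensures_free_end:
  assumes p: "given_point c i p"
    and ks: "list_all2 (given_stick c) ks ss"
    and ex: "\<exists>x. dist p x = 1 \<and> x \<notin> (\<Union>s\<in>set ss. segment s)"
  shows "ensures c (free_end i ks) (\<lambda>j c'. \<exists>x. given_point c' j x \<and> dist p x = 1 \<and> x \<notin> (\<Union>s\<in>set ss. segment s))"
  unfolding ensures_def
proof (intro allI impI)
  fix c' assume c': "c \<sqsubseteq> c'"
  have p': "given_point c' i p" using p c' by (rule given_point_mono)
  have "list_all2 (given_stick c') ks ss"
    using ks by (rule list_all2_mono) (rule given_stick_mono[OF _ c'])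
  note ss = given_sticks_list[OF this]
  have eq: "outcomes (Ruler_Free i ks) c' =
      {(Done, extend c' [x] []) | x. dist p x = 1 \<and> x \<notin> (\<Union>s\<in>set ss. segment s)}"
    using p' ss by (auto simp: given_point_iff)
  have ne: "outcomes (Ruler_Free i ks) c' \<noteq> {}" unfolding eq using ex by blast
  show "achieves (\<lambda>(j, n) c''. n = counts c'' \<and> c' \<sqsubseteq> c'' \<and>
      (\<exists>x. given_point c'' j x \<and> dist p x = 1 \<and> x \<notin> (\<Union>s\<in>set ss. segment s))) (free_end i ks (counts c')) c'"
    unfolding free_end_def counts_def prod.case
  proof (rule achieves.step[OF ne], goal_cases)
    case (1 obs c'')
    then obtain x where x: "c'' = extend c' [x] []" "dist p x = 1" "x \<notin> (\<Union>s\<in>set ss. segment s)"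
      unfolding eq by blast
    then show ?case by (auto intro!: achieves.finish simp: given_point_def)
  qed
qed

lemma ensures_intersection:
  assumes s: "given_stick c i s" and t: "given_stick c j t" and x: "segment s \<inter> segment t = {x}"
  shows "ensures c (intersection i j) (\<lambda>k c'. given_point c' k x)"
  unfolding ensures_def
proof (intro allI impI)
  fix c' assume c': "c \<sqsubseteq> c'"
  have st: "given_stick c' i s" "given_stick c' j t"
    using s t c' by (auto dest: given_stick_mono)
  have "outcomes (Intersect i j) c' = {(Found 1, extend c' [x] [])}"
    using x by (auto simp: given_stick_iff[OF st(1)] given_stick_iff[OF st(2)])
  then show "achieves (\<lambda>(r, n) c''. n = counts c'' \<and> c' \<sqsubseteq> c'' \<and> given_point c'' r x)
      (intersection i j (counts c')) c'"
    unfolding intersection_def counts_def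
    by (auto intro!: achieves.step achieves.finish simp: counts_def given_point_def)
qed

section \<open>Points computed from points\<close>

text \<open>The point \<open>x\<close> is the same in all runs: whatever \<open>m\<close> chooses
  arbitrarily must not influence the result.\<close>
definition computes :: "config \<Rightarrow> nat prog \<Rightarrow> point \<Rightarrow> bool" where
  "computes c m x \<longleftrightarrow> ensures c m (\<lambda>i c'. given_point c' i x)"

lemma computes_mono: "computes c m x \<Longrightarrow> c \<sqsubseteq> c' \<Longrightarrow> computes c' m x"
  unfolding computes_def by (rule ensures_mono)

lemma computes_give: "given_point c i x \<Longrightarrow> computes c (give i) x"
  unfolding computes_def by (rule ensures_give) (rule given_point_mono)

lemma ensures_bind_point:
  assumes "computes c m x" "\<And>i c'. c \<sqsubseteq> c' \<Longrightarrow> given_point c' i x \<Longrightarrow> ensures c' (f i) R"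
  shows "ensures c (m \<bind> f) R"
  using assms unfolding computes_def by (rule ensures_bind)

definition rod :: "nat prog \<Rightarrow> nat prog \<Rightarrow> (nat \<times> nat) prog" where
  "rod p q = do { i \<leftarrow> p; j \<leftarrow> q; lay i j }"

definition tip :: "nat prog \<Rightarrow> nat prog \<Rightarrow> nat prog" where
  "tip p q = do { (b, _) \<leftarrow> rod p q; give b }"

definition meet :: "nat prog \<Rightarrow> nat prog \<Rightarrow> nat prog \<Rightarrow> nat prog \<Rightarrow> nat prog" where
  "meet p q r s = do { (_, k) \<leftarrow> rod p q; (_, l) \<leftarrow> rod r s; intersection k l }"

text \<open>Meant for a stick that meets the unit circle around \<open>z\<close> exactly once;
  with two common points the head of the list would be an arbitrary one of them.\<close>
definition strike :: "nat prog \<Rightarrow> nat prog \<Rightarrow> nat prog \<Rightarrow> nat prog" where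
  "strike z p q = do { i \<leftarrow> z; (_, k) \<leftarrow> rod p q; xs \<leftarrow> ruler i [k]; give (hd xs) }"

text \<open>Continues the unit stick from \<open>p\<close> to \<open>q\<close> by another unit. A
  stick laid from \<open>p\<close> through \<open>q\<close> ends at \<open>q\<close>, so an
  arbitrary interior point is used to get past it: the stick from there through \<open>q\<close>
  sticks out beyond \<open>q\<close> and shows the direction. The choice cancels out.\<close>
definition beyond :: "nat prog \<Rightarrow> nat prog \<Rightarrow> nat prog" where
  "beyond p q = do { (b, k) \<leftarrow> rod p q; x \<leftarrow> pick k; tip (give b) (tip (give x) (give b)) }"

lemma ensures_rod:
  assumes p: "computes c mp p" and q: "computes c mq (p + a *\<^sub>R w)" and w: "norm w = 1" and a: "0 < a" "a \<le> 1"
  shows "ensures c (rod mp mq) (\<lambda>(b, k) c'. given_point c' b (p + w) \<and> given_stick c' k (p, p + w))"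
  unfolding rod_def
proof (rule ensures_bind_point[OF p], rule ensures_bind_point, erule computes_mono[OF q], goal_cases)
  case (1 i c1 j c2)
  then have "given_point c2 i p" using given_point_mono by blast
  then show ?case using 1(4) w a by (rule ensures_lay)
qed

lemma computes_tip:
  assumes "computes c mp p" "computes c mq (p + a *\<^sub>R w)" "norm w = 1" "0 < a" "a \<le> 1"
  shows "computes c (tip mp mq) (p + w)"
  unfolding computes_def tip_def
  by (rule ensures_bind[OF ensures_rod[OF assms]]) (auto intro!: ensures_give dest: given_point_mono)

text \<open>Linear independence of the two directions excludes overlapping sticks.\<close>
lemma computes_meet:
  assumes p: "computes c mp p" and q: "computes c mq (p + a *\<^sub>R w)" and w: "norm w = 1" and a: "0 < a" "a \<le> 1"
    and r: "computes c mr r" and s: "computes c ms (r + b *\<^sub>R z)" and z: "norm z = 1" and b: "0 < b" "b \<le> 1"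
    and x: "x = p + \<alpha> *\<^sub>R w" "0 \<le> \<alpha>" "\<alpha> \<le> 1" "x = r + \<beta> *\<^sub>R z" "0 \<le> \<beta>" "\<beta> \<le> 1"
    and indep: "\<And>\<sigma> \<tau>. \<sigma> *\<^sub>R w = \<tau> *\<^sub>R z \<Longrightarrow> \<sigma> = 0"
  shows "computes c (meet mp mq mr ms) x"
  unfolding computes_def meet_def
proof (rule ensures_bind[OF ensures_rod[OF p q w a]], clarify,
    rule ensures_bind, rule ensures_rod, erule computes_mono[OF r], erule computes_mono[OF s],
    rule z, rule b, rule b, clarify)
  fix b k c1 b' l c2
  assume "given_stick c1 k (p, p + w)" "c1 \<sqsubseteq> c2" and l: "given_stick c2 l (r, r + z)"
  then have k: "given_stick c2 k (p, p + w)" by (blast dest: given_stick_mono)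
  have "segment (p, p + w) \<inter> segment (r, r + z) = {x}"
  proof (intro equalityI subsetI)
    fix y assume "y \<in> segment (p, p + w) \<inter> segment (r, r + z)"
    then obtain \<sigma> \<tau> where y: "y = p + \<sigma> *\<^sub>R w" "y = r + \<tau> *\<^sub>R z"
      unfolding segment_ray by blast
    have "(\<sigma> - \<alpha>) *\<^sub>R w = y - x" using y x by (simp add: algebra_simps)
    also have "\<dots> = (\<tau> - \<beta>) *\<^sub>R z" unfolding y(2) x(4) by (simp add: algebra_simps)
    finally have "\<sigma> - \<alpha> = 0" by (rule indep)
    then show "y \<in> {x}" using y x by simp
  next
    fix y assume "y \<in> {x}"
    then show "y \<in> segment (p, p + w) \<inter> segment (r, r + z)"
      unfolding segment_ray using x by blast
  qed
  then show "ensures c2 (intersection k l) (\<lambda>i c'. given_point c' i x)"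
    using k l by (intro ensures_intersection)
qed

lemma computes_strike:
  assumes o: "computes c mo o'"
    and p: "computes c mp p" and q: "computes c mq (p + a *\<^sub>R w)" and w: "norm w = 1" and a: "0 < a" "a \<le> 1"
    and t: "0 \<le> \<tau>" "\<tau> \<le> 1" "dist o' (p + \<tau> *\<^sub>R w) = 1"
    and uniq: "\<And>\<sigma>. 0 \<le> \<sigma> \<Longrightarrow> \<sigma> \<le> 1 \<Longrightarrow> dist o' (p + \<sigma> *\<^sub>R w) = 1 \<Longrightarrow> \<sigma> = \<tau>"
  shows "computes c (strike mo mp mq) (p + \<tau> *\<^sub>R w)"
  unfolding computes_def strike_def
proof (rule ensures_bind_point[OF o], rule ensures_bind, rule ensures_rod, erule computes_mono[OF p],
    erule computes_mono[OF q], rule w, rule a, rule a, clarify)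
  fix i c1 b k c2
  assume "given_point c1 i o'" "c1 \<sqsubseteq> c2" and k: "given_stick c2 k (p, p + w)"
  then have i: "given_point c2 i o'" by (blast dest: given_point_mono)
  have eq: "{x \<in> \<Union> (segment ` set [(p, p + w)]). dist o' x = 1} = {p + \<tau> *\<^sub>R w}"
    (is "?X = _")
  proof (intro equalityI subsetI)
    fix x assume "x \<in> ?X"
    then obtain \<sigma> where s: "x = p + \<sigma> *\<^sub>R w" "0 \<le> \<sigma>" "\<sigma> \<le> 1" "dist o' x = 1"
      by (auto simp: segment_ray)
    then show "x \<in> {p + \<tau> *\<^sub>R w}" using uniq[of \<sigma>] by simp
  next
    fix x assume "x \<in> {p + \<tau> *\<^sub>R w}"
    then show "x \<in> ?X" using t by (auto simp: segment_ray)
  qed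
  show "ensures c2 (ruler i [k] \<bind> (\<lambda>xs. give (hd xs))) (\<lambda>i c'. given_point c' i (p + \<tau> *\<^sub>R w))"
  proof (rule ensures_bind, rule ensures_ruler[OF i, of "[k]" "[(p, p + w)]"])
    show "list_all2 (given_stick c2) [k] [(p, p + w)]" using k by simp
    show "finite {x \<in> \<Union> (segment ` set [(p, p + w)]). dist o' x = 1}" unfolding eq by simp
  next
    fix xs c3
    assume "\<exists>ys. distinct ys \<and> set ys = {x \<in> \<Union> (segment ` set [(p, p + w)]). dist o' x = 1} \<and>
      list_all2 (given_point c3) xs ys"
    then obtain ys where "distinct ys" "set ys = {p + \<tau> *\<^sub>R w}" "list_all2 (given_point c3) xs ys"
      unfolding eq by blast
    then have "given_point c3 (hd xs) (p + \<tau> *\<^sub>R w)"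
      by (cases ys) (auto simp: list_all2_Cons2)
    then show "ensures c3 (give (hd xs)) (\<lambda>i c'. given_point c' i (p + \<tau> *\<^sub>R w))"
      by (intro ensures_give) (rule given_point_mono)
  qed
qed

lemma computes_beyond:
  assumes p: "computes c mp p" and q: "computes c mq (p + w)" and w: "norm w = 1"
  shows "computes c (beyond mp mq) (p + 2 *\<^sub>R w)"
proof -
  have rod: "ensures c (rod mp mq) (\<lambda>(b, k) c'. given_point c' b (p + w) \<and> given_stick c' k (p, p + w))"
    by (rule ensures_rod[OF p, of mq 1 w]) (use q w in simp_all)
  have w0: "w \<noteq> 0" using w by auto
  have "ensures c2 (tip (give b) (tip (give x) (give b))) (\<lambda>i c'. given_point c' i (p + 2 *\<^sub>R w))"
    if b: "given_point c1 b (p + w)" and c12: "c1 \<sqsubseteq> c2"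
      and a: "0 < a" "a < 1" and x: "given_point c2 x (p + a *\<^sub>R w)" for b c1 x c2 a
  proof -
    have split: "p + w = (p + a *\<^sub>R w) + (1 - a) *\<^sub>R w" "(p + a *\<^sub>R w) + w = (p + w) + a *\<^sub>R w"
      "p + 2 *\<^sub>R w = (p + w) + w"
      by (simp_all add: algebra_simps scaleR_2)
    have b': "computes c2 (give b) (p + w)" using b c12 by (intro computes_give) (rule given_point_mono)
    have "computes c2 (tip (give x) (give b)) ((p + a *\<^sub>R w) + w)"
      by (rule computes_tip[OF computes_give[OF x] b'[unfolded split(1)] w]) (use a in simp_all)
    then have "computes c2 (tip (give b) (tip (give x) (give b))) ((p + w) + w)"
      unfolding split(2) by (rule computes_tip[OF b' _ w]) (use a in simp_all)
    then show ?thesis unfolding computes_def split(3) .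
  qed
  then show ?thesis
    unfolding computes_def beyond_def using w0
    by (intro ensures_bind[OF rod]) (auto intro!: ensures_bind[OF ensures_pick])
qed

section \<open>Orthonormal coordinates\<close>

text \<open>The point with coordinates \<open>x\<close> and \<open>y\<close> in the frame with
  origin \<open>z\<close> and axes \<open>u\<close> and \<open>v\<close>. The frame is never known
  to a construction; it serves to state what is constructed.\<close>
definition pt :: "complex \<Rightarrow> complex \<Rightarrow> complex \<Rightarrow> real \<Rightarrow> real \<Rightarrow> point" where
  "pt z u v x y = z + x *\<^sub>R u + y *\<^sub>R v"

lemma pt_swap: "pt z v u x y = pt z u v y x"
  by (simp add: pt_def)

lemma pt_shift: "pt (pt z u v i j) u v x y = pt z u v (i + x) (j + y)"
  by (simp add: pt_def algebra_simps)

locale frame =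
  fixes z u v :: complex
  assumes norm_u: "norm u = 1" and norm_v: "norm v = 1" and orthogonal: "inner u v = 0"
begin

abbreviation P :: "real \<Rightarrow> real \<Rightarrow> point" where "P \<equiv> pt z u v"

text \<open>Exchanging the axes turns every statement about rows into one about columns.\<close>
lemma swap: "frame v u"
  using norm_u norm_v orthogonal by unfold_locales (auto simp: inner_commute)

lemma norm_comb: "(norm (x *\<^sub>R u + y *\<^sub>R v))\<^sup>2 = x\<^sup>2 + y\<^sup>2"
proof -
  have "inner u u = 1" "inner v v = 1"
    using norm_u norm_v by (simp_all add: norm_eq_1)
  then show ?thesis
    unfolding power2_norm_eq_inner using orthogonal
    by (simp add: inner_add_left inner_add_right inner_commute[of v u] power2_eq_square)
qed

lemma dist_P: "(dist (P x y) (P x' y'))\<^sup>2 = (x - x')\<^sup>2 + (y - y')\<^sup>2"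
proof -
  have "P x y - P x' y' = (x - x') *\<^sub>R u + (y - y') *\<^sub>R v"
    by (simp add: pt_def algebra_simps)
  then show ?thesis by (simp add: dist_norm norm_comb)
qed

lemma dist_P_sqrt: "dist (P x y) (P x' y') = sqrt ((x - x')\<^sup>2 + (y - y')\<^sup>2)"
  by (metis dist_P real_sqrt_abs abs_of_nonneg zero_le_dist)

lemma dist_P_eq_1: "dist (P x y) (P x' y') = 1 \<longleftrightarrow> (x - x')\<^sup>2 + (y - y')\<^sup>2 = 1"
  unfolding dist_P_sqrt by simp

lemma dist_P_le_1: "dist (P x y) (P x' y') \<le> 1 \<longleftrightarrow> (x - x')\<^sup>2 + (y - y')\<^sup>2 \<le> 1"
  unfolding dist_P_sqrt by simp

lemma P_eq_iff: "P x y = P x' y' \<longleftrightarrow> x = x' \<and> y = y'"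
proof -
  have "P x y = P x' y' \<longleftrightarrow> (dist (P x y) (P x' y'))\<^sup>2 = 0" by simp
  then show ?thesis unfolding dist_P by (simp add: sum_power2_eq_zero_iff)
qed

lemma computes_abscissa: "computes c m (P x w) \<Longrightarrow> x = x' \<Longrightarrow> computes c m (P x' w)"
  by simp

text \<open>Orthonormal vectors have determinant \<open>D = \<plusminus>1\<close>, so Cramer's
  rule applies.\<close>
lemma P_surj: "\<exists>x y. w = P x y"
proof -
  define D where "D = Re u * Im v - Im u * Re v"
  have uv: "Re u * Re v + Im u * Im v = 0" "(Re u)\<^sup>2 + (Im u)\<^sup>2 = 1" "(Re v)\<^sup>2 + (Im v)\<^sup>2 = 1"
    using orthogonal norm_u norm_v by (simp_all add: inner_complex_def cmod_def)
  have "D\<^sup>2 + (Re u * Re v + Im u * Im v)\<^sup>2 = ((Re u)\<^sup>2 + (Im u)\<^sup>2) * ((Re v)\<^sup>2 + (Im v)\<^sup>2)"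
    unfolding D_def by (simp add: power2_eq_square algebra_simps)
  then have D: "D \<noteq> 0" using uv by auto
  define a where "a = Re (w - z)"
  define b where "b = Im (w - z)"
  have "((a * Im v - b * Re v) * Re u + (b * Re u - a * Im u) * Re v) = a * D"
    "((a * Im v - b * Re v) * Im u + (b * Re u - a * Im u) * Im v) = b * D"
    unfolding D_def by (simp_all add: algebra_simps)
  then have "(a * Im v - b * Re v) / D * Re u + (b * Re u - a * Im u) / D * Re v = a"
    "(a * Im v - b * Re v) / D * Im u + (b * Re u - a * Im u) / D * Im v = b"
    using D by (simp_all add: field_simps)
  then have "w = P ((a * Im v - b * Re v) / D) ((b * Re u - a * Im u) / D)"
    unfolding a_def b_def by (simp add: pt_def complex_eq_iff)
  then show ?thesis by blast
qed

lemma unit_direction: "d\<^sup>2 + e\<^sup>2 = 1 \<Longrightarrow> norm (d *\<^sub>R u + e *\<^sub>R v) = 1"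
  using norm_comb[of d e] by (metis norm_ge_zero one_power2 power2_eq_imp_eq zero_le_one)

lemma P_add: "P (x + a * d) (y + a * e) = P x y + a *\<^sub>R (d *\<^sub>R u + e *\<^sub>R v)"
  by (simp add: pt_def algebra_simps)

lemma tip_dir:
  assumes "computes c mp (P x y)" "computes c mq (P (x + a * d) (y + a * e))"
    "d\<^sup>2 + e\<^sup>2 = 1" "0 < a" "a \<le> 1"
  shows "computes c (tip mp mq) (P (x + d) (y + e))"
  using computes_tip[OF assms(1) assms(2)[unfolded P_add] unit_direction[OF assms(3)] assms(4,5)]
    P_add[of x 1 d y e] by simp

lemma tip_right:
  assumes "computes c mp (P x y)" "computes c mq (P x' y)" "x < x'" "x' \<le> x + 1"
  shows "computes c (tip mp mq) (P (x + 1) y)"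
  using tip_dir[of c mp x y mq "x' - x" 1 0] assms by simp

lemma tip_left:
  assumes "computes c mp (P x y)" "computes c mq (P x' y)" "x' < x" "x \<le> x' + 1"
  shows "computes c (tip mp mq) (P (x - 1) y)"
  using tip_dir[of c mp x y mq "x - x'" "-1" 0] assms by simp

lemma tip_up:
  assumes "computes c mp (P x y)" "computes c mq (P x y')" "y < y'" "y' \<le> y + 1"
  shows "computes c (tip mp mq) (P x (y + 1))"
  using tip_dir[of c mp x y mq "y' - y" 0 1] assms by simp

lemma tip_down:
  assumes "computes c mp (P x y)" "computes c mq (P x y')" "y' < y" "y \<le> y' + 1"
  shows "computes c (tip mp mq) (P x (y - 1))"
  using tip_dir[of c mp x y mq "y - y'" 0 "-1"] assms by simp

lemma beyond_P:
  assumes "computes c mp (P x y)" "computes c mq (P x' y')" "(x' - x)\<^sup>2 + (y' - y)\<^sup>2 = 1"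
  shows "computes c (beyond mp mq) (P (2 * x' - x) (2 * y' - y))"
proof -
  let ?w = "(x' - x) *\<^sub>R u + (y' - y) *\<^sub>R v"
  have "P x' y' = P x y + ?w"
    by (simp add: pt_def algebra_simps)
  moreover have "P (2 * x' - x) (2 * y' - y) = P x y + 2 *\<^sub>R ?w"
    using P_add[of x 2 "x' - x" y "y' - y"] by (simp add: algebra_simps)
  ultimately show ?thesis
    using computes_beyond[OF assms(1) _ unit_direction[OF assms(3)], of mq] assms(2) by simp
qed

lemma meet_P:
  assumes p: "computes c mp (P x1 y1)" and q: "computes c mq (P x2 y2)"
    and r: "computes c mr (P x3 y3)" and s: "computes c ms (P x4 y4)"
    and pq: "(x2 - x1)\<^sup>2 + (y2 - y1)\<^sup>2 \<le> 1" and rs: "(x4 - x3)\<^sup>2 + (y4 - y3)\<^sup>2 \<le> 1"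
    and x: "x = x1 + \<alpha> * (x2 - x1)" "y = y1 + \<alpha> * (y2 - y1)" "0 \<le> \<alpha>" "(x - x1)\<^sup>2 + (y - y1)\<^sup>2 \<le> 1"
    and x': "x = x3 + \<beta> * (x4 - x3)" "y = y3 + \<beta> * (y4 - y3)" "0 \<le> \<beta>" "(x - x3)\<^sup>2 + (y - y3)\<^sup>2 \<le> 1"
    and cross: "(x2 - x1) * (y4 - y3) \<noteq> (y2 - y1) * (x4 - x3)"
  shows "computes c (meet mp mq mr ms) (P x y)"
proof -
  define l where "l = sqrt ((x2 - x1)\<^sup>2 + (y2 - y1)\<^sup>2)"
  define k where "k = sqrt ((x4 - x3)\<^sup>2 + (y4 - y3)\<^sup>2)"
  have "x2 - x1 \<noteq> 0 \<or> y2 - y1 \<noteq> 0" "x4 - x3 \<noteq> 0 \<or> y4 - y3 \<noteq> 0" using cross by auto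
  then have l0: "l > 0" and k0: "k > 0"
    unfolding l_def k_def by (simp_all add: sum_power2_gt_zero_iff)
  have l2: "l\<^sup>2 = (x2 - x1)\<^sup>2 + (y2 - y1)\<^sup>2" and k2: "k\<^sup>2 = (x4 - x3)\<^sup>2 + (y4 - y3)\<^sup>2"
    unfolding l_def k_def by simp_all
  have l1: "l \<le> 1" and k1: "k \<le> 1" unfolding l_def k_def using pq rs by simp_all
  define d where "d = (x2 - x1) / l"
  define e where "e = (y2 - y1) / l"
  define f where "f = (x4 - x3) / k"
  define g where "g = (y4 - y3) / k"
  have d: "x2 - x1 = l * d" "y2 - y1 = l * e" and f: "x4 - x3 = k * f" "y4 - y3 = k * g"
    unfolding d_def e_def f_def g_def using l0 k0 by simp_all
  have de: "d\<^sup>2 + e\<^sup>2 = 1" and fg: "f\<^sup>2 + g\<^sup>2 = 1"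
    unfolding d_def e_def f_def g_def power_divide add_divide_distrib[symmetric] l2[symmetric] k2[symmetric]
    using l0 k0 by simp_all
  have "x2 = x1 + l * d" "y2 = y1 + l * e" "x4 = x3 + k * f" "y4 = y3 + k * g" using d f by simp_all
  then have q': "computes c mq (P x1 y1 + l *\<^sub>R (d *\<^sub>R u + e *\<^sub>R v))"
    and s': "computes c ms (P x3 y3 + k *\<^sub>R (f *\<^sub>R u + g *\<^sub>R v))"
    using q s by (simp_all add: P_add)
  have "(\<alpha> * l)\<^sup>2 = (x - x1)\<^sup>2 + (y - y1)\<^sup>2"
    unfolding x(1,2) power_mult_distrib l2 by (simp add: power_mult_distrib distrib_left)
  then have "(\<alpha> * l)\<^sup>2 \<le> 1\<^sup>2" using x(4) by simp
  then have al: "\<alpha> * l \<le> 1" by (rule power2_le_imp_le) simp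
  have "(\<beta> * k)\<^sup>2 = (x - x3)\<^sup>2 + (y - y3)\<^sup>2"
    unfolding x'(1,2) power_mult_distrib k2 by (simp add: power_mult_distrib distrib_left)
  then have "(\<beta> * k)\<^sup>2 \<le> 1\<^sup>2" using x'(4) by simp
  then have bk: "\<beta> * k \<le> 1" by (rule power2_le_imp_le) simp
  show ?thesis
  proof (rule computes_meet[OF p q' unit_direction[OF de] l0 l1 r s' unit_direction[OF fg] k0 k1 _ _ al _ _ bk])
    show "P x y = P x1 y1 + (\<alpha> * l) *\<^sub>R (d *\<^sub>R u + e *\<^sub>R v)"
      unfolding P_add[symmetric] x d by (simp add: algebra_simps)
    show "P x y = P x3 y3 + (\<beta> * k) *\<^sub>R (f *\<^sub>R u + g *\<^sub>R v)"
      unfolding P_add[symmetric] x' f by (simp add: algebra_simps)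
    show "0 \<le> \<alpha> * l" "0 \<le> \<beta> * k" using x(3) x'(3) l0 k0 by simp_all
  next
    fix \<sigma> \<tau> :: real assume "\<sigma> *\<^sub>R (d *\<^sub>R u + e *\<^sub>R v) = \<tau> *\<^sub>R (f *\<^sub>R u + g *\<^sub>R v)"
    then have "P (0 + \<sigma> * d) (0 + \<sigma> * e) = P (0 + \<tau> * f) (0 + \<tau> * g)" unfolding P_add by simp
    then have eq: "\<sigma> * d = \<tau> * f" "\<sigma> * e = \<tau> * g" unfolding P_eq_iff by simp_all
    have "\<sigma> * (d * g - e * f) = 0" using eq by algebra
    moreover have "d * g \<noteq> e * f" using cross unfolding d f by auto
    ultimately show "\<sigma> = 0" by simp
  qed
qed

text \<open>On the line of the stick the unit circle is a quadratic equation in the parameter. The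
  second root \<open>\<sigma>\<close> is known from the sum of the roots, and it must coincide
  with \<open>\<tau>\<close> or miss the stick.\<close>
lemma strike_P:
  assumes o: "computes c mo (P cx cy)"
    and p: "computes c mp (P x1 y1)" and q: "computes c mq (P (x1 + a * d) (y1 + a * e))"
    and de: "d\<^sup>2 + e\<^sup>2 = 1" and a: "0 < a" "a \<le> 1"
    and t: "0 \<le> \<tau>" "\<tau> \<le> 1" and hit: "(x1 + \<tau> * d - cx)\<^sup>2 + (y1 + \<tau> * e - cy)\<^sup>2 = 1"
    and other: "\<sigma> = 2 * ((cx - x1) * d + (cy - y1) * e) - \<tau>" "\<sigma> = \<tau> \<or> \<sigma> < 0 \<or> 1 < \<sigma>"
  shows "computes c (strike mo mp mq) (P (x1 + \<tau> * d) (y1 + \<tau> * e))"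
  unfolding P_add
proof (rule computes_strike[OF o p q[unfolded P_add] unit_direction[OF de] a t])
  show "dist (P cx cy) (P x1 y1 + \<tau> *\<^sub>R (d *\<^sub>R u + e *\<^sub>R v)) = 1"
    unfolding P_add[symmetric] dist_P_eq_1 using hit by (simp add: power2_commute)
next
  fix \<rho> :: real
  assume r: "0 \<le> \<rho>" "\<rho> \<le> 1" and "dist (P cx cy) (P x1 y1 + \<rho> *\<^sub>R (d *\<^sub>R u + e *\<^sub>R v)) = 1"
  then have "(cx - (x1 + \<rho> * d))\<^sup>2 + (cy - (y1 + \<rho> * e))\<^sup>2 = 1"
    unfolding P_add[symmetric] dist_P_eq_1 by simp
  then have "(\<rho> - \<tau>) * (\<rho> - \<sigma>) = 0"
    using hit de unfolding other(1) by algebra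
  then have "\<rho> = \<tau> \<or> \<rho> = \<sigma>" by simp
  then show "\<rho> = \<tau>" using other(2) r by auto
qed

text \<open>The two candidates on a horizontal line are mirror images in the vertical line through
  the centre, hence the second is \<open>2 * cx - x\<close>. The case \<open>x = cx\<close> is
  tangency.\<close>
lemma strike_row:
  assumes "computes c mo (P cx cy)" "computes c mp (P x1 y1)" "computes c mq (P x2 y1)"
    and "x1 < x2" "x2 \<le> x1 + 1" "x1 \<le> x" "x \<le> x1 + 1" "(x - cx)\<^sup>2 + (y1 - cy)\<^sup>2 = 1"
    and "x = cx \<or> 2 * cx - x < x1 \<or> x1 + 1 < 2 * cx - x"
  shows "computes c (strike mo mp mq) (P x y1)"
proof -
  have "2 * (cx - x1) - (x - x1) = x - x1 \<or> 2 * (cx - x1) - (x - x1) < 0 \<or> 1 < 2 * (cx - x1) - (x - x1)"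
    using assms(9) by (elim disjE) auto
  then have "computes c (strike mo mp mq) (P (x1 + (x - x1) * 1) (y1 + (x - x1) * 0))"
    by (intro strike_P[OF assms(1,2), where a = "x2 - x1" and \<sigma> = "2 * (cx - x1) - (x - x1)"])
      (use assms in simp_all)
  then show ?thesis by simp
qed

lemma strike_column:
  assumes "computes c mo (P cx cy)" "computes c mp (P x1 y1)" "computes c mq (P x1 y2)"
    and "y1 < y2" "y2 \<le> y1 + 1" "y1 \<le> y" "y \<le> y1 + 1" "(x1 - cx)\<^sup>2 + (y - cy)\<^sup>2 = 1"
    and "y = cy \<or> 2 * cy - y < y1 \<or> y1 + 1 < 2 * cy - y"
  shows "computes c (strike mo mp mq) (P x1 y)"
  using frame.strike_row[OF swap, of c mo z cy cx mp y1 x1 mq y2 y] assms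
  by (simp add: pt_swap[of _ v u] add.commute)

end

section \<open>A thin isosceles triangle\<close>

lemma infinite_unit_circle: "infinite {x. dist p x = (1::real)}" for p :: complex
proof -
  have "infinite {0<..<1::real}" by simp
  moreover have "inj_on (\<lambda>t. p + cis t) {0<..<1}"
  proof (rule inj_onI)
    fix s t :: real assume st: "s \<in> {0<..<1}" "t \<in> {0<..<1}" and "p + cis s = p + cis t"
    then have "Arg (cis s) = Arg (cis t)" by simp
    moreover have "Arg (cis r) = r" if "r \<in> {0<..<1}" for r
      using that pi_gt3 by (intro Arg_cis) auto
    ultimately show "s = t" using st by simp
  qed
  ultimately have "infinite ((\<lambda>t. p + cis t) ` {0<..<1})"
    by (simp add: finite_image_iff)
  moreover have "(\<lambda>t. p + cis t) ` {0<..<1} \<subseteq> {x. dist p x = 1}"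
    by (auto simp: dist_norm)
  ultimately show ?thesis using finite_subset by blast
qed

text \<open>Six half-open sectors of 60 degrees cover the circle, so two of seven points share
  one; their distance is below the side of a regular hexagon.\<close>
lemma close_pair_on_circle:
  fixes p :: complex
  assumes Z: "Z \<subseteq> {x. dist p x = 1}" "card Z = 7"
  shows "\<exists>x\<in>Z. \<exists>y\<in>Z. x \<noteq> y \<and> dist x y < 1"
proof -
  define sector where "sector x = \<lceil>3 * (Arg (x - p) + pi) / pi\<rceil>" for x
  have "sector ` Z \<subseteq> {1..6}"
  proof (rule image_subsetI)
    fix x
    have "0 < 3 * (Arg (x - p) + pi) / pi" "3 * (Arg (x - p) + pi) / pi \<le> 6"
      using Arg_bounded[of "x - p"] by (auto simp: field_simps)
    then show "sector x \<in> {1..6}"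
      unfolding sector_def by (simp add: ceiling_le_iff)
  qed
  then have "card (sector ` Z) \<le> 6"
    using card_mono[of "{1..6::int}" "sector ` Z"] by simp
  then have "\<not> inj_on sector Z"
    using Z(2) by (intro pigeonhole) simp
  then obtain x y where xy: "x \<in> Z" "y \<in> Z" "x \<noteq> y" "sector x = sector y"
    unfolding inj_on_def by blast
  define a where "a = Arg (x - p)"
  define b where "b = Arg (y - p)"
  have n: "norm (x - p) = 1" "norm (y - p) = 1"
    using xy Z by (auto simp: dist_norm norm_minus_commute)
  have c: "cis a = x - p" "cis b = y - p"
    unfolding a_def b_def using n cis_Arg[of "x - p"] cis_Arg[of "y - p"]
    by (fastforce simp: sgn_div_norm)+
  have "\<bar>3 * (a + pi) / pi - 3 * (b + pi) / pi\<bar> < 1"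
    using xy(4) unfolding sector_def a_def[symmetric] b_def[symmetric] by linarith
  moreover have "3 * (a + pi) / pi - 3 * (b + pi) / pi = 3 * (a - b) / pi"
    by (simp add: field_simps)
  ultimately have "3 * (a - b) / pi < 1" "- 1 < 3 * (a - b) / pi" by linarith+
  then have "3 * (a - b) < pi" "- pi < 3 * (a - b)"
    using pi_gt_zero by (simp_all add: pos_divide_less_eq pos_less_divide_eq)
  then have ab: "\<bar>a - b\<bar> < pi / 3"
    unfolding abs_less_iff by (simp add: field_simps)
  have "cos (pi / 3) < cos \<bar>a - b\<bar>"
    using ab by (intro cos_monotone_0_pi) auto
  then have cab: "cos (a - b) > 1 / 2"
    by (simp add: cos_60)
  have "(dist x y)\<^sup>2 = (norm (cis a - cis b))\<^sup>2"
    unfolding c by (simp add: dist_norm)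
  also have "\<dots> = (cos a - cos b)\<^sup>2 + (sin a - sin b)\<^sup>2"
    by (simp add: cmod_power2)
  also have "\<dots> = 2 - 2 * cos (a - b)"
    using sin_cos_squared_add[of a] sin_cos_squared_add[of b]
    by (simp add: cos_diff power2_eq_square algebra_simps)
  finally have "(dist x y)\<^sup>2 < 1\<^sup>2" using cab by simp
  then have "dist x y < 1" by (rule power2_less_imp_less) simp
  then show ?thesis using xy by blast
qed

text \<open>Every new point has to avoid the sticks laid towards the earlier ones, which is how
  the ruler is kept from choosing the same point again.\<close>
primrec spokes :: "nat \<Rightarrow> nat \<Rightarrow> nat list \<Rightarrow> nat list prog" where
  "spokes i 0 ks = give []"
| "spokes i (Suc n) ks = do {
     x \<leftarrow> free_end i ks;
     (_, k) \<leftarrow> lay i x;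
     xs \<leftarrow> spokes i n (k # ks);
     give (x # xs) }"

text \<open>A spoke meets the unit circle around its hub only at its tip, so avoiding the spokes
  means avoiding the earlier points.\<close>
lemma ensures_spokes:
  assumes "given_point c i p" "list_all2 (given_stick c) ks (map (Pair p) ys)" "\<forall>y\<in>set ys. dist p y = 1"
  shows "ensures c (spokes i n ks) (\<lambda>xs c'. \<exists>zs. list_all2 (given_point c') xs zs \<and> length zs = n \<and>
    distinct zs \<and> set zs \<inter> set ys = {} \<and> (\<forall>z\<in>set zs. dist p z = 1))"
  using assms
proof (induction n arbitrary: c ks ys)
  case 0
  then show ?case by (auto intro!: ensures_give)
next
  case (Suc n)
  have tips: "x \<in> (\<Union>s\<in>set (map (Pair p) ys). segment s) \<longleftrightarrow> x \<in> set ys" if x: "dist p x = 1" for x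
  proof
    assume "x \<in> (\<Union>s\<in>set (map (Pair p) ys). segment s)"
    then obtain y where y: "y \<in> set ys" "x \<in> segment (p, p + (y - p))" by auto
    then obtain a where a: "x = p + a *\<^sub>R (y - p)" "0 \<le> a" unfolding segment_ray by auto
    have "norm (y - p) = 1" using Suc.prems y by (auto simp: dist_norm norm_minus_commute)
    then have "a = 1" using x a by (simp add: dist_norm)
    then show "x \<in> set ys" using a y by simp
  next
    assume "x \<in> set ys"
    then show "x \<in> (\<Union>s\<in>set (map (Pair p) ys). segment s)"
      by (auto simp: segment_def intro!: bexI[of _ x])
  qed
  have ex: "\<exists>x. dist p x = 1 \<and> x \<notin> (\<Union>s\<in>set (map (Pair p) ys). segment s)"
  proof -
    have "infinite ({x. dist p x = 1} - set ys)"
      using infinite_unit_circle by simp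
    then obtain x where "dist p x = 1" "x \<notin> set ys"
      by (metis (mono_tags, lifting) DiffE ex_in_conv finite.emptyI mem_Collect_eq)
    then show ?thesis using tips by blast
  qed
  let ?R = "\<lambda>xs c'. \<exists>zs. list_all2 (given_point c') xs zs \<and> length zs = Suc n \<and>
    distinct zs \<and> set zs \<inter> set ys = {} \<and> (\<forall>z\<in>set zs. dist p z = 1)"
  show ?case
    unfolding spokes.simps
  proof (rule ensures_bind[OF ensures_free_end[OF Suc.prems(1,2) ex]], elim exE conjE)
    fix j c1 x
    assume c1: "c \<sqsubseteq> c1" and j: "given_point c1 j x" and x: "dist p x = 1"
      and "x \<notin> (\<Union>s\<in>set (map (Pair p) ys). segment s)"
    then have new: "x \<notin> set ys" using tips by blast
    have i: "given_point c1 i p" using Suc.prems(1) c1 by (rule given_point_mono)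
    have "norm (x - p) = 1" using x by (simp add: dist_norm norm_minus_commute)
    then have lay: "ensures c1 (lay i j) (\<lambda>(b, k) c'. given_point c' b (p + (x - p)) \<and> given_stick c' k (p, p + (x - p)))"
      using j by (intro ensures_lay[OF i, where a = 1]) auto
    show "ensures c1 (do { (_, k) \<leftarrow> lay i j; xs \<leftarrow> spokes i n (k # ks); give (j # xs) })
       ?R"
    proof (rule ensures_bind[OF lay], clarify)
      fix b k c2 assume c2: "c1 \<sqsubseteq> c2" and k: "given_stick c2 k (p, p + (x - p))"
      have i2: "given_point c2 i p" using i c2 by (rule given_point_mono)
      have "list_all2 (given_stick c2) ks (map (Pair p) ys)"
        using Suc.prems(2) by (rule list_all2_mono) (meson given_stick_mono c1 c2 extends_trans)
      then have ks: "list_all2 (given_stick c2) (k # ks) (map (Pair p) (x # ys))"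
        using k by simp
      have xys: "\<forall>y\<in>set (x # ys). dist p y = 1" using Suc.prems(3) x by simp
      show "ensures c2 (do { xs \<leftarrow> spokes i n (k # ks); give (j # xs) })
         ?R"
      proof (rule ensures_bind[OF Suc.IH[OF i2 ks xys]], elim exE conjE)
        fix xs c3 zs
        assume c3: "c2 \<sqsubseteq> c3" and zs: "list_all2 (given_point c3) xs zs" "length zs = n" "distinct zs"
          "set zs \<inter> set (x # ys) = {}" "\<forall>z\<in>set zs. dist p z = 1"
        have "list_all2 (given_point c') (j # xs) (x # zs)" if c': "c3 \<sqsubseteq> c'" for c'
        proof -
          have "given_point c' j x" using j c2 c3 c' by (meson given_point_mono)
          moreover have "list_all2 (given_point c') xs zs"
            using zs(1) by (rule list_all2_mono) (meson given_point_mono c')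
          ultimately show ?thesis by simp
        qed
        moreover have "length (x # zs) = Suc n" "distinct (x # zs)" "set (x # zs) \<inter> set ys = {}"
          "\<forall>z\<in>set (x # zs). dist p z = 1"
          using zs new x by auto
        ultimately show "ensures c3 (give (j # xs)) ?R"
          by (intro ensures_give) blast
      qed
    qed
  qed
qed

definition thin_triangle :: "nat \<Rightarrow> (nat \<times> nat) prog" where
  "thin_triangle i = do {
     xs \<leftarrow> spokes i 7 [];
     search (\<lambda>n. case prod_decode n of (k, l) \<Rightarrow>
       if k < l \<and> l < 7 then do {
         obs \<leftarrow> compare (xs ! k) (xs ! l);
         give (if obs = Shorter then Some (xs ! k, xs ! l) else None) }
       else give None) }"

lemma compare_unit_simps [simp]:
  "compare_unit d = Shorter \<longleftrightarrow> d < 1" "compare_unit d = Longer \<longleftrightarrow> d > 1" "compare_unit d = Unit_Length \<longleftrightarrow> d = 1"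
  by (auto simp: compare_unit_def)

lemma ensures_thin_triangle:
  assumes i: "given_point c i p"
  shows "ensures c (thin_triangle i) (\<lambda>(j, k) c'. \<exists>x y. given_point c' j x \<and> given_point c' k y \<and>
    dist p x = 1 \<and> dist p y = 1 \<and> 0 < dist x y \<and> dist x y < 1)"
    (is "ensures c _ ?Q")
  unfolding thin_triangle_def
proof (rule ensures_bind[OF ensures_spokes[OF i, of "[]" "[]"]]; (elim exE conjE)?)
  fix xs c1 zs
  assume c1: "c \<sqsubseteq> c1" and zs: "list_all2 (given_point c1) xs zs" "length zs = 7" "distinct zs" "\<forall>z\<in>set zs. dist p z = 1"
  have "card (set zs) = 7" using zs by (simp add: distinct_card)
  then obtain x y where "x \<in> set zs" "y \<in> set zs" "x \<noteq> y" "dist x y < 1"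
    using close_pair_on_circle[of "set zs" p] zs by blast
  then obtain k l where "k < 7" "l < 7" "zs ! k \<noteq> zs ! l" "dist (zs ! k) (zs ! l) < 1"
    using zs(2) by (metis in_set_conv_nth)
  then obtain k l where kl: "k < l" "l < 7" "dist (zs ! k) (zs ! l) < 1"
    by (metis dist_commute linorder_neqE_nat)
  have len: "length xs = 7" using zs by (auto dest: list_all2_lengthD)
  show "ensures c1 (search (\<lambda>n. case prod_decode n of (k, l) \<Rightarrow>
       if k < l \<and> l < 7 then do {
         obs \<leftarrow> compare (xs ! k) (xs ! l);
         give (if obs = Shorter then Some (xs ! k, xs ! l) else None) }
       else give None)) ?Q"
  proof (rule ensures_search[where N = "prod_encode (k, l)"])
    show "points c1 \<noteq> []" using i c1 by (blast dest: given_point_mono points_nonempty)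
  next
    fix n
    obtain a b where n: "prod_decode n = (a, b)" by (cases "prod_decode n")
    then have n': "n = prod_encode (a, b)" by (metis prod_decode_inverse)
    show "ensures c1 (case prod_decode n of (k, l) \<Rightarrow>
       if k < l \<and> l < 7 then do {
         obs \<leftarrow> compare (xs ! k) (xs ! l);
         give (if obs = Shorter then Some (xs ! k, xs ! l) else None) }
       else give None) (\<lambda>r c'. case r of None \<Rightarrow> n \<noteq> prod_encode (k, l) | Some jk \<Rightarrow> ?Q jk c')"
    proof (cases "a < b \<and> b < 7")
      case True
      then have ab: "given_point c1 (xs ! a) (zs ! a)" "given_point c1 (xs ! b) (zs ! b)"
        using zs(1) len by (simp_all add: list_all2_conv_all_nth)
      have "zs ! a \<noteq> zs ! b" "zs ! a \<in> set zs" "zs ! b \<in> set zs"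
        using True zs by (auto simp: nth_eq_iff_index_eq)
      then have d: "0 < dist (zs ! a) (zs ! b)" "dist p (zs ! a) = 1" "dist p (zs ! b) = 1"
        using zs(4) by auto
      have "ensures c1 (do {
          obs \<leftarrow> compare (xs ! a) (xs ! b);
          give (if obs = Shorter then Some (xs ! a, xs ! b) else None) })
        (\<lambda>r c'. case r of None \<Rightarrow> prod_encode (a, b) \<noteq> prod_encode (k, l) | Some jk \<Rightarrow> ?Q jk c')"
      proof (rule ensures_bind[OF ensures_compare[OF ab]], rule ensures_give, goal_cases)
        case (1 obs c2 c3)
        then have ab': "given_point c3 (xs ! a) (zs ! a)" "given_point c3 (xs ! b) (zs ! b)"
          using ab by (meson given_point_mono)+
        show ?case
        proof (cases "dist (zs ! a) (zs ! b) < 1")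
          case True
          then show ?thesis using 1(2) ab' d by auto
        next
          case False
          then show ?thesis using 1(2) kl by (auto simp: prod_encode_eq)
        qed
      qed
      then show ?thesis
        unfolding n n' using True by (simp add: prod_encode_eq)
    next
      case False
      then show ?thesis unfolding n n' using kl by (auto intro!: ensures_give)
    qed
  qed
qed (auto simp: assms)

section \<open>The unit square on a thin isosceles triangle\<close>

text \<open>The corners of a square: bottom left, bottom right, top left, top right, each given by
  a program.\<close>
datatype square = Square (bl: "nat prog") (br: "nat prog") (tl: "nat prog") (tr: "nat prog")

definition computes_square :: "config \<Rightarrow> square \<Rightarrow> point \<Rightarrow> complex \<Rightarrow> complex \<Rightarrow> bool" where
  "computes_square c Q z u v \<longleftrightarrow> computes c (bl Q) (pt z u v 0 0) \<and> computes c (br Q) (pt z u v 1 0) \<and>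
     computes c (tl Q) (pt z u v 0 1) \<and> computes c (tr Q) (pt z u v 1 1)"

text \<open>A mark on the leg \<open>yc\<close> of an isosceles triangle with apex
  \<open>y\<close> and unit legs. The unit circle around \<open>b\<close> passes through
  \<open>y\<close> and meets the continuation of the leg a second time beyond \<open>c\<close>;
  one unit back from there lies the mark. Exchanging \<open>b\<close> and \<open>c\<close> mirrors
  it.\<close>
definition leg_mark :: "nat prog \<Rightarrow> nat prog \<Rightarrow> nat prog \<Rightarrow> nat prog" where
  "leg_mark y b c = strike (strike b c (beyond y c)) y c"

text \<open>The sticks from the base points to the two opposite marks are mirror images of each
  other, so they cross on the altitude.\<close>
definition foot :: "nat prog \<Rightarrow> nat prog \<Rightarrow> nat prog \<Rightarrow> nat prog" where
  "foot y b c = meet y (meet b (leg_mark y b c) c (leg_mark y c b)) b c"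

text \<open>The right angle at \<open>m\<close> is not yet a square, for its fourth corner is
  \<open>sqrt 2\<close> away. With \<open>y'\<close>, the mirror image of the apex, the point
  \<open>beyond y' c\<close> has the same height as \<open>y\<close>. This horizontal line meets
  the unit circle around \<open>m\<close> in \<open>v\<close>, vertically above \<open>c\<close>.
  The verticals through \<open>m\<close> and \<open>c\<close> are then cut off at height 1, and
  the stick along their upper ends yields the last corner.\<close>
definition triangle_square :: "nat prog \<Rightarrow> nat prog \<Rightarrow> nat prog \<Rightarrow> square" where
  "triangle_square y b c = (let
     m = foot y b c;
     top = tip m y;
     below = beyond top m;
     y' = strike c below m;
     v = strike m y (beyond y' c)
   in Square m (tip m c) top (tip top (tip c v)))"

context frame
begin

text \<open>All coordinates are explicit in the half base \<open>t\<close> and the height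
  \<open>s\<close>. The bound \<open>t < 1 / 2\<close> makes the second intersection of each unit
  circle miss the stick in question.\<close>
lemma triangle_square_coordinates:
  assumes y: "computes c my (P 0 s)" and b: "computes c mb (P (- t) 0)" and cc: "computes c mc (P t 0)"
    and t: "0 < t" "t < 1 / 2" and s: "0 < s" and ts: "t\<^sup>2 + s\<^sup>2 = 1"
  shows "computes_square c (triangle_square my mb mc) z u v"
proof -
  have t2: "t\<^sup>2 < 1 / 4" "0 < t\<^sup>2"
    using t power_strict_mono[of t "1/2" 2] by (auto simp: power_divide)
  have s2: "s\<^sup>2 = 1 - t\<^sup>2" using ts by simp
  have "s\<^sup>2 < 1\<^sup>2" using s2 t2 by simp
  then have s1: "s < 1" by (rule power2_less_imp_less) simp
  define k where "k = 1 - 4 * t\<^sup>2"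
  have k: "0 < k" "k < 1" using t2 by (simp_all add: k_def)
  have mark: "computes c (leg_mark my mb' mc') (P (\<epsilon> * t * k) (4 * s * t\<^sup>2))"
    if b': "computes c mb' (P (- \<epsilon> * t) 0)" and c': "computes c mc' (P (\<epsilon> * t) 0)" and e: "\<epsilon> = 1 \<or> \<epsilon> = - 1"
    for \<epsilon> mb' mc'
  proof -
    have e2: "\<epsilon>\<^sup>2 = 1" using e by auto
    have "computes c (beyond my mc') (P (2 * (\<epsilon> * t) - 0) (2 * 0 - s))"
      by (rule beyond_P[OF y c']) (use e2 ts in \<open>simp add: power_mult_distrib\<close>)
    then have ext: "computes c (beyond my mc') (P (\<epsilon> * t + 1 * (\<epsilon> * t)) (0 + 1 * (- s)))" by simp
    have de: "(\<epsilon> * t)\<^sup>2 + (- s)\<^sup>2 = 1" using ts e2 by (simp add: power_mult_distrib)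
    have E: "computes c (strike mb' mc' (beyond my mc')) (P (\<epsilon> * t + k * (\<epsilon> * t)) (0 + k * (- s)))"
    proof (rule strike_P[OF b' c' ext de])
      show "(\<epsilon> * t + k * (\<epsilon> * t) - - \<epsilon> * t)\<^sup>2 + (0 + k * - s - 0)\<^sup>2 = 1"
        unfolding k_def using e2 s2 by algebra
      \<comment> \<open>The other root belongs to the apex, which is one unit before the start of the stick.\<close>
      show "- 1 = 2 * ((- \<epsilon> * t - \<epsilon> * t) * (\<epsilon> * t) + (0 - 0) * - s) - k"
        unfolding k_def using e2 by algebra
    qed (use k in auto)
    have c'': "computes c mc' (P (0 + 1 * (\<epsilon> * t)) (s + 1 * (- s)))" using c' by simp
    have "computes c (leg_mark my mb' mc') (P (0 + k * (\<epsilon> * t)) (s + k * (- s)))"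
      unfolding leg_mark_def
    proof (rule strike_P[OF E y c'' de])
      show "(0 + k * (\<epsilon> * t) - (\<epsilon> * t + k * (\<epsilon> * t)))\<^sup>2 + (s + k * - s - (0 + k * - s))\<^sup>2 = 1"
        using e2 s2 by algebra
      \<comment> \<open>The other root lies two units further, beyond the end of the leg.\<close>
      show "k + 2 = 2 * ((\<epsilon> * t + k * (\<epsilon> * t) - 0) * (\<epsilon> * t) + (0 + k * - s - s) * - s) - k"
        using e2 s2 by algebra
    qed (use k in auto)
    moreover have "P (0 + k * (\<epsilon> * t)) (s + k * (- s)) = P (\<epsilon> * t * k) (4 * s * t\<^sup>2)"
      unfolding P_eq_iff by (simp add: k_def algebra_simps)
    ultimately show ?thesis by (rule back_subst)
  qed
  have E: "computes c (leg_mark my mb mc) (P (t * k) (4 * s * t\<^sup>2))"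
    using mark[of mb 1 mc] b cc by simp
  have F: "computes c (leg_mark my mc mb) (P (- t * k) (4 * s * t\<^sup>2))"
    using mark[of mc "-1" mb] b cc by simp
  define g where "g = 4 * s * t\<^sup>2 / (1 + k)"
  have len: "(t * k + t)\<^sup>2 + (4 * s * t\<^sup>2)\<^sup>2 = 4 * t\<^sup>2"
    unfolding k_def using s2 by algebra
  have al: "0 < 1 / (1 + k)" "1 / (1 + k) \<le> 1" using k by simp_all
  have gle: "t\<^sup>2 + g\<^sup>2 \<le> 1"
  proof -
    have "t = (t * k + t) * (1 / (1 + k))" "g = (4 * s * t\<^sup>2) * (1 / (1 + k))"
      using k by (simp_all add: field_simps g_def)
    then have "t\<^sup>2 + g\<^sup>2 = ((t * k + t) * (1 / (1 + k)))\<^sup>2 + ((4 * s * t\<^sup>2) * (1 / (1 + k)))\<^sup>2" by simp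
    also have "\<dots> = ((t * k + t)\<^sup>2 + (4 * s * t\<^sup>2)\<^sup>2) * (1 / (1 + k))\<^sup>2"
      unfolding power_mult_distrib by (simp add: distrib_right)
    also have "\<dots> \<le> (4 * t\<^sup>2) * 1"
      unfolding len using al by (intro mult_left_mono) (auto simp: power_le_one)
    finally show ?thesis using t2 by simp
  qed
  have G: "computes c (meet mb (leg_mark my mb mc) mc (leg_mark my mc mb)) (P 0 g)"
  proof (rule meet_P[OF b E cc F, where \<alpha> = "1 / (1 + k)" and \<beta> = "1 / (1 + k)"])
    show "(t * k - - t)\<^sup>2 + (4 * s * t\<^sup>2 - 0)\<^sup>2 \<le> 1" "(- t * k - t)\<^sup>2 + (4 * s * t\<^sup>2 - 0)\<^sup>2 \<le> 1"
      using len t2 by (simp_all add: power2_eq_square algebra_simps)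
    show "(t * k - - t) * (4 * s * t\<^sup>2 - 0) \<noteq> (4 * s * t\<^sup>2 - 0) * (- t * k - t)"
    proof -
      have "0 < t * k + t" using t k by (intro add_pos_pos) simp_all
      then have "(t * k + t) * (4 * s * t\<^sup>2) > 0" using t s by simp
      then show ?thesis by (simp add: algebra_simps)
    qed
    show "0 = - t + 1 / (1 + k) * (t * k - - t)" "0 = t + 1 / (1 + k) * (- t * k - t)"
      using k by (simp_all add: field_simps)
    show "g = 0 + 1 / (1 + k) * (4 * s * t\<^sup>2 - 0)" "g = 0 + 1 / (1 + k) * (4 * s * t\<^sup>2 - 0)"
      unfolding g_def by simp_all
    show "(0 - - t)\<^sup>2 + (g - 0)\<^sup>2 \<le> 1" "(0 - t)\<^sup>2 + (g - 0)\<^sup>2 \<le> 1" using gle by simp_all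
  qed (use al in auto)
  have gs: "0 < g" "g < s"
  proof -
    show "0 < g" unfolding g_def using s t k by simp
    have "4 * t\<^sup>2 < 1 + k" unfolding k_def using t2 by simp
    then have "4 * t\<^sup>2 / (1 + k) < 1" using k by simp
    then have "s * (4 * t\<^sup>2 / (1 + k)) < s * 1" using s by (intro mult_strict_left_mono)
    then show "g < s" unfolding g_def by (simp add: mult_ac)
  qed
  have M: "computes c (foot my mb mc) (P 0 0)"
    unfolding foot_def
  proof (rule meet_P[OF y G b cc, where \<alpha> = "s / (s - g)" and \<beta> = "1 / 2"])
    have "(g - s)\<^sup>2 \<le> 1" using gs s1 by (simp add: abs_square_le_1)
    then show "(0 - 0)\<^sup>2 + (g - s)\<^sup>2 \<le> 1" by simp
    show "(0 - 0)\<^sup>2 + (0 - s)\<^sup>2 \<le> 1" using s s1 by (simp add: abs_square_le_1)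
    show "(t - - t)\<^sup>2 + (0 - 0)\<^sup>2 \<le> 1" using t2 by simp
    show "(0 - - t)\<^sup>2 + (0 - 0)\<^sup>2 \<le> 1" using t2 by simp
    show "0 = s + s / (s - g) * (g - s)" using gs by (simp add: field_simps)
    show "(0 - 0) * (0 - 0) \<noteq> (g - s) * (t - - t)" using gs t by simp
    show "0 \<le> s / (s - g)" using s gs by simp
  qed auto
  let ?m = "foot my mb mc"
  have top: "computes c (tip ?m my) (P 0 1)"
    using tip_up[OF M y] s s1 by simp
  have below: "computes c (beyond (tip ?m my) ?m) (P 0 (- 1))"
    using beyond_P[OF top M] by simp
  have y': "computes c (strike mc (beyond (tip ?m my) ?m) ?m) (P 0 (- s))"
    by (rule strike_column[OF cc below M]) (use s s1 ts in auto)
  have far: "computes c (beyond (strike mc (beyond (tip ?m my) ?m) ?m) mc) (P (2 * t) s)"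
    using beyond_P[OF y' cc] ts by simp
  have v: "computes c (strike ?m my (beyond (strike mc (beyond (tip ?m my) ?m) ?m) mc)) (P t s)"
    by (rule strike_row[OF M y far]) (use t ts in auto)
  have r: "computes c (tip mc (strike ?m my (beyond (strike mc (beyond (tip ?m my) ?m) ?m) mc))) (P t 1)"
    using tip_up[OF cc v] s s1 by simp
  have "computes c (tip (tip ?m my) (tip mc (strike ?m my (beyond (strike mc (beyond (tip ?m my) ?m) ?m) mc)))) (P 1 1)"
    using tip_right[OF top r] t by simp
  moreover have "computes c (tip ?m mc) (P 1 0)"
    using tip_right[OF M cc] t by simp
  ultimately show ?thesis
    using M top unfolding computes_square_def triangle_square_def Let_def by simp
qed

end

text \<open>The frame has its origin at the midpoint of the base and its axes along the base and
  the altitude.\<close>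
lemma triangle_square:
  assumes y: "computes c my y" and b: "computes c mb b" and d: "computes c md d"
    and yb: "dist y b = 1" and yd: "dist y d = 1" and bd: "0 < dist b d" "dist b d < 1"
  shows "\<exists>z u v. frame u v \<and> computes_square c (triangle_square my mb md) z u v"
proof -
  define m where "m = (1 / 2) *\<^sub>R (b + d)"
  define h where "h = (1 / 2) *\<^sub>R (d - b)"
  define t where "t = norm h"
  define s where "s = norm (y - m)"
  have bm: "b = m - h" and dm: "d = m + h"
    unfolding m_def h_def by (simp_all add: complex_eq_iff field_simps)
  have "dist b d = 2 * t"
    unfolding t_def dist_norm bm dm by (simp flip: scaleR_2)
  then have t: "0 < t" "t < 1 / 2" using bd by simp_all
  have n: "(norm ((y - m) + h))\<^sup>2 = 1" "(norm ((y - m) - h))\<^sup>2 = 1"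
    using yb yd unfolding bm dm dist_norm by (simp_all add: algebra_simps)
  have ip: "inner h (y - m) = 0"
    using n unfolding power2_norm_eq_inner
    by (simp add: inner_add_left inner_add_right inner_diff_left inner_diff_right inner_commute)
  have ts: "t\<^sup>2 + s\<^sup>2 = 1"
    using n(1) ip unfolding t_def s_def power2_norm_eq_inner
    by (simp add: inner_add_left inner_add_right inner_diff_left inner_diff_right inner_commute)
  have "t\<^sup>2 < 1" using t by (simp add: power_less_one_iff abs_square_less_1)
  then have "s\<^sup>2 > 0" using ts by linarith
  then have "s \<noteq> 0" by (simp add: zero_less_power2)
  then have s: "0 < s" unfolding s_def by simp
  define u where "u = h /\<^sub>R t"
  define v where "v = (y - m) /\<^sub>R s"
  have fr: "frame u v"
  proof
    show "norm u = 1" "norm v = 1" unfolding u_def v_def using t s by (simp_all flip: t_def s_def)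
    show "inner u v = 0" unfolding u_def v_def using ip by simp
  qed
  have "h = t *\<^sub>R u" "y - m = s *\<^sub>R v" unfolding u_def v_def using t s by simp_all
  then have "y = pt m u v 0 s" "b = pt m u v (- t) 0" "d = pt m u v t 0"
    unfolding bm dm pt_def by (simp_all add: algebra_simps)
  then show ?thesis
    using frame.triangle_square_coordinates[OF fr, of c my m s mb t md] y b d t s ts fr by auto
qed

section \<open>Straightedge work inside a unit square\<close>

text \<open>Unit circle and opposite side are tangent, so \<open>rise\<close> and
  \<open>across\<close> yield the orthogonal projections to the top and to the right side.\<close>
definition rise :: "square \<Rightarrow> nat prog \<Rightarrow> nat prog" where
  "rise Q m = strike m (tl Q) (tr Q)"

definition across :: "square \<Rightarrow> nat prog \<Rightarrow> nat prog" where
  "across Q m = strike m (br Q) (tr Q)"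

text \<open>A rectangle of height \<open>w\<close> and width \<open>sqrt (1 - w\<^sup>2)\<close>
  has diagonals of length 1, so they are sticks and their intersection halves the height. Doing
  this at the left and at the right side of the square gives two points at half height and hence
  the horizontal line through them.\<close>
definition half_height :: "square \<Rightarrow> nat prog \<Rightarrow> nat prog" where
  "half_height Q m = (let
     r = across Q m;
     low = strike m (bl Q) (br Q); high = strike (bl Q) m r;
     low' = strike r (bl Q) (br Q); high' = strike (br Q) m r
   in meet (meet (br Q) high' r low') (meet (bl Q) high m low) (bl Q) (tl Q))"

text \<open>The heights \<open>y / 2\<close> and \<open>y / 4\<close> obtained by halving an
  arbitrary height \<open>y\<close>. Together with the bottom side they give three equidistant
  lines at distance below \<open>1 / 4\<close>, which leaves a stick room to run far enough
  sideways. The value of \<open>y\<close> cancels from all results.\<close>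
definition upper :: "square \<Rightarrow> nat prog \<Rightarrow> nat prog" where
  "upper Q h = half_height Q h"

definition lower :: "square \<Rightarrow> nat prog \<Rightarrow> nat prog" where
  "lower Q h = half_height Q (upper Q h)"

text \<open>Projects a point at the lower height to the bottom side. The line one unit below that
  height is available, and by tangency the perpendicular to it is a stick, which crosses the
  bottom side.\<close>
definition drop :: "square \<Rightarrow> nat prog \<Rightarrow> nat prog \<Rightarrow> nat prog" where
  "drop Q h m = meet m (strike m (tip (lower Q h) (bl Q)) (tip (across Q (lower Q h)) (br Q))) (bl Q) (br Q)"

text \<open>The midpoint of the bottom side. The two crossing sticks are mirror images of each
  other in the vertical midline of the square.\<close>
definition center :: "square \<Rightarrow> nat prog \<Rightarrow> nat prog" where
  "center Q h = (let
     l = upper Q h; r = across Q l;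
     low = strike l (bl Q) (br Q); high = strike (bl Q) l r;
     low' = strike r (bl Q) (br Q); high' = strike (br Q) l r
   in drop Q h (meet low high' low' high))"

definition lift :: "square \<Rightarrow> nat prog \<Rightarrow> nat prog \<Rightarrow> nat prog" where
  "lift Q m l = meet m (rise Q m) l (across Q l)"

text \<open>A stick from the bottom side to the upper height crosses the lower height
  halfway.\<close>
definition mean :: "square \<Rightarrow> nat prog \<Rightarrow> nat prog \<Rightarrow> nat prog \<Rightarrow> nat prog" where
  "mean Q h m n = drop Q h (meet m (lift Q n (upper Q h)) (lower Q h) (across Q (lower Q h)))"

text \<open>A stick from the upper height through the lower height runs on to the bottom side, by
  the same amount again.\<close>
definition mirror :: "square \<Rightarrow> nat prog \<Rightarrow> nat prog \<Rightarrow> nat prog \<Rightarrow> nat prog" where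
  "mirror Q h m n = meet (lift Q m (upper Q h)) (lift Q n (lower Q h)) (bl Q) (br Q)"

text \<open>Let \<open>a\<close>, \<open>b\<close>, \<open>k\<close> stand for signed distances
  from the vertical midline. The stick from \<open>a\<close> on the bottom side to
  \<open>-b\<close> at the upper height meets the midline in a point \<open>s\<close>. Projection
  from \<open>s\<close> maps the upper height to the bottom side, fixing the midline, and
  \<open>-b\<close> goes to \<open>a\<close>. It is therefore scaling by \<open>-a / b\<close>,
  and sends \<open>k\<close> to \<open>-k * a / b\<close>.\<close>
definition fourth_proportional :: "square \<Rightarrow> nat prog \<Rightarrow> nat prog \<Rightarrow> nat prog \<Rightarrow> nat prog \<Rightarrow> nat prog" where
  "fourth_proportional Q h a b k = meet (lift Q k (upper Q h))
     (meet a (lift Q b (upper Q h)) (center Q h) (rise Q (center Q h))) (bl Q) (br Q)"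

locale sheet = frame z u v for z u v :: complex +
  fixes c :: config and Q :: square and h :: "nat prog" and y :: real
  assumes square: "computes_square c Q z u v"
    and mark: "computes c h (P 0 y)" and y: "0 < y" "y < 1"
    and points: "points c \<noteq> []"
begin

lemma corners:
  "computes c (bl Q) (P 0 0)" "computes c (br Q) (P 1 0)" "computes c (tl Q) (P 0 1)" "computes c (tr Q) (P 1 1)"
  using square unfolding computes_square_def by simp_all

lemma rise:
  assumes "computes c m (P x 0)" "0 \<le> x" "x \<le> 1"
  shows "computes c (rise Q m) (P x 1)"
  unfolding rise_def by (rule strike_row[OF assms(1) corners(3,4)]) (use assms in auto)

lemma across:
  assumes "computes c m (P 0 w)" "0 \<le> w" "w \<le> 1"
  shows "computes c (across Q m) (P 1 w)"
  unfolding across_def by (rule strike_column[OF assms(1) corners(2,4)]) (use assms in auto)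

lemma bottom_left:
  assumes "computes c m (P 0 w)" "0 \<le> x" "x \<le> 1" "x\<^sup>2 + w\<^sup>2 = 1"
  shows "computes c (strike m (bl Q) (br Q)) (P x 0)"
  by (rule strike_row[OF assms(1) corners(1,2)]) (use assms in auto)

lemma bottom_right:
  assumes "computes c m (P 1 w)" "0 \<le> x" "x \<le> 1" "x\<^sup>2 + w\<^sup>2 = 1"
  shows "computes c (strike m (bl Q) (br Q)) (P (1 - x) 0)"
  by (rule strike_row[OF assms(1) corners(1,2)]) (use assms in auto)

lemma level_left:
  assumes m: "computes c m (P 0 w)" and w: "0 \<le> w" "w \<le> 1" and "0 \<le> x" "x \<le> 1" "x\<^sup>2 + w\<^sup>2 = 1"
  shows "computes c (strike (bl Q) m (across Q m)) (P x w)"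
  by (rule strike_row[OF corners(1) m across[OF m w]]) (use assms in auto)

lemma level_right:
  assumes m: "computes c m (P 0 w)" and w: "0 \<le> w" "w \<le> 1" and "0 \<le> x" "x \<le> 1" "x\<^sup>2 + w\<^sup>2 = 1"
  shows "computes c (strike (br Q) m (across Q m)) (P (1 - x) w)"
  by (rule strike_row[OF corners(2) m across[OF m w]]) (use assms in auto)

lemma half_height:
  assumes m: "computes c m (P 0 w)" and w: "0 < w" "w < 1"
  shows "computes c (half_height Q m) (P 0 (w / 2))"
proof -
  define x where "x = sqrt (1 - w\<^sup>2)"
  have "w\<^sup>2 < 1" "0 < w\<^sup>2" using w by (simp_all add: power_less_one_iff)
  then have xw: "x\<^sup>2 + w\<^sup>2 = 1" and x: "0 < x" "x < 1" unfolding x_def by simp_all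
  note args = m less_imp_le[OF w(1)] less_imp_le[OF w(2)]
  note args' = less_imp_le[OF x(1)] less_imp_le[OF x(2)] xw
  have r: "computes c (across Q m) (P 1 w)" using across args .
  have A: "computes c (meet (bl Q) (strike (bl Q) m (across Q m)) m (strike m (bl Q) (br Q))) (P (x / 2) (w / 2))"
    by (rule meet_P[OF corners(1) level_left[OF args args'] m bottom_left[OF m args'],
          where \<alpha> = "1 / 2" and \<beta> = "1 / 2"])
      (use x w xw in \<open>simp_all add: power2_eq_square field_simps\<close>)
  have B: "computes c (meet (br Q) (strike (br Q) m (across Q m)) (across Q m) (strike (across Q m) (bl Q) (br Q)))
      (P (1 - x / 2) (w / 2))"
    by (rule meet_P[OF corners(2) level_right[OF args args'] r bottom_right[OF r args'],
          where \<alpha> = "1 / 2" and \<beta> = "1 / 2"])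
      (use x w xw in \<open>simp_all add: power2_eq_square field_simps\<close>)
  have lens: "(1 - x)\<^sup>2 \<le> 1" "(1 - x / 2)\<^sup>2 \<le> 1" using x by (simp_all add: abs_square_le_1)
  show ?thesis
    unfolding half_height_def Let_def
  proof (rule meet_P[OF B A corners(1,3), where \<alpha> = "(1 - x / 2) / (1 - x)" and \<beta> = "w / 2"])
    show "(x / 2 - (1 - x / 2))\<^sup>2 + (w / 2 - w / 2)\<^sup>2 \<le> 1"
      using lens(1) by (simp add: power2_commute[of x 1])
    show "(0 - (1 - x / 2))\<^sup>2 + (w / 2 - w / 2)\<^sup>2 \<le> 1"
      using lens(2) by (simp add: power2_commute[of "x / 2" 1])
    show "0 = 1 - x / 2 + (1 - x / 2) / (1 - x) * (x / 2 - (1 - x / 2))"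
      using x by (simp add: field_simps)
    have "(w / 2)\<^sup>2 \<le> 1" using w by (simp add: abs_square_le_1)
    then show "(0 - 0)\<^sup>2 + (w / 2 - 0)\<^sup>2 \<le> 1" by simp
  qed (use x w in auto)
qed

lemma upper: "computes c (upper Q h) (P 0 (y / 2))"
  unfolding upper_def using half_height[OF mark y] .

lemma lower: "computes c (lower Q h) (P 0 (y / 4))"
  unfolding lower_def using half_height[OF upper] y by simp

lemma drop:
  assumes m: "computes c m (P x (y / 4))" and x: "0 \<le> x" "x \<le> 1"
  shows "computes c (drop Q h m) (P x 0)"
proof -
  have r: "computes c (across Q (lower Q h)) (P 1 (y / 4))"
    using across[OF lower] y by simp
  have A: "computes c (tip (lower Q h) (bl Q)) (P 0 (y / 4 - 1))"
    using tip_down[OF lower corners(1)] y by simp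
  have B: "computes c (tip (across Q (lower Q h)) (br Q)) (P 1 (y / 4 - 1))"
    using tip_down[OF r corners(2)] y by simp
  have C: "computes c (strike m (tip (lower Q h) (bl Q)) (tip (across Q (lower Q h)) (br Q))) (P x (y / 4 - 1))"
    by (rule strike_row[OF m A B]) (use x in auto)
  have "(y / 4)\<^sup>2 \<le> 1" using y by (simp add: abs_square_le_1)
  moreover have "x\<^sup>2 \<le> 1" using x by (simp add: abs_square_le_1)
  ultimately show ?thesis
    unfolding drop_def
    by (intro meet_P[OF m C corners(1,2), where \<alpha> = "y / 4" and \<beta> = x]) (use x y in auto)
qed

text \<open>The two sticks run between the abscissas \<open>x = sqrt (1 - w\<^sup>2)\<close> and
  \<open>1 - x\<close>. Their squared length is \<open>(2 * x - 1)\<^sup>2 + w\<^sup>2\<close>, at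
  most 1 because of \<open>(3 * x - 1) * (1 - x) \<ge> 0\<close>.\<close>
lemma center: "computes c (center Q h) (P (1 / 2) 0)"
proof -
  define w where "w = y / 2"
  define x where "x = sqrt (1 - w\<^sup>2)"
  have w: "0 < w" "w < 1 / 2" using y unfolding w_def by simp_all
  then have "w\<^sup>2 < 1 / 4" "0 < w\<^sup>2" using power_strict_mono[of w "1 / 2" 2] by (simp_all add: power_divide)
  then have xw: "x\<^sup>2 + w\<^sup>2 = 1" and x: "x\<^sup>2 > 3 / 4" "0 \<le> x" "x \<le> 1" unfolding x_def by simp_all
  have "1 / 2 < x"
    using x by (intro power2_less_imp_less[of "1 / 2" x]) (auto simp: power_divide)
  note x = this x
  have l: "computes c (upper Q h) (P 0 w)" using upper unfolding w_def .
  have w01: "0 \<le> w" "w \<le> 1" using w by simp_all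
  have r: "computes c (across Q (upper Q h)) (P 1 w)" using across l w01 .
  have "0 \<le> (3 * x - 1) * (1 - x)" using x by simp
  then have len: "(2 * x - 1)\<^sup>2 + w\<^sup>2 \<le> 1" using xw by (simp add: power2_eq_square algebra_simps)
  have quarter: "(x - 1 / 2)\<^sup>2 + (w / 2)\<^sup>2 \<le> 1"
  proof -
    have "(x - 1 / 2)\<^sup>2 + (w / 2)\<^sup>2 = ((2 * x - 1)\<^sup>2 + w\<^sup>2) / 4" by (simp add: power2_eq_square field_simps)
    then show ?thesis using len by simp
  qed
  have "computes c (meet (strike (upper Q h) (bl Q) (br Q)) (strike (br Q) (upper Q h) (across Q (upper Q h)))
      (strike (across Q (upper Q h)) (bl Q) (br Q)) (strike (bl Q) (upper Q h) (across Q (upper Q h))))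
      (P (1 / 2) (w / 2))"
  proof (rule meet_P[OF bottom_left[OF l x(3,4) xw] level_right[OF l w01 x(3,4) xw]
        bottom_right[OF r x(3,4) xw] level_left[OF l w01 x(3,4) xw], where \<alpha> = "1 / 2" and \<beta> = "1 / 2"])
    show "(1 - x - x)\<^sup>2 + (w - 0)\<^sup>2 \<le> 1" "(x - (1 - x))\<^sup>2 + (w - 0)\<^sup>2 \<le> 1"
      "(1 / 2 - x)\<^sup>2 + (w / 2 - 0)\<^sup>2 \<le> 1" "(1 / 2 - (1 - x))\<^sup>2 + (w / 2 - 0)\<^sup>2 \<le> 1"
      using len quarter by (simp_all add: power2_eq_square algebra_simps)
    show "(1 - x - x) * (w - 0) \<noteq> (w - 0) * (x - (1 - x))"
      using x w by simp
  qed (simp_all add: field_simps)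
  then show ?thesis
    unfolding center_def Let_def using drop[of _ "1 / 2"] by (simp add: w_def)
qed

lemma lift:
  assumes m: "computes c m (P x 0)" and x: "0 \<le> x" "x \<le> 1"
    and l: "computes c l (P 0 w)" and w: "0 \<le> w" "w \<le> 1"
  shows "computes c (lift Q m l) (P x w)"
proof -
  have "x\<^sup>2 \<le> 1" "w\<^sup>2 \<le> 1" using x w by (simp_all add: abs_square_le_1)
  then show ?thesis
    unfolding lift_def
    by (intro meet_P[OF m rise[OF m x] l across[OF l w], where \<alpha> = w and \<beta> = x]) (use x w in auto)
qed

lemma lift_upper:
  assumes "computes c m (P x 0)" "0 \<le> x" "x \<le> 1"
  shows "computes c (lift Q m (upper Q h)) (P x (y / 2))"
  using lift[OF assms upper] y by simp

lemma lift_lower: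
  assumes "computes c m (P x 0)" "0 \<le> x" "x \<le> 1"
  shows "computes c (lift Q m (lower Q h)) (P x (y / 4))"
  using lift[OF assms lower] y by simp

lemma y_squared: "y\<^sup>2 \<le> 1" "0 < y\<^sup>2"
  using y by (simp_all add: abs_square_le_1)

lemma mean:
  assumes m: "computes c m (P a 0)" "0 \<le> a" "a \<le> 1" and n: "computes c n (P b 0)" "0 \<le> b" "b \<le> 1"
    and ab: "\<bar>a - b\<bar> \<le> 1 / 2"
  shows "computes c (mean Q h m n) (P ((a + b) / 2) 0)"
proof -
  have r: "computes c (across Q (lower Q h)) (P 1 (y / 4))"
    using across[OF lower] y by simp
  have ab2: "(b - a)\<^sup>2 \<le> 1 / 4"
    using power_mono[of "\<bar>a - b\<bar>" "1 / 2" 2] ab by (simp add: power2_commute power_divide)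
  have "((a + b) / 2)\<^sup>2 \<le> 1" using m n by (simp add: abs_square_le_1)
  moreover have "((a + b) / 2 - a)\<^sup>2 = (b - a)\<^sup>2 / 4" by (simp add: power2_eq_square field_simps)
  ultimately have "computes c (meet m (lift Q n (upper Q h)) (lower Q h) (across Q (lower Q h))) (P ((a + b) / 2) (y / 4))"
    by (intro meet_P[OF m(1) lift_upper[OF n] lower r, where \<alpha> = "1 / 2" and \<beta> = "(a + b) / 2"])
      (use ab2 y y_squared m n in \<open>simp_all add: field_simps power_divide\<close>)
  then show ?thesis unfolding mean_def using m n by (intro drop) simp_all
qed

lemma mirror:
  assumes m: "computes c m (P a 0)" "0 \<le> a" "a \<le> 1" and n: "computes c n (P b 0)" "0 \<le> b" "b \<le> 1"
    and ab: "\<bar>a - b\<bar> \<le> 1 / 4" and res: "0 \<le> 2 * b - a" "2 * b - a \<le> 1"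
  shows "computes c (mirror Q h m n) (P (2 * b - a) 0)"
proof -
  have ab2: "(b - a)\<^sup>2 \<le> 1 / 16"
    using power_mono[of "\<bar>a - b\<bar>" "1 / 4" 2] ab by (simp add: power2_commute power_divide)
  have "(2 * b - a)\<^sup>2 \<le> 1" using res by (simp add: abs_square_le_1)
  moreover have "(2 * b - a - a)\<^sup>2 = 4 * (b - a)\<^sup>2" by (simp add: power2_eq_square algebra_simps)
  ultimately show ?thesis
    unfolding mirror_def
    by (intro meet_P[OF lift_upper[OF m] lift_lower[OF n] corners(1,2), where \<alpha> = 2 and \<beta> = "2 * b - a"])
      (use ab2 y y_squared res in \<open>simp_all add: field_simps power_divide\<close>)
qed

text \<open>The bounds on \<open>a\<close>, \<open>b\<close> and \<open>k\<close> say that both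
  sticks are long enough. Both signs are chosen such that \<open>s\<close> lies between the two
  parallels, which keeps a division by a small \<open>b\<close> within reach as long as the
  quotient is.\<close>
lemma fourth_proportional:
  assumes m: "computes c m (P (1 / 2 + a) 0)" and n: "computes c n (P (1 / 2 - b) 0)"
    and l: "computes c l (P (1 / 2 + k) 0)"
    and ab: "0 \<le> a" "a \<le> 1 / 4" "0 < b" "b \<le> 1 / 4" and k: "\<bar>k\<bar> * (1 + a / b) \<le> 1 / 2"
  shows "computes c (fourth_proportional Q h m n l) (P (1 / 2 - k * a / b) 0)"
proof -
  define q where "q = a / b"
  have q: "0 \<le> q" "a = q * b" unfolding q_def using ab by simp_all
  have "\<bar>k\<bar> + \<bar>k * q\<bar> \<le> 1 / 2"
    using k q(1) unfolding q_def[symmetric] by (simp add: distrib_left abs_mult)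
  then have k': "\<bar>k\<bar> \<le> 1 / 2" "\<bar>k * q\<bar> \<le> 1 / 2" by linarith+
  have n': "computes c (lift Q n (upper Q h)) (P (1 / 2 - b) (y / 2))" using lift_upper[OF n] ab by simp
  have l': "computes c (lift Q l (upper Q h)) (P (1 / 2 + k) (y / 2))" using lift_upper[OF l] k' by simp
  have r: "computes c (rise Q (center Q h)) (P (1 / 2) 1)" using rise[OF center] by simp
  define t where "t = q / (1 + q)"
  have t: "0 \<le> t" "t < 1" "q = t * (1 + q)" unfolding t_def using q(1) by simp_all
  have sq: "(a + b)\<^sup>2 \<le> 1 / 4" using ab power_mono[of "a + b" "1 / 2" 2] by (simp add: power_divide)
  have y4: "(y / 2)\<^sup>2 \<le> 1 / 4" using y_squared by (simp add: power_divide)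
  have ty: "(t * (y / 2))\<^sup>2 \<le> 1 / 4"
  proof -
    have "t\<^sup>2 \<le> 1" using t by (simp add: abs_square_le_1)
    then have "t\<^sup>2 * (y / 2)\<^sup>2 \<le> 1 * (1 / 4)" using y4 by (intro mult_mono) auto
    then show ?thesis by (simp only: power_mult_distrib mult_1_left)
  qed
  have a2: "a\<^sup>2 \<le> 1 / 4" using ab power_mono[of a "1 / 2" 2] by (simp add: power_divide)
  have S: "computes c (meet m (lift Q n (upper Q h)) (center Q h) (rise Q (center Q h))) (P (1 / 2) (t * (y / 2)))"
  proof (rule meet_P[OF m n' center r, where \<alpha> = t and \<beta> = "t * (y / 2)"])
    show "(1 / 2 - b - (1 / 2 + a))\<^sup>2 + (y / 2 - 0)\<^sup>2 \<le> 1" 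
    proof -
      have "(1 / 2 - b - (1 / 2 + a))\<^sup>2 = (a + b)\<^sup>2" by (simp add: power2_eq_square algebra_simps)
      then show ?thesis using sq y4 by simp
    qed
  next
    have "t * (a + b) = (t * (1 + q)) * b" unfolding q(2) by (simp add: algebra_simps)
    then have "t * (a + b) = a" unfolding t(3)[symmetric] q(2)[symmetric] .
    then show "1 / 2 = 1 / 2 + a + t * (1 / 2 - b - (1 / 2 + a))" by (simp add: algebra_simps)
  next
    show "(1 / 2 - (1 / 2 + a))\<^sup>2 + (t * (y / 2) - 0)\<^sup>2 \<le> 1" using a2 ty by simp
    show "(1 / 2 - b - (1 / 2 + a)) * (1 - 0) \<noteq> (y / 2 - 0) * (1 / 2 - 1 / 2)" using ab by simp
    show "(1 / 2 - 1 / 2)\<^sup>2 + (t * (y / 2) - 0)\<^sup>2 \<le> 1" using ty by simp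
  qed (use t y in auto)
  have kq: "(k * (1 + q))\<^sup>2 \<le> 1 / 4"
    using power_mono[of "\<bar>k\<bar> * (1 + q)" "1 / 2" 2] k q(1)
    unfolding q_def[symmetric] by (simp add: power_mult_distrib power_divide)
  have "computes c (fourth_proportional Q h m n l) (P (1 / 2 - k * q) 0)"
    unfolding fourth_proportional_def
  proof (rule meet_P[OF l' S corners(1,2), where \<alpha> = "1 + q" and \<beta> = "1 / 2 - k * q"])
    have "(k)\<^sup>2 \<le> 1 / 4" using k' power_mono[of "\<bar>k\<bar>" "1 / 2" 2] by (simp add: power_divide)
    moreover have "(t * (y / 2) - y / 2)\<^sup>2 \<le> 1 / 4"
    proof -
      have "(1 - t)\<^sup>2 \<le> 1" using t by (simp add: abs_square_le_1)
      then have "(1 - t)\<^sup>2 * (y / 2)\<^sup>2 \<le> 1 * (1 / 4)" using y4 by (intro mult_mono) auto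
      moreover have "(t * (y / 2) - y / 2)\<^sup>2 = (1 - t)\<^sup>2 * (y / 2)\<^sup>2" by (simp add: power2_eq_square algebra_simps)
      ultimately show ?thesis by simp
    qed
    ultimately show "(1 / 2 - (1 / 2 + k))\<^sup>2 + (t * (y / 2) - y / 2)\<^sup>2 \<le> 1" by simp
    show "1 / 2 - k * q = 1 / 2 + k + (1 + q) * (1 / 2 - (1 / 2 + k))" by (simp add: algebra_simps)
    show "0 = y / 2 + (1 + q) * (t * (y / 2) - y / 2)"
    proof -
      have "(1 + q) * (1 - t) = 1" using t(3) by (simp add: algebra_simps)
      then have "(1 + q) * (1 - t) * (y / 2) = y / 2" by simp
      then show ?thesis by (simp add: algebra_simps)
    qed
    have "(1 / 2 - k * q - (1 / 2 + k))\<^sup>2 = (k * (1 + q))\<^sup>2" by (simp add: power2_eq_square algebra_simps)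
    then show "(1 / 2 - k * q - (1 / 2 + k))\<^sup>2 + (0 - y / 2)\<^sup>2 \<le> 1" using kq y4 by simp
    have "0 \<le> 1 / 2 - k * q" "1 / 2 - k * q \<le> 1" using k'(2) by (auto simp: abs_le_iff)
    then show "0 \<le> 1 / 2 - k * q" "(1 / 2 - k * q - 0)\<^sup>2 + (0 - 0)\<^sup>2 \<le> 1" by (simp_all add: abs_square_le_1)
    show "(1 / 2 - (1 / 2 + k)) * (0 - 0) \<noteq> (t * (y / 2) - y / 2) * (1 - 0)" using t y by simp
  qed (use q in auto)
  then show ?thesis unfolding q_def by simp
qed

end

section \<open>Arithmetic with real numbers\<close>

text \<open>An exponent \<open>k\<close> together with a program for the mantissa. The exponent is
  part of the program text, not of the figure.\<close>
type_synonym number = "nat \<times> nat prog"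

text \<open>Mantissas stay within \<open>1 / 8\<close> of the midpoint of the bottom side. All
  sticks in the operations below are then short enough, and a larger result is accommodated by a
  larger exponent, so that sums, differences and products are total.\<close>
definition represents :: "config \<Rightarrow> point \<Rightarrow> complex \<Rightarrow> complex \<Rightarrow> number \<Rightarrow> real \<Rightarrow> bool" where
  "represents c z u v N X \<longleftrightarrow> \<bar>X\<bar> \<le> 2 ^ fst N / 8 \<and> computes c (snd N) (pt z u v (1 / 2 + X / 2 ^ fst N) 0)"

lemma represents_mono: "represents c z u v N X \<Longrightarrow> c \<sqsubseteq> c' \<Longrightarrow> represents c' z u v N X"
  unfolding represents_def using computes_mono by blast

definition halve :: "square \<Rightarrow> nat prog \<Rightarrow> nat prog \<Rightarrow> nat prog" where
  "halve Q h m = mean Q h m (center Q h)"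

definition double :: "square \<Rightarrow> nat prog \<Rightarrow> nat prog \<Rightarrow> nat prog" where
  "double Q h m = mirror Q h (center Q h) m"

definition negate :: "square \<Rightarrow> nat prog \<Rightarrow> nat prog \<Rightarrow> nat prog" where
  "negate Q h m = mirror Q h m (center Q h)"

definition eighth :: "square \<Rightarrow> nat prog \<Rightarrow> nat prog" where
  "eighth Q h = halve Q h (halve Q h (br Q))"

definition zero :: "square \<Rightarrow> nat prog \<Rightarrow> number" where
  "zero Q h = (0, center Q h)"

definition one :: "square \<Rightarrow> nat prog \<Rightarrow> number" where
  "one Q h = (3, eighth Q h)"

text \<open>The mean of the mantissas is half their sum, which the exponent \<open>k + 1\<close>
  compensates.\<close>
definition add :: "square \<Rightarrow> nat prog \<Rightarrow> number \<Rightarrow> number \<Rightarrow> number" where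
  "add Q h M N = (let k = max (fst M) (fst N) in
     (k + 1, mean Q h ((halve Q h ^^ (k - fst M)) (snd M)) ((halve Q h ^^ (k - fst N)) (snd N))))"

definition neg :: "square \<Rightarrow> nat prog \<Rightarrow> number \<Rightarrow> number" where
  "neg Q h M = (fst M, negate Q h (snd M))"

definition sub :: "square \<Rightarrow> nat prog \<Rightarrow> number \<Rightarrow> number \<Rightarrow> number" where
  "sub Q h M N = add Q h M (neg Q h N)"

text \<open>For mantissas \<open>a\<close> and \<open>k\<close> of the factors, the fourth
  proportional is taken of \<open>(a + 1 / 8) / 2 \<ge> 0\<close>, \<open>1 / 16\<close> and
  \<open>k\<close>, which is \<open>-(8 * a + 1) * k\<close>; its mean with \<open>k\<close> is
  \<open>-4 * a * k\<close>. The shift by \<open>1 / 8\<close> makes the first argument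
  nonnegative.\<close>
definition mul :: "square \<Rightarrow> nat prog \<Rightarrow> number \<Rightarrow> number \<Rightarrow> number" where
  "mul Q h M N = (fst M + fst N,
     halve Q h (halve Q h (negate Q h (mean Q h
       (fourth_proportional Q h (mean Q h (snd M) (eighth Q h)) (negate Q h (halve Q h (eighth Q h))) (snd N))
       (snd N)))))"

text \<open>The argument \<open>e\<close> certifies the divisor to be at least \<open>1 / 2 ^
  e\<close>. A numerator of this size keeps the quotient bounded, however small the divisor
  is.\<close>
definition invert :: "square \<Rightarrow> nat prog \<Rightarrow> nat \<Rightarrow> number \<Rightarrow> number" where
  "invert Q h e N = (e + 3, negate Q h
     (fourth_proportional Q h ((halve Q h ^^ (e + fst N - 3)) (eighth Q h)) (negate Q h (snd N)) (eighth Q h)))"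

definition scale_up :: "nat \<Rightarrow> number \<Rightarrow> number" where
  "scale_up n N = (fst N + n, snd N)"

definition scale_down :: "square \<Rightarrow> nat prog \<Rightarrow> nat \<Rightarrow> number \<Rightarrow> number" where
  "scale_down Q h n N = (fst N, (halve Q h ^^ n) (snd N))"

definition integer :: "square \<Rightarrow> nat prog \<Rightarrow> int \<Rightarrow> number" where
  "integer Q h i = (let n = (add Q h (one Q h) ^^ nat \<bar>i\<bar>) (zero Q h) in if i \<ge> 0 then n else neg Q h n)"

text \<open>The midpoint of the bottom side stands for zero, hence the shift by \<open>1 /
  2\<close>; doubling the mantissa then removes the exponent.\<close>
definition to_abscissa :: "square \<Rightarrow> nat prog \<Rightarrow> number \<Rightarrow> nat prog" where
  "to_abscissa Q h N = (let M = sub Q h N (scale_down Q h 1 (one Q h)) in (double Q h ^^ fst M) (snd M))"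

text \<open>Two halvings towards the midpoint bring any point of the bottom side into the range of
  mantissas, hence the exponent 2.\<close>
definition of_abscissa :: "square \<Rightarrow> nat prog \<Rightarrow> nat prog \<Rightarrow> number" where
  "of_abscissa Q h m = add Q h (2, halve Q h (halve Q h m)) (scale_down Q h 1 (one Q h))"

text \<open>A height \<open>w\<close> on the left side is not a number yet. The unit circle around
  it meets the bottom side at \<open>a\<close> and the top side at \<open>b\<close> with
  \<open>a\<^sup>2 = 1 - w\<^sup>2\<close> and \<open>b\<^sup>2 = 1 - (1 - w)\<^sup>2\<close>. The
  difference \<open>b\<^sup>2 - a\<^sup>2 = 2 * w - 1\<close> is linear in
  \<open>w\<close>.\<close>
definition of_ordinate :: "square \<Rightarrow> nat prog \<Rightarrow> nat prog \<Rightarrow> number" where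
  "of_ordinate Q h m = (let
     a = of_abscissa Q h (strike m (bl Q) (br Q));
     b = of_abscissa Q h (strike (strike m (tl Q) (tr Q)) (bl Q) (br Q))
   in scale_down Q h 1 (add Q h (one Q h) (sub Q h (mul Q h b b) (mul Q h a a))))"

definition to_circle :: "square \<Rightarrow> nat prog \<Rightarrow> number \<Rightarrow> nat prog" where
  "to_circle Q h N = strike (to_abscissa Q h N) (bl Q) (tl Q)"

text \<open>For \<open>0 \<le> x \<le> 1\<close>, the number \<open>q = (1 - x) / (1 + x)\<close>
  satisfies \<open>1 - q\<^sup>2 = 4 * x / (1 + x)\<^sup>2\<close>, so \<open>sqrt x\<close> is
  half of \<open>(1 + x) * sqrt (1 - q\<^sup>2)\<close>. Here \<open>x\<close> is the radicand
  divided by \<open>2 ^ (2 * k)\<close>, whose root the final scaling restores, and \<open>1 + x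
  \<ge> 1\<close> certifies the division with \<open>e = 0\<close>.\<close>
definition square_root :: "square \<Rightarrow> nat prog \<Rightarrow> number \<Rightarrow> number" where
  "square_root Q h N = (let
     k = fst N;
     a = add Q h (one Q h) (scale_down Q h (2 * k) N);
     b = sub Q h (one Q h) (scale_down Q h (2 * k) N);
     s = of_ordinate Q h (to_circle Q h (mul Q h b (invert Q h 0 a)))
   in scale_up k (scale_down Q h 1 (mul Q h s a)))"

text \<open>The far end of the stick from the midpoint through the left corner is exactly one unit
  left of the midpoint. So a single comparison with the unit shows on which side of the midpoint
  the mantissa lies.\<close>
definition nonneg :: "square \<Rightarrow> nat prog \<Rightarrow> number \<Rightarrow> bool prog" where
  "nonneg Q h N = do {
     i \<leftarrow> snd N;
     j \<leftarrow> tip (center Q h) (bl Q);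
     obs \<leftarrow> compare i j;
     give (obs \<noteq> Shorter) }"

definition lower_bound :: "square \<Rightarrow> nat prog \<Rightarrow> number \<Rightarrow> nat prog" where
  "lower_bound Q h N = search (\<lambda>e. do {
     b \<leftarrow> nonneg Q h (sub Q h N (scale_down Q h e (one Q h)));
     give (if b then Some e else None) })"

context sheet
begin

abbreviation rep :: "number \<Rightarrow> real \<Rightarrow> bool" where
  "rep \<equiv> represents c z u v"

lemma halve:
  assumes "computes c m (P (1 / 2 + a) 0)" "\<bar>a\<bar> \<le> 1 / 2"
  shows "computes c (halve Q h m) (P (1 / 2 + a / 2) 0)"
proof -
  have "computes c (halve Q h m) (P ((1 / 2 + a + 1 / 2) / 2) 0)"
    unfolding halve_def by (rule mean[OF assms(1) _ _ center]) (use assms(2) in auto)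
  then show ?thesis by (rule computes_abscissa) simp
qed

lemma halve_pow:
  assumes "computes c m (P (1 / 2 + a) 0)" "\<bar>a\<bar> \<le> 1 / 2"
  shows "computes c ((halve Q h ^^ n) m) (P (1 / 2 + a / 2 ^ n) 0)"
proof (induction n)
  case 0
  then show ?case using assms by simp
next
  case (Suc n)
  have "\<bar>a / 2 ^ n\<bar> \<le> \<bar>a\<bar>"
    by (simp add: abs_divide divide_le_eq mult_left_le one_le_power mult_le_cancel_left1)
  then have "\<bar>a / 2 ^ n\<bar> \<le> 1 / 2" using assms(2) by linarith
  from halve[OF Suc this] show ?case by (simp add: mult.commute)
qed

lemma double:
  assumes "computes c m (P (1 / 2 + a) 0)" "\<bar>a\<bar> \<le> 1 / 4"
  shows "computes c (double Q h m) (P (1 / 2 + 2 * a) 0)"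
proof -
  have "computes c (double Q h m) (P (2 * (1 / 2 + a) - 1 / 2) 0)"
    unfolding double_def by (rule mirror[OF center _ _ assms(1)]) (use assms(2) in auto)
  moreover have "2 * (1 / 2 + a) - 1 / 2 = 1 / 2 + 2 * a" by simp
  ultimately show ?thesis by simp
qed

lemma double_pow:
  assumes "computes c m (P (1 / 2 + a) 0)" "\<bar>a\<bar> * 2 ^ n \<le> 1 / 2"
  shows "computes c ((double Q h ^^ n) m) (P (1 / 2 + a * 2 ^ n) 0)"
  using assms(2)
proof (induction n)
  case 0
  then show ?case using assms(1) by simp
next
  case (Suc n)
  have "\<bar>a * 2 ^ n\<bar> \<le> 1 / 4" using Suc.prems by (simp add: abs_mult)
  moreover have "\<bar>a\<bar> * 2 ^ n \<le> 1 / 2" using calculation by (simp add: abs_mult)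
  ultimately show ?case using double[OF Suc.IH] by (simp add: mult_ac)
qed

lemma negate:
  assumes "computes c m (P (1 / 2 + a) 0)" "\<bar>a\<bar> \<le> 1 / 4"
  shows "computes c (negate Q h m) (P (1 / 2 - a) 0)"
proof -
  have "computes c (negate Q h m) (P (2 * (1 / 2) - (1 / 2 + a)) 0)"
    unfolding negate_def by (rule mirror[OF assms(1) _ _ center]) (use assms(2) in auto)
  then show ?thesis by simp
qed

lemma eighth: "computes c (eighth Q h) (P (1 / 2 + 1 / 8) 0)"
proof -
  have "computes c (br Q) (P (1 / 2 + 1 / 2) 0)" using corners by simp
  then have "computes c (halve Q h (br Q)) (P (1 / 2 + 1 / 2 / 2) 0)" by (rule halve) simp
  then have "computes c (eighth Q h) (P (1 / 2 + 1 / 2 / 2 / 2) 0)"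
    unfolding eighth_def by (rule halve) simp
  then show ?thesis by simp
qed

lemma mean_offset:
  assumes "computes c m (P (1 / 2 + a) 0)" "computes c n (P (1 / 2 + b) 0)"
    "\<bar>a\<bar> \<le> 1 / 2" "\<bar>b\<bar> \<le> 1 / 2" "\<bar>a - b\<bar> \<le> 1 / 2"
  shows "computes c (mean Q h m n) (P (1 / 2 + (a + b) / 2) 0)"
proof -
  have "computes c (mean Q h m n) (P ((1 / 2 + a + (1 / 2 + b)) / 2) 0)"
    by (rule mean[OF assms(1) _ _ assms(2)]) (use assms(3-5) in auto)
  then show ?thesis by (rule computes_abscissa) (simp add: field_simps)
qed

lemma mantissa:
  assumes "rep N X"
  shows "computes c (snd N) (P (1 / 2 + X / 2 ^ fst N) 0)" "\<bar>X / 2 ^ fst N\<bar> \<le> 1 / 8"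
  using assms unfolding represents_def by (auto simp: field_simps)

lemma repI:
  assumes "computes c m (P (1 / 2 + X / 2 ^ k) 0)" "\<bar>X / 2 ^ k\<bar> \<le> 1 / 8"
  shows "rep (k, m) X"
  using assms unfolding represents_def by (auto simp: field_simps)

lemma rep_zero: "rep (zero Q h) 0"
  unfolding zero_def by (rule repI) (use center in simp_all)

lemma rep_one: "rep (one Q h) 1"
  unfolding one_def by (rule repI) (use eighth in simp_all)

lemma rep_scale_up: "rep N X \<Longrightarrow> rep (scale_up n N) (X * 2 ^ n)"
  unfolding scale_up_def by (intro repI) (auto dest: mantissa simp: power_add)

lemma rep_scale_down:
  assumes "rep N X" shows "rep (scale_down Q h n N) (X / 2 ^ n)"
  unfolding scale_down_def
proof (rule repI)
  note m = mantissa[OF assms]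
  have "\<bar>X / 2 ^ fst N / 2 ^ n\<bar> \<le> \<bar>X / 2 ^ fst N\<bar>"
    by (simp only: abs_divide divide_le_eq) (simp add: mult_le_cancel_left1)
  moreover have eq: "X / 2 ^ n / 2 ^ fst N = X / 2 ^ fst N / 2 ^ n" by (simp add: field_simps)
  ultimately show "\<bar>X / 2 ^ n / 2 ^ fst N\<bar> \<le> 1 / 8" unfolding eq using m(2) by linarith
  have "\<bar>X / 2 ^ fst N\<bar> \<le> 1 / 2" using m(2) by linarith
  then show "computes c ((halve Q h ^^ n) (snd N)) (P (1 / 2 + X / 2 ^ n / 2 ^ fst N) 0)"
    unfolding eq by (rule halve_pow[OF m(1)])
qed

lemma rep_add:
  assumes "rep M X" "rep N Y" shows "rep (add Q h M N) (X + Y)"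
proof -
  define k where "k = max (fst M) (fst N)"
  have aux: "computes c ((halve Q h ^^ (k - fst L)) (snd L)) (P (1 / 2 + Z / 2 ^ k) 0) \<and> \<bar>Z / 2 ^ k\<bar> \<le> 1 / 8"
    if L: "rep L Z" and "fst L \<le> k" for L Z
  proof -
    have k: "k = fst L + (k - fst L)" using that by simp
    have "rep (scale_down Q h (k - fst L) L) (Z / 2 ^ (k - fst L))" using L by (rule rep_scale_down)
    note r = mantissa[OF this, unfolded scale_down_def fst_conv snd_conv]
    have eq: "Z / 2 ^ (k - fst L) / 2 ^ fst L = Z / 2 ^ k"
      by (subst (2) k) (simp add: power_add)
    from r[unfolded eq] show ?thesis by blast
  qed
  have M: "computes c ((halve Q h ^^ (k - fst M)) (snd M)) (P (1 / 2 + X / 2 ^ k) 0)" "\<bar>X / 2 ^ k\<bar> \<le> 1 / 8"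
    using aux[OF assms(1)] by (auto simp: k_def)
  have N: "computes c ((halve Q h ^^ (k - fst N)) (snd N)) (P (1 / 2 + Y / 2 ^ k) 0)" "\<bar>Y / 2 ^ k\<bar> \<le> 1 / 8"
    using aux[OF assms(2)] by (auto simp: k_def)
  have eq: "(X / 2 ^ k + Y / 2 ^ k) / 2 = (X + Y) / 2 ^ (k + 1)" by (simp add: field_simps)
  have small: "\<bar>X / 2 ^ k\<bar> \<le> 1 / 2" "\<bar>Y / 2 ^ k\<bar> \<le> 1 / 2" "\<bar>X / 2 ^ k - Y / 2 ^ k\<bar> \<le> 1 / 2"
    using M(2) N(2) by linarith+
  have "\<bar>(a + b) / 2\<bar> \<le> 1 / 8" if "\<bar>a\<bar> \<le> 1 / 8" "\<bar>b\<bar> \<le> 1 / 8" for a b :: real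
    using that abs_triangle_ineq[of a b] unfolding abs_divide by simp
  note range = this[OF M(2) N(2), unfolded eq]
  show ?thesis
    unfolding add_def Let_def k_def[symmetric]
    by (rule repI[OF mean_offset[OF M(1) N(1) small, unfolded eq] range])
qed

lemma rep_neg:
  assumes "rep N X" shows "rep (neg Q h N) (- X)"
  unfolding neg_def by (rule repI) (use mantissa[OF assms] negate[OF mantissa(1)[OF assms]] in auto)

lemma rep_sub: "rep M X \<Longrightarrow> rep N Y \<Longrightarrow> rep (sub Q h M N) (X - Y)"
  unfolding sub_def using rep_add[OF _ rep_neg] by fastforce

lemma rep_mul:
  assumes "rep M X" "rep N Y" shows "rep (mul Q h M N) (X * Y)"
proof -
  let ?F = "fourth_proportional Q h (mean Q h (snd M) (eighth Q h)) (negate Q h (halve Q h (eighth Q h))) (snd N)"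
  define a where "a = X / 2 ^ fst M"
  define k where "k = Y / 2 ^ fst N"
  note m = mantissa[OF assms(1), folded a_def] and n = mantissa[OF assms(2), folded k_def]
  have ak: "\<bar>a * k\<bar> \<le> 1 / 8 * (1 / 8)" unfolding abs_mult using m(2) n(2) by (intro mult_mono) auto
  have A: "computes c (mean Q h (snd M) (eighth Q h)) (P (1 / 2 + (a + 1 / 8) / 2) 0)"
    by (rule mean_offset[OF m(1) eighth]) (use m(2) in auto)
  have "computes c (halve Q h (eighth Q h)) (P (1 / 2 + 1 / 8 / 2) 0)" by (rule halve[OF eighth]) simp
  then have "computes c (negate Q h (halve Q h (eighth Q h))) (P (1 / 2 - 1 / 8 / 2) 0)" by (rule negate) simp
  then have B: "computes c (negate Q h (halve Q h (eighth Q h))) (P (1 / 2 - 1 / 16) 0)" by simp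
  have quot: "(a + 1 / 8) / 2 / (1 / 16) = 8 * a + 1" by simp
  have "\<bar>k\<bar> * (1 + (a + 1 / 8) / 2 / (1 / 16)) \<le> 1 / 8 * 3"
    unfolding quot using m(2) n(2) by (intro mult_mono) auto
  then have "computes c ?F
      (P (1 / 2 - k * ((a + 1 / 8) / 2) / (1 / 16)) 0)"
    by (intro fourth_proportional[OF A B n(1)]) (use m(2) in auto)
  then have C: "computes c ?F
      (P (1 / 2 + (- 8 * (a * k) - k)) 0)"
    by (rule computes_abscissa) (simp add: field_simps)
  have "computes c (mean Q h ?F (snd N)) (P (1 / 2 + (- 8 * (a * k) - k + k) / 2) 0)"
    by (rule mean_offset[OF C n(1)]) (use ak n(2) in linarith)+
  then have D: "computes c (mean Q h ?F (snd N)) (P (1 / 2 + (- 4 * (a * k))) 0)"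
    by simp
  have E: "computes c (negate Q h (mean Q h ?F (snd N))) (P (1 / 2 + 4 * (a * k)) 0)"
    using negate[OF D] ak by simp
  have F: "computes c (snd (mul Q h M N)) (P (1 / 2 + 4 * (a * k) / 2 / 2) 0)"
    unfolding mul_def snd_conv
    by (rule halve, rule halve[OF E]) (use ak in linarith)+
  have "4 * (a * k) / 2 / 2 = X * Y / 2 ^ (fst M + fst N)"
    unfolding a_def k_def by (simp add: power_add)
  then show ?thesis
    using F ak unfolding mul_def by (intro repI) (simp_all add: a_def k_def power_add)
qed

lemma rep_invert:
  assumes "rep N Y" and Y: "1 / 2 ^ e \<le> Y" shows "rep (invert Q h e N) (1 / Y)"
proof -
  define b where "b = Y / 2 ^ fst N"
  note m = mantissa[OF assms(1), folded b_def]
  have Y0: "0 < Y" using Y by (smt (verit) zero_less_divide_1_iff zero_less_power)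
  then have b: "0 < b" "b \<le> 1 / 8" using m(2) unfolding b_def by auto
  have "1 / 2 ^ (e + fst N) \<le> b"
    using divide_right_mono[OF Y, of "2 ^ fst N"] unfolding b_def by (simp add: power_add)
  note ab = this order_trans[OF this b(2)]
  from ab(2) have "(2::real) ^ 3 \<le> 2 ^ (e + fst N)" by (simp add: field_simps)
  then have e3: "3 \<le> e + fst N" by (subst (asm) power_increasing_iff) auto
  have "computes c ((halve Q h ^^ (e + fst N - 3)) (eighth Q h)) (P (1 / 2 + 1 / 8 / 2 ^ (e + fst N - 3)) 0)"
    by (rule halve_pow[OF eighth]) simp
  moreover have "(1 / 8 :: real) / 2 ^ (e + fst N - 3) = 1 / 2 ^ (e + fst N)"
  proof -
    have "(2::real) ^ (e + fst N) = 2 ^ 3 * 2 ^ (e + fst N - 3)"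
      using e3 by (metis le_add_diff_inverse power_add)
    then show ?thesis by simp
  qed
  ultimately have A: "computes c ((halve Q h ^^ (e + fst N - 3)) (eighth Q h)) (P (1 / 2 + 1 / 2 ^ (e + fst N)) 0)"
    by simp
  have B: "computes c (negate Q h (snd N)) (P (1 / 2 - b) 0)"
    by (rule negate[OF m(1)]) (use b in auto)
  have q: "1 / 2 ^ (e + fst N) / b \<le> 1" using ab(1) b(1) by (simp only: pos_divide_le_eq mult_1)
  have C: "computes c (fourth_proportional Q h ((halve Q h ^^ (e + fst N - 3)) (eighth Q h)) (negate Q h (snd N)) (eighth Q h))
      (P (1 / 2 - 1 / 8 * (1 / 2 ^ (e + fst N)) / b) 0)"
  proof (rule fourth_proportional[OF A B eighth])
    have "\<bar>1 / 8\<bar> * (1 + t) \<le> 1 / 2" if "t \<le> 1" for t :: real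
      using that by simp
    then show "\<bar>1 / 8\<bar> * (1 + 1 / 2 ^ (e + fst N) / b) \<le> 1 / 2" using q by blast
  qed (use ab(2) b in auto)
  have eq: "1 / 8 * (1 / 2 ^ (e + fst N)) / b = 1 / Y / 2 ^ (e + 3)"
    unfolding b_def using Y0 by (simp add: power_add field_simps)
  have small: "1 / Y / 2 ^ (e + 3) \<le> 1 / 8" "0 \<le> 1 / Y / 2 ^ (e + 3)"
    unfolding eq[symmetric] using q b by simp_all
  have "computes c (snd (invert Q h e N)) (P (1 / 2 - - (1 / Y / 2 ^ (e + 3))) 0)"
    unfolding invert_def snd_conv
    by (rule negate) (use C[unfolded eq] small in auto)
  then show ?thesis
    unfolding invert_def by (intro repI) (use small in auto)
qed

lemma rep_integer: "rep (integer Q h i) (of_int i)"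
proof -
  have n: "rep ((add Q h (one Q h) ^^ n) (zero Q h)) (real n)" for n
  proof (induction n)
    case 0
    then show ?case using rep_zero by simp
  next
    case (Suc n)
    then show ?case using rep_add[OF rep_one Suc] by simp
  qed
  show ?thesis
    using n[of "nat \<bar>i\<bar>"] rep_neg[OF n[of "nat \<bar>i\<bar>"]] unfolding integer_def Let_def by auto
qed

lemma rep_half: "rep (scale_down Q h 1 (one Q h)) (1 / 2)"
  using rep_scale_down[OF rep_one, of 1] by simp

lemma to_abscissa:
  assumes "rep N X" "0 \<le> X" "X \<le> 1"
  shows "computes c (to_abscissa Q h N) (P X 0)"
proof -
  define M where "M = sub Q h N (scale_down Q h 1 (one Q h))"
  have "rep M (X - 1 / 2)" unfolding M_def using rep_sub[OF assms(1) rep_half] .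
  note m = mantissa[OF this]
  have "\<bar>(X - 1 / 2) / 2 ^ fst M\<bar> * 2 ^ fst M = \<bar>X - 1 / 2\<bar>" by (simp add: abs_divide)
  also have "\<dots> \<le> 1 / 2" using assms by linarith
  finally have "computes c ((double Q h ^^ fst M) (snd M)) (P (1 / 2 + (X - 1 / 2) / 2 ^ fst M * 2 ^ fst M) 0)"
    by (rule double_pow[OF m(1)])
  then show ?thesis unfolding to_abscissa_def M_def[symmetric] Let_def by simp
qed

lemma of_abscissa:
  assumes "computes c m (P x 0)" "0 \<le> x" "x \<le> 1"
  shows "rep (of_abscissa Q h m) x"
proof -
  have x: "\<bar>x - 1 / 2\<bar> \<le> 1 / 2" using assms by linarith
  have "computes c m (P (1 / 2 + (x - 1 / 2)) 0)" using assms by simp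
  then have "computes c (halve Q h m) (P (1 / 2 + (x - 1 / 2) / 2) 0)" using x by (rule halve)
  then have "computes c (halve Q h (halve Q h m)) (P (1 / 2 + (x - 1 / 2) / 2 / 2) 0)"
    by (rule halve) (use x in \<open>simp add: abs_divide\<close>)
  moreover have "\<bar>(x - 1 / 2) / 2 / 2\<bar> \<le> 1 / 8" using x by (simp add: abs_divide)
  ultimately have "rep (2, halve Q h (halve Q h m)) (x - 1 / 2)" by (intro repI) simp_all
  then show ?thesis unfolding of_abscissa_def using rep_add[OF _ rep_half] by fastforce
qed

lemma of_ordinate:
  assumes m: "computes c m (P 0 w)" and w: "0 \<le> w" "w \<le> 1"
  shows "rep (of_ordinate Q h m) w"
proof -
  define a where "a = sqrt (1 - w\<^sup>2)"
  define b where "b = sqrt (1 - (1 - w)\<^sup>2)"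
  have "w\<^sup>2 \<le> 1" "(1 - w)\<^sup>2 \<le> 1" using w by (simp_all add: abs_square_le_1)
  then have a: "0 \<le> a" "a \<le> 1" "a\<^sup>2 + w\<^sup>2 = 1" and b: "0 \<le> b" "b \<le> 1" "b\<^sup>2 + (1 - w)\<^sup>2 = 1"
    unfolding a_def b_def by simp_all
  have A: "computes c (strike m (bl Q) (br Q)) (P a 0)"
    by (rule bottom_left[OF m a])
  have B': "computes c (strike m (tl Q) (tr Q)) (P b 1)"
    by (rule strike_row[OF m corners(3,4)]) (use b in auto)
  have B: "computes c (strike (strike m (tl Q) (tr Q)) (bl Q) (br Q)) (P b 0)"
    by (rule strike_row[OF B' corners(1,2)]) (use b in auto)
  note ra = of_abscissa[OF A a(1,2)] and rb = of_abscissa[OF B b(1,2)]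
  have "rep (of_ordinate Q h m) ((1 + (b * b - a * a)) / 2 ^ 1)"
    unfolding of_ordinate_def Let_def
    by (intro rep_scale_down rep_add rep_sub rep_mul rep_one ra rb)
  moreover have "(1 + (b * b - a * a)) / 2 ^ 1 = w"
    using a(3) b(3) by (simp add: power2_eq_square algebra_simps)
  ultimately show ?thesis by simp
qed

lemma to_circle:
  assumes "rep N X" "0 \<le> X" "X \<le> 1"
  shows "computes c (to_circle Q h N) (P 0 (sqrt (1 - X\<^sup>2)))"
proof -
  have "X\<^sup>2 \<le> 1" using assms by (simp add: abs_square_le_1)
  then show ?thesis
    unfolding to_circle_def
    by (intro strike_column[OF to_abscissa[OF assms] corners(1,3)]) auto
qed

lemma square_root:
  assumes N: "rep N X" and X: "0 \<le> X"
  shows "rep (square_root Q h N) (sqrt X)"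
proof -
  define k where "k = fst N"
  define x where "x = X / 2 ^ (2 * k)"
  have "\<bar>X\<bar> \<le> 2 ^ k / 8" using N unfolding represents_def k_def by blast
  moreover have "(2::real) ^ k \<le> 2 ^ (2 * k)" by (rule power_increasing) auto
  moreover have "(0::real) \<le> 2 ^ k" by simp
  ultimately have "X \<le> 2 ^ (2 * k)" by linarith
  then have x: "0 \<le> x" "x \<le> 1" unfolding x_def using X by simp_all
  have rx: "rep (scale_down Q h (2 * k) N) x" unfolding x_def using rep_scale_down[OF N] .
  note ra = rep_add[OF rep_one rx] and rb = rep_sub[OF rep_one rx]
  have ri: "rep (invert Q h 0 (add Q h (one Q h) (scale_down Q h (2 * k) N))) (1 / (1 + x))"
    by (rule rep_invert[OF ra]) (use x in simp)
  define q where "q = (1 - x) * (1 / (1 + x))"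
  have q: "0 \<le> q" "q \<le> 1" unfolding q_def using x by simp_all
  have q2: "q\<^sup>2 \<le> 1" using q by (simp add: abs_square_le_1)
  note circ = to_circle[OF rep_mul[OF rb ri, folded q_def] q]
  have "rep (of_ordinate Q h (to_circle Q h (mul Q h (sub Q h (one Q h) (scale_down Q h (2 * k) N))
      (invert Q h 0 (add Q h (one Q h) (scale_down Q h (2 * k) N)))))) (sqrt (1 - q\<^sup>2))"
    by (rule of_ordinate[OF circ]) (use q2 in auto)
  then have "rep (square_root Q h N) (sqrt (1 - q\<^sup>2) * (1 + x) / 2 ^ 1 * 2 ^ k)"
    unfolding square_root_def Let_def k_def[symmetric]
    by (intro rep_scale_up rep_scale_down rep_mul ra)
  moreover have "sqrt (1 - q\<^sup>2) * (1 + x) / 2 ^ 1 * 2 ^ k = sqrt X"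
  proof -
    have "1 - q\<^sup>2 = 4 * x / (1 + x)\<^sup>2"
    proof -
      have "q * (1 + x) = 1 - x" unfolding q_def using x by simp
      then have "(1 - q\<^sup>2) * (1 + x)\<^sup>2 = 4 * x" by algebra
      moreover have "1 + x \<noteq> 0" using x by simp
      ultimately show ?thesis by (simp add: eq_divide_eq)
    qed
    then have "sqrt (1 - q\<^sup>2) = 2 * sqrt x / (1 + x)"
      using x by (simp add: real_sqrt_divide real_sqrt_mult)
    moreover have "sqrt X = sqrt x * 2 ^ k"
      unfolding x_def by (simp add: real_sqrt_divide power_mult real_sqrt_power power2_eq_square real_sqrt_mult flip: power_mult_distrib)
    ultimately show ?thesis using x by (simp add: field_simps)
  qed
  ultimately show ?thesis by simp
qed

lemma ensures_nonneg:
  assumes N: "rep N X"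
  shows "ensures c (nonneg Q h N) (\<lambda>b _. b \<longleftrightarrow> 0 \<le> X)"
proof -
  note m = mantissa[OF N]
  have t: "computes c (tip (center Q h) (bl Q)) (P (1 / 2 - 1) 0)"
    by (rule tip_left[OF center corners(1)]) simp_all
  have "dist (P (1 / 2 + X / 2 ^ fst N) 0) (P (1 / 2 - 1) 0) = \<bar>1 + X / 2 ^ fst N\<bar>"
    unfolding dist_P_sqrt by simp
  also have "\<dots> = 1 + X / 2 ^ fst N" using m(2) by linarith
  finally have "dist (P (1 / 2 + X / 2 ^ fst N) 0) (P (1 / 2 - 1) 0) = 1 + X / 2 ^ fst N" .
  then have "compare_unit (dist (P (1 / 2 + X / 2 ^ fst N) 0) (P (1 / 2 - 1) 0)) \<noteq> Shorter \<longleftrightarrow> 0 \<le> X"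
    using pos_le_divide_eq[of "2 ^ fst N" 0 X] by (simp add: not_less)
  then show ?thesis
    unfolding nonneg_def
    by (intro ensures_bind_point[OF m(1)] ensures_bind_point[OF computes_mono[OF t]]
        ensures_bind[OF ensures_compare] ensures_give) (auto intro: given_point_mono)
qed

text \<open>The loop ends by the Archimedean property.\<close>
lemma ensures_lower_bound:
  assumes N: "rep N X" and X: "0 < X"
  shows "ensures c (lower_bound Q h N) (\<lambda>e _. 1 / 2 ^ e \<le> X)"
proof -
  obtain e0 where e0: "(1 / 2) ^ e0 < X"
    using X real_arch_pow_inv[of X "1 / 2"] by auto
  have *: "ensures c (do { b \<leftarrow> nonneg Q h (sub Q h N (scale_down Q h e (one Q h)));
     give (if b then Some e else None) })
     (\<lambda>r c'. case r of None \<Rightarrow> e \<noteq> e0 | Some e \<Rightarrow> 1 / 2 ^ e \<le> X)" for e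
  proof (rule ensures_bind[OF ensures_nonneg[OF rep_sub[OF N rep_scale_down[OF rep_one, of e]]]], rule ensures_give)
    fix b :: bool assume "b \<longleftrightarrow> 0 \<le> X - 1 / 2 ^ e"
    then show "case if b then Some e else None of None \<Rightarrow> e \<noteq> e0 | Some e \<Rightarrow> 1 / 2 ^ e \<le> X"
      using e0 by (auto simp: power_one_over)
  qed
  show ?thesis
    unfolding lower_bound_def using points * by (rule ensures_search)
qed

end

section \<open>The lattice of unit squares\<close>

datatype direction = East | West | North | South

instance direction :: countable
  by countable_datatype

primrec move :: "direction \<Rightarrow> square \<Rightarrow> square" where
  "move East Q = Square (br Q) (beyond (bl Q) (br Q)) (tr Q) (beyond (tl Q) (tr Q))"
| "move West Q = Square (beyond (br Q) (bl Q)) (bl Q) (beyond (tr Q) (tl Q)) (tl Q)"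
| "move North Q = Square (tl Q) (tr Q) (beyond (bl Q) (tl Q)) (beyond (br Q) (tr Q))"
| "move South Q = Square (beyond (tl Q) (bl Q)) (beyond (tr Q) (br Q)) (bl Q) (br Q)"

primrec cell :: "direction list \<Rightarrow> square \<Rightarrow> square" where
  "cell [] Q = Q"
| "cell (d # ds) Q = move d (cell ds Q)"

text \<open>The displacement of a cell from the original square, counted along the path that leads
  to it.\<close>
definition easting :: "direction list \<Rightarrow> int" where
  "easting ds = (\<Sum>d\<leftarrow>ds. case d of East \<Rightarrow> 1 | West \<Rightarrow> - 1 | _ \<Rightarrow> 0)"

definition northing :: "direction list \<Rightarrow> int" where
  "northing ds = (\<Sum>d\<leftarrow>ds. case d of North \<Rightarrow> 1 | South \<Rightarrow> - 1 | _ \<Rightarrow> 0)"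

lemma easting_simps [simp]:
  "easting [] = 0" "easting (East # ds) = easting ds + 1" "easting (West # ds) = easting ds - 1"
  "easting (North # ds) = easting ds" "easting (South # ds) = easting ds"
  by (simp_all add: easting_def)

lemma northing_simps [simp]:
  "northing [] = 0" "northing (East # ds) = northing ds" "northing (West # ds) = northing ds"
  "northing (North # ds) = northing ds + 1" "northing (South # ds) = northing ds - 1"
  by (simp_all add: northing_def)

definition path :: "int \<Rightarrow> int \<Rightarrow> direction list" where
  "path i j = replicate (nat i) East @ replicate (nat (- i)) West @
     replicate (nat j) North @ replicate (nat (- j)) South"

lemma easting_path [simp]: "easting (path i j) = i" and northing_path [simp]: "northing (path i j) = j"
  unfolding easting_def northing_def path_def by (auto simp: sum_list_replicate)

text \<open>Exchanges the roles of rows and columns.\<close>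
definition transpose_square :: "square \<Rightarrow> square" where
  "transpose_square Q = Square (bl Q) (tl Q) (br Q) (tr Q)"

lemma computes_transpose: "computes_square c Q z u v \<Longrightarrow> computes_square c (transpose_square Q) z v u"
  unfolding computes_square_def transpose_square_def by (simp add: pt_swap[of z v u])

lemma computes_square_mono: "computes_square c Q z u v \<Longrightarrow> c \<sqsubseteq> c' \<Longrightarrow> computes_square c' Q z u v"
  unfolding computes_square_def using computes_mono by blast

text \<open>Moves a point from the bottom side of a remote cell to the corresponding point of the
  original square, one cell at a time. A vertical move is a tangency, a horizontal one is a unit
  step along the row.\<close>
primrec carry_home :: "square \<Rightarrow> direction list \<Rightarrow> nat prog \<Rightarrow> nat prog" where
  "carry_home Q [] m = m"
| "carry_home Q (d # ds) m = carry_home Q ds (strike m (bl (cell ds Q)) (br (cell ds Q)))"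

primrec carry_out :: "square \<Rightarrow> direction list \<Rightarrow> nat prog \<Rightarrow> nat prog" where
  "carry_out Q [] m = m"
| "carry_out Q (d # ds) m = strike (carry_out Q ds m) (bl (cell (d # ds) Q)) (br (cell (d # ds) Q))"

text \<open>Looks for a row of the lattice that the unit circle around the given point meets in
  two points. The observation that two points were found on collinear sticks certifies that they
  are all the intersections with that row, so they are symmetric about the foot of the
  perpendicular from the given point.\<close>
definition row_points :: "square \<Rightarrow> nat \<Rightarrow> (nat \<times> nat) prog" where
  "row_points Q i = search (\<lambda>n. case from_nat n of (ds, es) \<Rightarrow>
     if northing ds = northing es then do {
       (_, k) \<leftarrow> rod (bl (cell ds Q)) (br (cell ds Q));
       (_, l) \<leftarrow> rod (bl (cell es Q)) (br (cell es Q));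
       xs \<leftarrow> ruler i [k, l];
       give (if length xs = 2 then Some (xs ! 0, xs ! 1) else None) }
     else give None)"

text \<open>A point of a row lies on the bottom side of a cell iff it is within the unit of both
  ends of that side.\<close>
definition locate :: "square \<Rightarrow> nat \<Rightarrow> direction list prog" where
  "locate Q i = search (\<lambda>n. do {
     a \<leftarrow> bl (cell (from_nat n) Q);
     b \<leftarrow> br (cell (from_nat n) Q);
     d \<leftarrow> compare i a;
     e \<leftarrow> compare i b;
     give (if d \<noteq> Longer \<and> e \<noteq> Longer then Some (from_nat n) else None) })"

definition feet :: "square \<Rightarrow> nat \<Rightarrow> ((int \<times> nat prog) \<times> (int \<times> nat prog)) prog" where
  "feet Q i = do {
     (a, b) \<leftarrow> row_points Q i;
     ds \<leftarrow> locate Q a;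
     es \<leftarrow> locate Q b;
     give ((easting ds, carry_home Q ds (give a)), (easting es, carry_home Q es (give b))) }"

context frame
begin

lemma square_P:
  "computes_square c Q (P i j) u v \<longleftrightarrow> computes c (bl Q) (P i j) \<and> computes c (br Q) (P (i + 1) j) \<and>
     computes c (tl Q) (P i (j + 1)) \<and> computes c (tr Q) (P (i + 1) (j + 1))"
  unfolding computes_square_def pt_shift by simp

lemma move_square:
  assumes "computes_square c Q (P i j) u v"
  shows "computes_square c (move d Q) (P (i + (case d of East \<Rightarrow> 1 | West \<Rightarrow> - 1 | _ \<Rightarrow> 0))
     (j + (case d of North \<Rightarrow> 1 | South \<Rightarrow> - 1 | _ \<Rightarrow> 0))) u v"
proof -
  have far: "computes c (beyond mp mq) (P x'' y'')"
    if "computes c mp (P x y)" "computes c mq (P x' y')" "(x' - x)\<^sup>2 + (y' - y)\<^sup>2 = 1"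
      "x'' = 2 * x' - x" "y'' = 2 * y' - y" for mp mq x y x' y' x'' y''
    using beyond_P[OF that(1-3)] that(4,5) by simp
  note sq = assms[unfolded square_P]
  show ?thesis
    unfolding square_P by (cases d) (use sq in \<open>auto intro: far\<close>)
qed

lemma cell_square:
  assumes "computes_square c Q z u v"
  shows "computes_square c (cell ds Q) (P (easting ds) (northing ds)) u v"
proof (induction ds)
  case Nil
  then show ?case using assms by (simp add: pt_def)
next
  case (Cons d ds)
  show ?case
    using move_square[OF Cons, of d] by (cases d) simp_all
qed

text \<open>The carried point keeps its position \<open>\<phi>\<close> in the cell. In the
  horizontal case the other intersection of the unit circle with the row is two units away from
  the new point, and so off the target stick.\<close>
lemma step_row:
  fixes i j i' j' :: real
  assumes m: "computes c m (P (i + \<phi>) j)" and \<phi>: "0 \<le> \<phi>" "\<phi> \<le> 1"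
    and Q: "computes_square c Q (P i' j') u v"
    and near: "(i' = i \<and> (j' - j)\<^sup>2 = 1) \<or> (j' = j \<and> (i' = i + 1 \<or> i' = i - 1))"
  shows "computes c (strike m (bl Q) (br Q)) (P (i' + \<phi>) j')"
  by (rule strike_row[OF m Q[unfolded square_P, THEN conjunct1] Q[unfolded square_P, THEN conjunct2, THEN conjunct1]])
    (use near \<phi> in auto)

lemma neighbours:
  "(easting ds = easting (d # ds) \<and> (real_of_int (northing ds) - northing (d # ds))\<^sup>2 = 1) \<or>
   (northing ds = northing (d # ds) \<and> (real_of_int (easting ds) = easting (d # ds) + 1 \<or> real_of_int (easting ds) = easting (d # ds) - 1))"
  by (cases d) (simp_all)

lemma carry_home:
  fixes \<phi> :: real
  assumes Q: "computes_square c Q z u v" and \<phi>: "0 \<le> \<phi>" "\<phi> \<le> 1"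
    and "computes c m (P (easting ds + \<phi>) (northing ds))"
  shows "computes c (carry_home Q ds m) (P \<phi> 0)"
  using assms(4)
proof (induction ds arbitrary: m)
  case Nil
  then show ?case by simp
next
  case (Cons d ds)
  show ?case
    unfolding carry_home.simps
    by (rule Cons.IH, rule step_row[OF Cons.prems \<phi> cell_square[OF Q]]) (use neighbours[of ds d] in auto)
qed

lemma carry_out:
  fixes \<phi> :: real
  assumes Q: "computes_square c Q z u v" and \<phi>: "0 \<le> \<phi>" "\<phi> \<le> 1"
    and m: "computes c m (P \<phi> 0)"
  shows "computes c (carry_out Q ds m) (P (easting ds + \<phi>) (northing ds))"
proof (induction ds)
  case Nil
  then show ?case using m by simp
next
  case (Cons d ds)
  show ?case
    unfolding carry_out.simps
    by (rule step_row[OF Cons \<phi> cell_square[OF Q]])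
      (use neighbours[of ds d] in \<open>auto simp: power2_commute\<close>)
qed

text \<open>If the row were different, its distance would be at least 1, so the point would have
  to lie vertically above or below both ends of the side.\<close>
lemma ensures_locate:
  fixes r :: real and j :: int
  assumes Q: "computes_square c Q z u v" and i: "given_point c i (P r j)"
  shows "ensures c (locate Q i) (\<lambda>ds _. northing ds = j \<and> easting ds \<le> r \<and> r \<le> easting ds + 1)"
  unfolding locate_def
proof (rule ensures_search[where N = "to_nat (path \<lfloor>r\<rfloor> j)"])
  show "points c \<noteq> []" using i by (rule points_nonempty)
next
  fix n
  define ds :: "direction list" where "ds = from_nat n"
  note sq = cell_square[OF Q, of ds, unfolded square_P]
  let ?a = "dist (P r j) (P (easting ds) (northing ds))"
  let ?b = "dist (P r j) (P (easting ds + 1) (northing ds))"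
  have test: "?a \<le> 1 \<and> ?b \<le> 1 \<longleftrightarrow> northing ds = j \<and> easting ds \<le> r \<and> r \<le> easting ds + 1"
  proof (cases "northing ds = j")
    case True
    have "?a \<le> 1 \<longleftrightarrow> \<bar>r - easting ds\<bar> \<le> 1" "?b \<le> 1 \<longleftrightarrow> \<bar>r - (easting ds + 1)\<bar> \<le> 1"
      unfolding dist_P_le_1 using True by (simp_all add: abs_square_le_1)
    then show ?thesis using True by linarith
  next
    case False
    then have "1 \<le> \<bar>real_of_int j - northing ds\<bar>" by linarith
    from one_le_power[OF this, of 2] have far: "1 \<le> (real_of_int j - northing ds)\<^sup>2" by simp
    have "\<not> (?a \<le> 1 \<and> ?b \<le> 1)"
    proof
      assume "?a \<le> 1 \<and> ?b \<le> 1"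
      then have "(r - easting ds)\<^sup>2 \<le> 0" "(r - (easting ds + 1))\<^sup>2 \<le> 0"
        unfolding dist_P_le_1 using far by linarith+
      then show False by simp
    qed
    then show ?thesis using False by blast
  qed
  have res: "case if compare_unit ?a \<noteq> Longer \<and> compare_unit ?b \<noteq> Longer then Some ds else None of
      None \<Rightarrow> n \<noteq> to_nat (path \<lfloor>r\<rfloor> j) | Some ds \<Rightarrow> northing ds = j \<and> easting ds \<le> r \<and> r \<le> easting ds + 1"
  proof (cases "?a \<le> 1 \<and> ?b \<le> 1")
    case True
    then show ?thesis using test by simp
  next
    case False
    have "ds \<noteq> path \<lfloor>r\<rfloor> j"
    proof
      assume "ds = path \<lfloor>r\<rfloor> j"
      then have "northing ds = j \<and> easting ds \<le> r \<and> r \<le> easting ds + 1" by simp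
      then show False using False test by blast
    qed
    then have "n \<noteq> to_nat (path \<lfloor>r\<rfloor> j)" unfolding ds_def by auto
    then show ?thesis using False by auto
  qed
  show "ensures c (do {
     a \<leftarrow> bl (cell (from_nat n) Q);
     b \<leftarrow> br (cell (from_nat n) Q);
     d \<leftarrow> compare i a;
     e \<leftarrow> compare i b;
     give (if d \<noteq> Longer \<and> e \<noteq> Longer then Some (from_nat n) else None) })
     (\<lambda>r' c'. case r' of None \<Rightarrow> n \<noteq> to_nat (path \<lfloor>r\<rfloor> j)
        | Some ds \<Rightarrow> northing ds = j \<and> easting ds \<le> r \<and> r \<le> easting ds + 1)"
    unfolding ds_def[symmetric]
  proof (rule ensures_bind_point[OF conjunct1[OF sq]],
      rule ensures_bind_point[OF computes_mono[OF conjunct1[OF conjunct2[OF sq]]]], assumption, goal_cases)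
    case (1 a c1 b c2)
    then have g: "given_point c2 i (P r j)" "given_point c2 a (P (easting ds) (northing ds))"
      using i by (meson given_point_mono)+
    have b: "given_point c2 b (P (easting ds + 1) (northing ds))" using 1 by simp
    show ?case
    proof (rule ensures_bind[OF ensures_compare[OF g]])
      fix d c3 assume c3: "c2 \<sqsubseteq> c3" and d: "d = compare_unit ?a"
      note g3 = given_point_mono[OF g(1) c3] given_point_mono[OF b c3]
      show "ensures c3 (do { e \<leftarrow> compare i b;
          give (if d \<noteq> Longer \<and> e \<noteq> Longer then Some ds else None) })
        (\<lambda>r' c'. case r' of None \<Rightarrow> n \<noteq> to_nat (path \<lfloor>r\<rfloor> j)
          | Some ds \<Rightarrow> northing ds = j \<and> easting ds \<le> r \<and> r \<le> easting ds + 1)"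
        by (rule ensures_bind[OF ensures_compare[OF g3]], rule ensures_give) (use res d in simp)
    qed
  qed
qed

text \<open>The nearest row has distance at most \<open>1 / 2\<close>, so the circle meets it in
  two points; the cells containing these make the search succeed.\<close>
lemma ensures_row_points:
  assumes Q: "computes_square c Q z u v" and i: "given_point c i (P x y)"
  shows "ensures c (row_points Q i) (\<lambda>(a, b) c'. \<exists>(r::real) (s::real) (j::int). given_point c' a (P r j) \<and>
    given_point c' b (P s j) \<and> r + s = 2 * x)" (is "ensures c _ ?R")
  unfolding row_points_def
proof -
  define j where "j = round y"
  define d :: real where "d = sqrt (1 - (y - j)\<^sup>2)"
  have "\<bar>y - j\<bar> \<le> 1 / 2" unfolding j_def using of_int_round_abs_le[of y] by (simp add: abs_minus_commute)
  then have "(y - j)\<^sup>2 \<le> 1 / 4" using power_mono[of "\<bar>y - j\<bar>" "1 / 2" 2] by (simp add: power_divide)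
  then have d: "0 < d" "d\<^sup>2 + (y - j)\<^sup>2 = 1" unfolding d_def by simp_all
  define N where "N = to_nat (path \<lfloor>x - d\<rfloor> j, path \<lfloor>x + d\<rfloor> j)"
  show "ensures c (search (\<lambda>n. case from_nat n of (ds, es) \<Rightarrow>
     if northing ds = northing es then do {
       (_, k) \<leftarrow> rod (bl (cell ds Q)) (br (cell ds Q));
       (_, l) \<leftarrow> rod (bl (cell es Q)) (br (cell es Q));
       xs \<leftarrow> ruler i [k, l];
       give (if length xs = 2 then Some (xs ! 0, xs ! 1) else None) }
     else give None)) ?R"
  proof (rule ensures_search[where N = N])
    show "points c \<noteq> []" using i by (rule points_nonempty)
  next
    fix n
    let ?Q = "\<lambda>r c'. case r of None \<Rightarrow> n \<noteq> N | Some ab \<Rightarrow> ?R ab c'"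
    obtain ds es :: "direction list" where n: "from_nat n = (ds, es)" by (cases "from_nat n :: direction list \<times> direction list")
    have N: "ds = path \<lfloor>x - d\<rfloor> j \<and> es = path \<lfloor>x + d\<rfloor> j" if "n = N"
      using n that unfolding N_def by simp
    show "ensures c (case from_nat n of (ds, es) \<Rightarrow>
     if northing ds = northing es then do {
       (_, k) \<leftarrow> rod (bl (cell ds Q)) (br (cell ds Q));
       (_, l) \<leftarrow> rod (bl (cell es Q)) (br (cell es Q));
       xs \<leftarrow> ruler i [k, l];
       give (if length xs = 2 then Some (xs ! 0, xs ! 1) else None) }
     else give None) ?Q"
    proof (cases "northing ds = northing es")
      case False
      then have "n \<noteq> N" using N by auto
      then show ?thesis using n False by (auto intro!: ensures_give)
    next
      case True
      define p where "p = P (easting ds) (northing ds)"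
      define q where "q = P (easting es) (northing ds)"
      define X where "X = {w \<in> \<Union> (segment ` set [(p, p + u), (q, q + u)]). dist (P x y) w = 1}"
      have rods: "ensures c' (rod (bl (cell fs Q)) (br (cell fs Q)))
          (\<lambda>(b, k) c'. given_point c' b (P (easting fs) (northing fs) + u) \<and>
             given_stick c' k (P (easting fs) (northing fs), P (easting fs) (northing fs) + u))" if "c \<sqsubseteq> c'" for fs c'
      proof -
        note sq = computes_square_mono[OF cell_square[OF Q, of fs] that, unfolded square_P]
        have "P (easting fs + 1) (northing fs) = P (easting fs) (northing fs) + 1 *\<^sub>R u" by (simp add: pt_def algebra_simps)
        with sq have "computes c' (br (cell fs Q)) (P (easting fs) (northing fs) + 1 *\<^sub>R u)" by simp
        then show ?thesis using sq norm_u by (intro ensures_rod[where a = 1]) auto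
      qed
      have seg: "segment (P k l, P k l + u) = {P t l | t. k \<le> t \<and> t \<le> k + 1}" for k l
      proof -
        have "P k l + a *\<^sub>R u = P (k + a) l" for a by (simp add: pt_def algebra_simps)
        then have "segment (P k l, P k l + u) = {P (k + a) l | a. 0 \<le> a \<and> a \<le> 1}" unfolding segment_ray by simp
        also have "\<dots> = {P t l | t. k \<le> t \<and> t \<le> k + 1}"
        proof (intro equalityI subsetI)
          fix w assume "w \<in> {P t l | t. k \<le> t \<and> t \<le> k + 1}"
          then obtain t where "w = P t l" "k \<le> t" "t \<le> k + 1" by blast
          then show "w \<in> {P (k + a) l | a. 0 \<le> a \<and> a \<le> 1}" by (auto intro!: exI[of _ "t - k"])
        qed auto
        finally show ?thesis .
      qed
      have X: "X = {P t (northing ds) | t :: real. ((easting ds \<le> t \<and> t \<le> easting ds + 1) \<or> (easting es \<le> t \<and> t \<le> easting es + 1)) \<and>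
          (x - t)\<^sup>2 + (y - northing ds)\<^sup>2 = 1}"
        unfolding X_def p_def q_def by (auto simp: seg dist_P_eq_1)
      define D where "D = sqrt (1 - (y - northing ds)\<^sup>2)"
      have "X \<subseteq> {P (x + D) (northing ds), P (x - D) (northing ds)}"
      proof
        fix w assume "w \<in> X"
        then obtain t where t: "w = P t (northing ds)" "(x - t)\<^sup>2 + (y - northing ds)\<^sup>2 = 1" unfolding X by auto
        then have "\<bar>x - t\<bar> = D" unfolding D_def by (metis add_diff_cancel_right' real_sqrt_abs)
        then show "w \<in> {P (x + D) (northing ds), P (x - D) (northing ds)}" using t(1) by (auto simp: abs_if split: if_splits)
      qed
      then have fin: "finite X" by (rule finite_subset) simp
      have hit: "2 \<le> card X" if "n = N"
      proof -
        have e: "ds = path \<lfloor>x - d\<rfloor> j" "es = path \<lfloor>x + d\<rfloor> j" using N that by auto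
        have "P (x - d) j \<in> X" "P (x + d) j \<in> X"
          unfolding X e using d by (auto simp: P_eq_iff intro!: exI)
        then have "{P (x - d) j, P (x + d) j} \<subseteq> X" by simp
        moreover have "card {P (x - d) j, P (x + d) j} = 2" using d by (simp add: P_eq_iff)
        ultimately show ?thesis using card_mono[OF fin] by metis
      qed
      have strike: "ensures c' (do {
           xs \<leftarrow> ruler i [k, l];
           give (if length xs = 2 then Some (xs ! 0, xs ! 1) else None) })
         ?Q"
        if c': "c \<sqsubseteq> c'" and k: "given_stick c' k (p, p + u)" and l: "given_stick c' l (q, q + u)" for c' k l
      proof (rule ensures_bind[OF ensures_ruler[OF given_point_mono[OF i c'], of "[k, l]" "[(p, p + u), (q, q + u)]", folded X_def]])
        show "list_all2 (given_stick c') [k, l] [(p, p + u), (q, q + u)]" using k l by simp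
        show "finite X" by (rule fin)
      next
        fix xs c3
        assume "\<exists>ws. distinct ws \<and> set ws = X \<and> list_all2 (given_point c3) xs ws"
        then obtain ws where ws: "distinct ws" "set ws = X" "list_all2 (given_point c3) xs ws" by blast
        have len: "length xs = length ws" "length ws = card X"
          using ws by (auto dest: list_all2_lengthD simp: distinct_card)
        show "ensures c3 (give (if length xs = 2 then Some (xs ! 0, xs ! 1) else None))
          ?Q"
        proof (rule ensures_give)
          fix c4 assume c4: "c3 \<sqsubseteq> c4"
          show "case if length xs = 2 then Some (xs ! 0, xs ! 1) else None of None \<Rightarrow> n \<noteq> N | Some ab \<Rightarrow> ?R ab c4"
          proof (cases "length xs = 2")
            case True
            then have g: "given_point c4 (xs ! 0) (ws ! 0)" "given_point c4 (xs ! 1) (ws ! 1)"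
              using ws(3) len given_point_mono[OF _ c4] by (auto simp: list_all2_conv_all_nth)
            have ne: "ws ! 0 \<in> X" "ws ! 1 \<in> X" "ws ! 0 \<noteq> ws ! 1"
              using ws True len by (auto simp: nth_eq_iff_index_eq)
            from ne(1) obtain r where r: "ws ! 0 = P r (northing ds)" "(x - r)\<^sup>2 + (y - northing ds)\<^sup>2 = 1"
              unfolding X by blast
            from ne(2) obtain s where s: "ws ! 1 = P s (northing ds)" "(x - s)\<^sup>2 + (y - northing ds)\<^sup>2 = 1"
              unfolding X by blast
            have rs: "ws ! 0 = P r (northing ds)" "ws ! 1 = P s (northing ds)" "r \<noteq> s"
              "(x - r)\<^sup>2 + (y - northing ds)\<^sup>2 = 1" "(x - s)\<^sup>2 + (y - northing ds)\<^sup>2 = 1"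
              using r s ne(3) by auto
            have "(r - s) * (r + s - 2 * x) = 0" using rs(4,5) by algebra
            then have "r + s = 2 * x" using rs(3) by simp
            then show ?thesis using True g unfolding rs(1,2) by auto
          next
            case False
            have "card X \<le> 2"
              using card_mono[OF _ \<open>X \<subseteq> {P (x + D) (northing ds), P (x - D) (northing ds)}\<close>] card_insert_le_m1[of 2 "{P (x - D) (northing ds)}" "P (x + D) (northing ds)"]
              by simp
            then have "n \<noteq> N" using False len hit by auto
            then show ?thesis using False by simp
          qed
        qed
      qed
      have "ensures c (do {
         (_, k) \<leftarrow> rod (bl (cell ds Q)) (br (cell ds Q));
         (_, l) \<leftarrow> rod (bl (cell es Q)) (br (cell es Q));
         xs \<leftarrow> ruler i [k, l];
         give (if length xs = 2 then Some (xs ! 0, xs ! 1) else None) })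
         ?Q"
      proof (rule ensures_bind[OF rods[OF extends_refl]], clarify, rule ensures_bind[OF rods], assumption, clarify)
        fix b k c1 b' l c2
        assume "c \<sqsubseteq> c1" "c1 \<sqsubseteq> c2" "given_stick c1 k (P (easting ds) (northing ds), P (easting ds) (northing ds) + u)"
          "given_stick c2 l (P (easting es) (northing es), P (easting es) (northing es) + u)"
        then show "ensures c2 (do {
             xs \<leftarrow> ruler i [k, l];
             give (if length xs = 2 then Some (xs ! 0, xs ! 1) else None) })
           ?Q"
          using True unfolding p_def[symmetric] True[symmetric] q_def[symmetric]
          by (intro strike) (auto dest: given_stick_mono extends_trans)
      qed
      then show ?thesis using n True by simp
    qed
  qed
qed

lemma ensures_feet:
  assumes Q: "computes_square c Q z u v" and i: "given_point c i (P x y)"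
  shows "ensures c (feet Q i) (\<lambda>((k, m), (l, n)) c'. \<exists>(r::real) (s::real). computes c' m (P r 0) \<and> 0 \<le> r \<and> r \<le> 1 \<and>
    computes c' n (P s 0) \<and> 0 \<le> s \<and> s \<le> 1 \<and> (k + r) + (l + s) = 2 * x)"
    (is "ensures c _ ?R")
  unfolding feet_def
proof (rule ensures_bind[OF ensures_row_points[OF Q i]], clarify)
  fix a b c1 and r s :: real and j :: int
  assume c1: "c \<sqsubseteq> c1" and a: "given_point c1 a (P r j)" and b: "given_point c1 b (P s j)" and rs: "r + s = 2 * x"
  note Q1 = computes_square_mono[OF Q c1]
  show "ensures c1 (do {
     ds \<leftarrow> locate Q a;
     es \<leftarrow> locate Q b;
     give ((easting ds, carry_home Q ds (give a)), (easting es, carry_home Q es (give b))) })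
   ?R"
  proof (rule ensures_bind[OF ensures_locate[OF Q1 a]], elim conjE)
    fix ds c2 assume c2: "c1 \<sqsubseteq> c2" and ds: "northing ds = j" "easting ds \<le> r" "r \<le> easting ds + 1"
    note Q2 = computes_square_mono[OF Q1 c2] and a2 = given_point_mono[OF a c2] and b2 = given_point_mono[OF b c2]
    show "ensures c2 (do {
       es \<leftarrow> locate Q b;
       give ((easting ds, carry_home Q ds (give a)), (easting es, carry_home Q es (give b))) })
     ?R"
    proof (rule ensures_bind[OF ensures_locate[OF Q2 b2]], elim conjE, rule ensures_give)
      fix es c3 c4 assume c34: "c2 \<sqsubseteq> c3" "c3 \<sqsubseteq> c4" and es: "northing es = j" "easting es \<le> s" "s \<le> easting es + 1"
      have c4: "c2 \<sqsubseteq> c4" using c34 by (rule extends_trans)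
      note Q4 = computes_square_mono[OF Q2 c4]
        and a4 = computes_give[OF given_point_mono[OF a2 c4]] and b4 = computes_give[OF given_point_mono[OF b2 c4]]
      have A: "computes c4 (carry_home Q ds (give a)) (P (r - easting ds) 0)"
        by (rule carry_home[OF Q4]) (use ds a4 in auto)
      have B: "computes c4 (carry_home Q es (give b)) (P (s - easting es) 0)"
        by (rule carry_home[OF Q4]) (use es b4 in auto)
      show "?R ((easting ds, carry_home Q ds (give a)), (easting es, carry_home Q es (give b))) c4"
        unfolding prod.case
        by (intro exI[of _ "r - easting ds"] exI[of _ "s - easting es"]) (use A B ds es rs in auto)
    qed
  qed
qed

end

section \<open>From points to coordinates and back\<close>

definition measure_x :: "square \<Rightarrow> nat prog \<Rightarrow> nat \<Rightarrow> number prog" where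
  "measure_x Q h i = do {
     ((k, m), (l, n)) \<leftarrow> feet Q i;
     give (scale_down Q h 1 (add Q h (add Q h (integer Q h k) (of_abscissa Q h m))
       (add Q h (integer Q h l) (of_abscissa Q h n)))) }"

text \<open>In the transposed lattice the carried points end up on the left side of the original
  square, where they are heights.\<close>
definition measure_y :: "square \<Rightarrow> nat prog \<Rightarrow> nat \<Rightarrow> number prog" where
  "measure_y Q h i = do {
     ((k, m), (l, n)) \<leftarrow> feet (transpose_square Q) i;
     give (scale_down Q h 1 (add Q h (add Q h (integer Q h k) (of_ordinate Q h m))
       (add Q h (integer Q h l) (of_ordinate Q h n)))) }"

definition coordinates :: "square \<Rightarrow> nat prog \<Rightarrow> nat \<Rightarrow> (number \<times> number) prog" where
  "coordinates Q h i = do { x \<leftarrow> measure_x Q h i; y \<leftarrow> measure_y Q h i; give (x, y) }"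

definition integer_part :: "square \<Rightarrow> nat prog \<Rightarrow> number \<Rightarrow> int prog" where
  "integer_part Q h N = search (\<lambda>n. do {
     a \<leftarrow> nonneg Q h (sub Q h N (integer Q h (int_decode n)));
     b \<leftarrow> nonneg Q h (sub Q h (integer Q h (int_decode n + 1)) N);
     give (if a \<and> b then Some (int_decode n) else None) })"

text \<open>The map \<open>x \<mapsto> sqrt (1 - x\<^sup>2)\<close> is an involution on the unit
  interval, so applying \<open>to_circle\<close> twice moves a number from the bottom to the left
  side.\<close>
definition to_ordinate :: "square \<Rightarrow> nat prog \<Rightarrow> number \<Rightarrow> nat prog" where
  "to_ordinate Q h N = to_circle Q h (of_ordinate Q h (to_circle Q h N))"

text \<open>The fractional parts of the coordinates are constructed as points of the bottom and
  the left side of the original square and carried to the cell given by the integral parts. The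
  vertical and the horizontal stick through them cross in the required point.\<close>
definition point_at :: "square \<Rightarrow> nat prog \<Rightarrow> number \<Rightarrow> number \<Rightarrow> nat prog" where
  "point_at Q h X Y = do {
     i \<leftarrow> integer_part Q h X;
     j \<leftarrow> integer_part Q h Y;
     let C = cell (path i j) Q;
         p = carry_out Q (path i j) (to_abscissa Q h (sub Q h X (integer Q h i)));
         q = carry_out (transpose_square Q) (path j i) (to_ordinate Q h (sub Q h Y (integer Q h j)))
     in meet p (strike p (tl C) (tr C)) q (strike q (br C) (tr C)) }"

lemma (in sheet) sheet_mono: "c \<sqsubseteq> c' \<Longrightarrow> sheet z u v c' Q h y"
  using sheet_axioms unfolding sheet_def sheet_axioms_def
  using computes_square_mono computes_mono points_mono by blast

context sheet
begin

lemma ensures_measure_x: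
  assumes i: "given_point c i (P a b)"
  shows "ensures c (measure_x Q h i) (\<lambda>N c'. represents c' z u v N a)"
  unfolding measure_x_def
proof (rule ensures_bind[OF ensures_feet[OF square i]], clarify, rule ensures_give)
  fix k m l n c1 c2 and r s :: real
  assume "c \<sqsubseteq> c1" "c1 \<sqsubseteq> c2" and r: "computes c1 m (P r 0)" "0 \<le> r" "r \<le> 1"
    and s: "computes c1 n (P s 0)" "0 \<le> s" "s \<le> 1" and sum: "(real_of_int k + r) + (real_of_int l + s) = 2 * a"
  then interpret C: sheet z u v c2 Q h y
    using sheet_mono extends_trans by blast
  have "C.rep (scale_down Q h 1 (add Q h (add Q h (integer Q h k) (of_abscissa Q h m))
       (add Q h (integer Q h l) (of_abscissa Q h n)))) (((k + r) + (l + s)) / 2 ^ 1)"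
    using r s computes_mono[OF _ \<open>c1 \<sqsubseteq> c2\<close>]
    by (intro C.rep_scale_down C.rep_add C.rep_integer C.of_abscissa) auto
  then show "C.rep (scale_down Q h 1 (add Q h (add Q h (integer Q h k) (of_abscissa Q h m))
       (add Q h (integer Q h l) (of_abscissa Q h n)))) a"
    unfolding sum by simp
qed

lemma ensures_measure_y:
  assumes i: "given_point c i (P a b)"
  shows "ensures c (measure_y Q h i) (\<lambda>N c'. represents c' z u v N b)"
  unfolding measure_y_def
proof (rule ensures_bind[OF frame.ensures_feet[OF swap computes_transpose[OF square], of i b a]], 
    goal_cases)
  case 1
  then show ?case using i by (simp add: pt_swap[of z v u])
next
  case (2 kmln c1)
  obtain k m l n where kmln: "kmln = ((k, m), (l, n))" by (metis surj_pair)
  from 2 obtain r s :: real where r: "computes c1 m (P 0 r)" "0 \<le> r" "r \<le> 1"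
    and s: "computes c1 n (P 0 s)" "0 \<le> s" "s \<le> 1" and sum: "(real_of_int k + r) + (real_of_int l + s) = 2 * b"
    unfolding kmln by (auto simp: pt_swap[of z v u])
  show ?case
    unfolding kmln prod.case
  proof (rule ensures_give)
    fix c2 assume c2: "c1 \<sqsubseteq> c2"
    with 2 interpret C: sheet z u v c2 Q h y
      using sheet_mono extends_trans by blast
    have "C.rep (scale_down Q h 1 (add Q h (add Q h (integer Q h k) (of_ordinate Q h m))
         (add Q h (integer Q h l) (of_ordinate Q h n)))) (((k + r) + (l + s)) / 2 ^ 1)"
      using r s computes_mono[OF _ c2]
      by (intro C.rep_scale_down C.rep_add C.rep_integer C.of_ordinate) auto
    then show "C.rep (scale_down Q h 1 (add Q h (add Q h (integer Q h k) (of_ordinate Q h m))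
         (add Q h (integer Q h l) (of_ordinate Q h n)))) b"
      unfolding sum by simp
  qed
qed

lemma ensures_coordinates:
  assumes i: "given_point c i (P a b)"
  shows "ensures c (coordinates Q h i) (\<lambda>(M, N) c'. represents c' z u v M a \<and> represents c' z u v N b)"
  unfolding coordinates_def
proof (rule ensures_bind[OF ensures_measure_x[OF i]])
  fix M c1 assume c1: "c \<sqsubseteq> c1" and M: "represents c1 z u v M a"
  interpret C: sheet z u v c1 Q h y using sheet_mono[OF c1] .
  show "ensures c1 (do { y \<leftarrow> measure_y Q h i; give (M, y) })
    (\<lambda>(M, N) c'. represents c' z u v M a \<and> represents c' z u v N b)"
    by (rule ensures_bind[OF C.ensures_measure_y[OF given_point_mono[OF i c1]]], rule ensures_give)
      (use M represents_mono extends_trans in blast)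
qed

lemma ensures_integer_part:
  assumes N: "rep N X"
  shows "ensures c (integer_part Q h N) (\<lambda>i _. of_int i \<le> X \<and> X \<le> of_int i + 1)"
  unfolding integer_part_def
proof (rule ensures_search[where N = "int_encode \<lfloor>X\<rfloor>"])
  show "points c \<noteq> []" by (rule points)
next
  fix n
  define i where "i = int_decode n"
  have n: "i = \<lfloor>X\<rfloor>" if "n = int_encode \<lfloor>X\<rfloor>" using that unfolding i_def by simp
  show "ensures c (do {
     a \<leftarrow> nonneg Q h (sub Q h N (integer Q h (int_decode n)));
     b \<leftarrow> nonneg Q h (sub Q h (integer Q h (int_decode n + 1)) N);
     give (if a \<and> b then Some (int_decode n) else None) })
   (\<lambda>r c'. case r of None \<Rightarrow> n \<noteq> int_encode \<lfloor>X\<rfloor> | Some i \<Rightarrow> of_int i \<le> X \<and> X \<le> of_int i + 1)"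
    unfolding i_def[symmetric]
  proof (rule ensures_bind[OF ensures_nonneg[OF rep_sub[OF N rep_integer]]])
    fix a c1 assume c1: "c \<sqsubseteq> c1" and a: "a \<longleftrightarrow> 0 \<le> X - of_int i"
    show "ensures c1 (do {
       b \<leftarrow> nonneg Q h (sub Q h (integer Q h (i + 1)) N);
       give (if a \<and> b then Some i else None) })
     (\<lambda>r c'. case r of None \<Rightarrow> n \<noteq> int_encode \<lfloor>X\<rfloor> | Some i \<Rightarrow> of_int i \<le> X \<and> X \<le> of_int i + 1)"
    proof (rule ensures_bind[OF ensures_mono[OF ensures_nonneg[OF rep_sub[OF rep_integer N]] c1]], rule ensures_give)
      fix b assume b: "b \<longleftrightarrow> 0 \<le> real_of_int (i + 1) - X"
      show "case if a \<and> b then Some i else None of None \<Rightarrow> n \<noteq> int_encode \<lfloor>X\<rfloor>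
          | Some i \<Rightarrow> of_int i \<le> X \<and> X \<le> of_int i + 1"
      proof (cases "of_int i \<le> X \<and> X \<le> of_int i + 1")
        case True
        then show ?thesis using a b by simp
      next
        case False
        then have "i \<noteq> \<lfloor>X\<rfloor>" by linarith
        then show ?thesis using n False a b by auto
      qed
    qed
  qed
qed

lemma to_ordinate:
  assumes N: "rep N X" "0 \<le> X" "X \<le> 1"
  shows "computes c (to_ordinate Q h N) (P 0 X)"
proof -
  have "X\<^sup>2 \<le> 1" using N by (simp add: abs_square_le_1)
  then have s: "0 \<le> sqrt (1 - X\<^sup>2)" "sqrt (1 - X\<^sup>2) \<le> 1" "sqrt (1 - (sqrt (1 - X\<^sup>2))\<^sup>2) = X"
    using N by simp_all
  show ?thesis
    unfolding to_ordinate_def using to_circle[OF of_ordinate[OF to_circle[OF N] s(1,2)] s(1,2)]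
    unfolding s(3) .
qed

lemma computes_point_at:
  assumes M: "rep M X" and N: "rep N Y"
  shows "computes c (point_at Q h M N) (P X Y)"
  unfolding computes_def point_at_def
proof (rule ensures_bind[OF ensures_integer_part[OF M]], elim conjE,
    rule ensures_bind[OF ensures_mono[OF ensures_integer_part[OF N]]], assumption, elim conjE)
  fix i j :: int and c1 c2
  assume "c \<sqsubseteq> c1" "c1 \<sqsubseteq> c2" and i: "of_int i \<le> X" "X \<le> of_int i + 1" and j: "of_int j \<le> Y" "Y \<le> of_int j + 1"
  then have c2: "c \<sqsubseteq> c2" by (blast intro: extends_trans)
  interpret C: sheet z u v c2 Q h y using sheet_mono[OF c2] .
  define p where "p = carry_out Q (path i j) (to_abscissa Q h (sub Q h M (integer Q h i)))"
  define q where "q = carry_out (transpose_square Q) (path j i) (to_ordinate Q h (sub Q h N (integer Q h j)))"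
  note M2 = C.rep_sub[OF represents_mono[OF M c2] C.rep_integer[of i]]
  note N2 = C.rep_sub[OF represents_mono[OF N c2] C.rep_integer[of j]]
  have "computes c2 (to_abscissa Q h (sub Q h M (integer Q h i))) (P (X - i) 0)"
    by (rule C.to_abscissa[OF M2]) (use i in auto)
  then have "computes c2 p (P (easting (path i j) + (X - i)) (northing (path i j)))"
    unfolding p_def by (intro carry_out[OF C.square]) (use i in auto)
  then have p: "computes c2 p (P X j)" by simp
  have "computes c2 (to_ordinate Q h (sub Q h N (integer Q h j))) (P 0 (Y - j))"
    by (rule C.to_ordinate[OF N2]) (use j in auto)
  then have "computes c2 (to_ordinate Q h (sub Q h N (integer Q h j))) (pt z v u (Y - j) 0)"
    by (simp add: pt_swap[of z v u])
  then have "computes c2 q (pt z v u (easting (path j i) + (Y - j)) (northing (path j i)))"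
    unfolding q_def by (intro frame.carry_out[OF swap computes_transpose[OF C.square]]) (use j in auto)
  then have q: "computes c2 q (P i Y)" by (simp add: pt_swap[of z v u])
  note sq = cell_square[OF C.square, of "path i j", unfolded square_P easting_path northing_path]
  have p': "computes c2 (strike p (tl (cell (path i j) Q)) (tr (cell (path i j) Q))) (P X (j + 1))"
    by (rule strike_row[OF p, where ?x1.0 = i and ?x2.0 = "i + 1"]) (use sq i in auto)
  have q': "computes c2 (strike q (br (cell (path i j) Q)) (tr (cell (path i j) Q))) (P (i + 1) Y)"
    by (rule strike_column[OF q, where ?y1.0 = j and ?y2.0 = "j + 1"]) (use sq j in auto)
  have "(X - i)\<^sup>2 \<le> 1" "(Y - j)\<^sup>2 \<le> 1" using i j by (simp_all add: abs_square_le_1)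
  then have "computes c2 (meet p (strike p (tl (cell (path i j) Q)) (tr (cell (path i j) Q)))
      q (strike q (br (cell (path i j) Q)) (tr (cell (path i j) Q)))) (P X Y)"
    by (intro meet_P[OF p p' q q', where \<alpha> = "Y - j" and \<beta> = "X - i"]) (use i j in auto)
  then show "ensures c2 (let C = cell (path i j) Q;
         p = carry_out Q (path i j) (to_abscissa Q h (sub Q h M (integer Q h i)));
         q = carry_out (transpose_square Q) (path j i) (to_ordinate Q h (sub Q h N (integer Q h j)))
     in meet p (strike p (tl C) (tr C)) q (strike q (br C) (tr C))) (\<lambda>i c'. given_point c' i (P X Y))"
    unfolding Let_def p_def[symmetric] q_def[symmetric] computes_def .
qed

end

section \<open>Intersecting two circles\<close>

text \<open>With the first centre as origin and the second at \<open>d\<close>, the common points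
  are \<open>l * d\<close> plus or minus the vector \<open>d\<close> turned by a right angle and
  multiplied by \<open>sqrt q\<close>. They exist iff \<open>q\<close> is nonnegative.\<close>
definition chord_ends ::
    "square \<Rightarrow> nat prog \<Rightarrow> number \<Rightarrow> number \<Rightarrow> number \<Rightarrow> number \<Rightarrow> number \<Rightarrow> number \<Rightarrow> (bool \<times> nat list) prog" where
  "chord_ends Q h x y dx dy l q = do {
     meeting \<leftarrow> nonneg Q h q;
     if \<not> meeting then give (False, [])
     else let plus = add Q h; minus = sub Q h; times = mul Q h; m = square_root Q h q in do {
       i \<leftarrow> point_at Q h (plus x (minus (times l dx) (times m dy))) (plus y (plus (times l dy) (times m dx)));
       j \<leftarrow> point_at Q h (plus x (plus (times l dx) (times m dy))) (plus y (minus (times l dy) (times m dx)));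
       give (True, [i, j]) } }"

text \<open>Centres that coincide have to be set apart, since \<open>D\<close> is a divisor below;
  then the circles, being different, have no common point.\<close>
definition intersect_circles ::
    "square \<Rightarrow> nat prog \<Rightarrow> number \<Rightarrow> number \<Rightarrow> number \<Rightarrow> number \<Rightarrow> number \<Rightarrow> number \<Rightarrow> (bool \<times> nat list) prog" where
  "intersect_circles Q h x y dx dy R1 R2 = (let D = add Q h (mul Q h dx dx) (mul Q h dy dy) in do {
     concentric \<leftarrow> nonneg Q h (neg Q h D);
     if concentric then give (False, [])
     else do {
       e \<leftarrow> lower_bound Q h D;
       let inv = invert Q h e D; l = scale_down Q h 1 (mul Q h (sub Q h (add Q h D R1) R2) inv)
       in chord_ends Q h x y dx dy l (sub Q h (mul Q h R1 inv) (mul Q h l l)) } })"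

definition circles :: "square \<Rightarrow> nat prog \<Rightarrow> (bool \<times> nat list) prog" where
  "circles Q h = do {
     (x1, y1) \<leftarrow> coordinates Q h 0;
     (a1, b1) \<leftarrow> coordinates Q h 1;
     (x2, y2) \<leftarrow> coordinates Q h 2;
     (a2, b2) \<leftarrow> coordinates Q h 3;
     let minus = sub Q h; square_norm = (\<lambda>x y. add Q h (mul Q h x x) (mul Q h y y))
     in intersect_circles Q h x1 y1 (minus x2 x1) (minus y2 y1)
       (square_norm (minus a1 x1) (minus b1 y1)) (square_norm (minus a2 x2) (minus b2 y2)) }"

definition circle_construction :: "(bool \<times> nat list) prog" where
  "circle_construction = do {
     (j, k) \<leftarrow> thin_triangle 0;
     let Q = triangle_square (give 0) (give j) (give k) in do {
       (_, s) \<leftarrow> rod (bl Q) (tl Q);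
       i \<leftarrow> pick s;
       circles Q (give i) } }"

text \<open>The difference of the equations is linear and fixes the component \<open>l\<close> of
  the solution along \<open>(dx, dy)\<close>. For the component \<open>k\<close> along the
  perpendicular, the first equation becomes \<open>k\<^sup>2 = q\<close>.\<close>
lemma circle_equations:
  fixes X Y dx dy R1 R2 :: real
  defines "D \<equiv> dx * dx + dy * dy"
  defines "l \<equiv> (D + R1 - R2) * (1 / D) / 2 ^ 1"
  defines "q \<equiv> R1 * (1 / D) - l * l"
  assumes D: "0 < D"
  shows "X\<^sup>2 + Y\<^sup>2 = R1 \<and> (X - dx)\<^sup>2 + (Y - dy)\<^sup>2 = R2 \<longleftrightarrow>
    0 \<le> q \<and> ((X = l * dx - sqrt q * dy \<and> Y = l * dy + sqrt q * dx) \<or>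
      (X = l * dx + sqrt q * dy \<and> Y = l * dy - sqrt q * dx))"
proof
  assume XY: "X\<^sup>2 + Y\<^sup>2 = R1 \<and> (X - dx)\<^sup>2 + (Y - dy)\<^sup>2 = R2"
  define k where "k = (Y * dx - X * dy) / D"
  have lD: "l * D = X * dx + Y * dy"
  proof -
    have "l * D = (D + R1 - R2) / 2" unfolding l_def using D by simp
    also have "\<dots> = X * dx + Y * dy" using XY unfolding D_def by (simp add: power2_eq_square field_simps)
    finally show ?thesis .
  qed
  have kD: "k * D = Y * dx - X * dy" unfolding k_def using D by simp
  have "X * D = (l * dx - k * dy) * D" "Y * D = (l * dy + k * dx) * D"
    using lD kD unfolding D_def by algebra+
  then have X: "X = l * dx - k * dy" and Y: "Y = l * dy + k * dx" using D by simp_all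
  have "R1 = X\<^sup>2 + Y\<^sup>2" using XY by simp
  also have "\<dots> = (l * l + k * k) * D" unfolding X Y D_def by (simp add: power2_eq_square algebra_simps)
  finally have "R1 = (l * l + k * k) * D" .
  then have q: "q = k\<^sup>2" unfolding q_def using D by (simp add: power2_eq_square)
  have "sqrt q = \<bar>k\<bar>" unfolding q by simp
  then show "0 \<le> q \<and> ((X = l * dx - sqrt q * dy \<and> Y = l * dy + sqrt q * dx) \<or>
      (X = l * dx + sqrt q * dy \<and> Y = l * dy - sqrt q * dx))"
    using X Y q by (cases "0 \<le> k") auto
next
  assume "0 \<le> q \<and> ((X = l * dx - sqrt q * dy \<and> Y = l * dy + sqrt q * dx) \<or>
      (X = l * dx + sqrt q * dy \<and> Y = l * dy - sqrt q * dx))"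
  then obtain k where k: "k\<^sup>2 = q" and X: "X = l * dx - k * dy" and Y: "Y = l * dy + k * dx"
    by (metis (no_types, opaque_lifting) add_uminus_conv_diff diff_minus_eq_add mult_minus_left power2_minus real_sqrt_pow2)
  have "X\<^sup>2 + Y\<^sup>2 = (l * l + q) * D" unfolding k[symmetric] X Y D_def by algebra
  also have "\<dots> = R1" unfolding q_def using D by simp
  finally have R1: "X\<^sup>2 + Y\<^sup>2 = R1" .
  have "l * D * 2 = D + R1 - R2" unfolding l_def using D by simp
  moreover have "X * dx + Y * dy = l * D" unfolding X Y D_def by algebra
  ultimately have "(X - dx)\<^sup>2 + (Y - dy)\<^sup>2 = R2" using R1 unfolding D_def by algebra
  then show "X\<^sup>2 + Y\<^sup>2 = R1 \<and> (X - dx)\<^sup>2 + (Y - dy)\<^sup>2 = R2" using R1 by simp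
qed

context sheet
begin

lemma ensures_chord_ends:
  assumes x: "rep mx x" and y: "rep my y'" and dx: "rep mdx dx" and dy: "rep mdy dy"
    and l: "rep ml l" and q: "rep mq q"
    and E: "\<Gamma>1 \<inter> \<Gamma>2 = (if 0 \<le> q then
      {P (x + (l * dx - sqrt q * dy)) (y' + (l * dy + sqrt q * dx)),
       P (x + (l * dx + sqrt q * dy)) (y' + (l * dy - sqrt q * dx))} else {})"
  shows "ensures c (chord_ends Q h mx my mdx mdy ml mq) (solves_circles \<Gamma>1 \<Gamma>2)"
  unfolding chord_ends_def
proof (rule ensures_bind[OF ensures_nonneg[OF q]])
  fix b c1 assume c1: "c \<sqsubseteq> c1" and b: "b \<longleftrightarrow> 0 \<le> q"
  interpret C: sheet z u v c1 Q h y using sheet_mono[OF c1] .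
  show "ensures c1 (if \<not> b then give (False, [])
     else let plus = add Q h; minus = sub Q h; times = mul Q h; m = square_root Q h mq in do {
       i \<leftarrow> point_at Q h (plus mx (minus (times ml mdx) (times m mdy))) (plus my (plus (times ml mdy) (times m mdx)));
       j \<leftarrow> point_at Q h (plus mx (plus (times ml mdx) (times m mdy))) (plus my (minus (times ml mdy) (times m mdx)));
       give (True, [i, j]) }) (solves_circles \<Gamma>1 \<Gamma>2)"
  proof (cases b)
    case False
    then have "\<Gamma>1 \<inter> \<Gamma>2 = {}" using E b by simp
    then show ?thesis using False by (auto intro!: ensures_give simp: solves_circles_def)
  next
    case True
    then have q0: "0 \<le> q" using b by simp
    note r = represents_mono[OF x c1] represents_mono[OF y c1] represents_mono[OF dx c1] represents_mono[OF dy c1]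
      represents_mono[OF l c1] C.square_root[OF represents_mono[OF q c1] q0]
    let ?v = "P (x + (l * dx - sqrt q * dy)) (y' + (l * dy + sqrt q * dx))"
    let ?w = "P (x + (l * dx + sqrt q * dy)) (y' + (l * dy - sqrt q * dx))"
    have v: "computes c1 (point_at Q h (add Q h mx (sub Q h (mul Q h ml mdx) (mul Q h (square_root Q h mq) mdy)))
        (add Q h my (add Q h (mul Q h ml mdy) (mul Q h (square_root Q h mq) mdx)))) ?v"
      by (intro C.computes_point_at C.rep_add C.rep_sub C.rep_mul r)
    have w: "computes c1 (point_at Q h (add Q h mx (add Q h (mul Q h ml mdx) (mul Q h (square_root Q h mq) mdy)))
        (add Q h my (sub Q h (mul Q h ml mdy) (mul Q h (square_root Q h mq) mdx)))) ?w"
      by (intro C.computes_point_at C.rep_add C.rep_sub C.rep_mul r)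
    have "ensures c1 (do {
       i \<leftarrow> point_at Q h (add Q h mx (sub Q h (mul Q h ml mdx) (mul Q h (square_root Q h mq) mdy)))
        (add Q h my (add Q h (mul Q h ml mdy) (mul Q h (square_root Q h mq) mdx)));
       j \<leftarrow> point_at Q h (add Q h mx (add Q h (mul Q h ml mdx) (mul Q h (square_root Q h mq) mdy)))
        (add Q h my (sub Q h (mul Q h ml mdy) (mul Q h (square_root Q h mq) mdx)));
       give (True, [i, j]) }) (solves_circles \<Gamma>1 \<Gamma>2)"
    proof (rule ensures_bind_point[OF v], rule ensures_bind_point[OF computes_mono[OF w]], assumption, rule ensures_give)
      fix i c2 j c3 c4
      assume "given_point c2 i ?v" "given_point c3 j ?w" "c2 \<sqsubseteq> c3" "c3 \<sqsubseteq> c4"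
      then have "given_point c4 i ?v" "given_point c4 j ?w" by (meson given_point_mono)+
      then show "solves_circles \<Gamma>1 \<Gamma>2 (True, [i, j]) c4"
        unfolding solves_circles_def E using q0 by (auto simp: given_point_def)
    qed
    then show ?thesis using True by (simp add: Let_def)
  qed
qed

lemma ensures_intersect_circles:
  assumes x: "rep mx x" and y: "rep my y'" and dx: "rep mdx dx" and dy: "rep mdy dy"
    and R1: "rep mR1 R1" and R2: "rep mR2 R2" and diff: "dx = 0 \<Longrightarrow> dy = 0 \<Longrightarrow> R1 \<noteq> R2"
    and E: "\<Gamma>1 \<inter> \<Gamma>2 = {P (x + X) (y' + Y) | X Y. X\<^sup>2 + Y\<^sup>2 = R1 \<and> (X - dx)\<^sup>2 + (Y - dy)\<^sup>2 = R2}"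
  shows "ensures c (intersect_circles Q h mx my mdx mdy mR1 mR2) (solves_circles \<Gamma>1 \<Gamma>2)"
proof -
  define D where "D = dx * dx + dy * dy"
  define mD where "mD = add Q h (mul Q h mdx mdx) (mul Q h mdy mdy)"
  have rD: "rep mD D" unfolding mD_def D_def by (intro rep_add rep_mul dx dy)
  define l where "l = (D + R1 - R2) * (1 / D) / 2 ^ 1"
  define q where "q = R1 * (1 / D) - l * l"
  define ml where "ml e = scale_down Q h 1 (mul Q h (sub Q h (add Q h mD mR1) mR2) (invert Q h e mD))" for e
  have D0: "0 \<le> D" unfolding D_def by simp
  show ?thesis
    unfolding intersect_circles_def mD_def[symmetric] Let_def ml_def[symmetric]
  proof (rule ensures_bind[OF ensures_nonneg[OF rep_neg[OF rD]]])
    fix b c1 assume c1: "c \<sqsubseteq> c1" and b: "b \<longleftrightarrow> 0 \<le> - D"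
    interpret C1: sheet z u v c1 Q h y using sheet_mono[OF c1] .
    show "ensures c1 (if b then give (False, []) else do {
       e \<leftarrow> lower_bound Q h mD;
       chord_ends Q h mx my mdx mdy (ml e) (sub Q h (mul Q h mR1 (invert Q h e mD)) (mul Q h (ml e) (ml e))) })
      (solves_circles \<Gamma>1 \<Gamma>2)"
    proof (cases b)
      case True
      then have "D = 0" using b D0 by simp
      then have "dx = 0" "dy = 0" unfolding D_def by (simp_all add: sum_squares_eq_zero_iff)
      then have "\<Gamma>1 \<inter> \<Gamma>2 = {}" unfolding E using diff by auto
      then show ?thesis using True by (auto intro!: ensures_give simp: solves_circles_def)
    next
      case False
      then have D: "0 < D" using b by simp
      have E': "\<Gamma>1 \<inter> \<Gamma>2 = (if 0 \<le> q then
        {P (x + (l * dx - sqrt q * dy)) (y' + (l * dy + sqrt q * dx)),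
         P (x + (l * dx + sqrt q * dy)) (y' + (l * dy - sqrt q * dx))} else {})"
        unfolding E q_def l_def D_def circle_equations[OF D[unfolded D_def]] by auto
      have "ensures c1 (do {
         e \<leftarrow> lower_bound Q h mD;
         chord_ends Q h mx my mdx mdy (ml e) (sub Q h (mul Q h mR1 (invert Q h e mD)) (mul Q h (ml e) (ml e))) })
        (solves_circles \<Gamma>1 \<Gamma>2)"
      proof (rule ensures_bind[OF C1.ensures_lower_bound[OF represents_mono[OF rD c1] D]])
        fix e c2 assume c12: "c1 \<sqsubseteq> c2" and e: "1 / 2 ^ e \<le> D"
        have c2: "c \<sqsubseteq> c2" using c1 c12 by (rule extends_trans)
        interpret C2: sheet z u v c2 Q h y using sheet_mono[OF c2] .
        note r = represents_mono[OF x c2] represents_mono[OF y c2] represents_mono[OF dx c2]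
          represents_mono[OF dy c2] represents_mono[OF R1 c2] represents_mono[OF R2 c2]
          C2.rep_invert[OF represents_mono[OF rD c2] e] represents_mono[OF rD c2]
        have l: "C2.rep (ml e) l"
          unfolding ml_def l_def by (intro C2.rep_scale_down C2.rep_mul C2.rep_sub C2.rep_add r)
        have q: "C2.rep (sub Q h (mul Q h mR1 (invert Q h e mD)) (mul Q h (ml e) (ml e))) q"
          unfolding q_def by (intro C2.rep_sub C2.rep_mul r l)
        show "ensures c2 (chord_ends Q h mx my mdx mdy (ml e)
            (sub Q h (mul Q h mR1 (invert Q h e mD)) (mul Q h (ml e) (ml e)))) (solves_circles \<Gamma>1 \<Gamma>2)"
          by (rule C2.ensures_chord_ends[OF r(1-4) l q E'])
      qed
      then show ?thesis using False by simp
    qed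
  qed
qed

lemma ensures_circles:
  assumes g: "given_point c 0 (P x1 y1)" "given_point c 1 (P a1 b1)" "given_point c 2 (P x2 y2)" "given_point c 3 (P a2 b2)"
    and r: "P a1 b1 \<in> sphere (P x1 y1) r1" "P a2 b2 \<in> sphere (P x2 y2) r2" "0 < r1" "0 < r2"
    and ne: "sphere (P x1 y1) r1 \<noteq> sphere (P x2 y2) r2"
  shows "ensures c (circles Q h) (solves_circles (sphere (P x1 y1) r1) (sphere (P x2 y2) r2))"
    (is "ensures c _ ?S")
proof -
  define R1 where "R1 = (a1 - x1) * (a1 - x1) + (b1 - y1) * (b1 - y1)"
  define R2 where "R2 = (a2 - x2) * (a2 - x2) + (b2 - y2) * (b2 - y2)"
  have sph: "P X Y \<in> sphere (P x y') r \<longleftrightarrow> (X - x)\<^sup>2 + (Y - y')\<^sup>2 = r\<^sup>2" if "0 < r" for X Y x y' r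
  proof -
    have "P X Y \<in> sphere (P x y') r \<longleftrightarrow> (dist (P x y') (P X Y))\<^sup>2 = r\<^sup>2"
      using that by (simp add: power2_eq_iff_nonneg)
    then show ?thesis unfolding dist_P by (simp add: power2_commute)
  qed
  have R: "R1 = r1\<^sup>2" "R2 = r2\<^sup>2"
    using r sph unfolding R1_def R2_def by (simp_all add: power2_eq_square)
  have diff: "R1 \<noteq> R2" if "x2 - x1 = 0" "y2 - y1 = 0"
    using ne that r(3,4) unfolding R by (auto simp: power2_eq_iff_nonneg)
  have E: "sphere (P x1 y1) r1 \<inter> sphere (P x2 y2) r2 =
    {P (x1 + X) (y1 + Y) | X Y. X\<^sup>2 + Y\<^sup>2 = R1 \<and> (X - (x2 - x1))\<^sup>2 + (Y - (y2 - y1))\<^sup>2 = R2}" (is "?L = ?R")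
  proof (intro equalityI subsetI)
    fix w assume w: "w \<in> ?L"
    obtain X Y where XY: "w = P X Y" using P_surj by blast
    then have "w = P (x1 + (X - x1)) (y1 + (Y - y1))" by simp
    moreover have "(X - x1)\<^sup>2 + (Y - y1)\<^sup>2 = R1" "(X - x1 - (x2 - x1))\<^sup>2 + (Y - y1 - (y2 - y1))\<^sup>2 = R2"
      using w sph[OF r(3), of X Y x1 y1] sph[OF r(4), of X Y x2 y2] unfolding XY R by simp_all
    ultimately show "w \<in> ?R" by blast
  next
    fix w assume "w \<in> ?R"
    then obtain X Y where w: "w = P (x1 + X) (y1 + Y)" "X\<^sup>2 + Y\<^sup>2 = R1" "(X - (x2 - x1))\<^sup>2 + (Y - (y2 - y1))\<^sup>2 = R2"
      by blast
    then have "(x1 + X - x2)\<^sup>2 + (y1 + Y - y2)\<^sup>2 = R2" by (simp add: algebra_simps)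
    then show "w \<in> ?L"
      using w(2) sph[OF r(3), of "x1 + X" "y1 + Y" x1 y1] sph[OF r(4), of "x1 + X" "y1 + Y" x2 y2] unfolding w(1) R by simp
  qed
  show ?thesis
    unfolding circles_def
  proof (rule ensures_bind[OF ensures_coordinates[OF g(1)]], clarify)
    fix mx1 my1 c1 assume c1: "c \<sqsubseteq> c1" and n1: "represents c1 z u v mx1 x1" "represents c1 z u v my1 y1"
    interpret C1: sheet z u v c1 Q h y using sheet_mono[OF c1] .
    show "ensures c1 (do {
       (a1, b1) \<leftarrow> coordinates Q h 1;
       (x2, y2) \<leftarrow> coordinates Q h 2;
       (a2, b2) \<leftarrow> coordinates Q h 3;
       let minus = sub Q h; square_norm = (\<lambda>x y. add Q h (mul Q h x x) (mul Q h y y))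
       in intersect_circles Q h mx1 my1 (minus x2 mx1) (minus y2 my1)
         (square_norm (minus a1 mx1) (minus b1 my1)) (square_norm (minus a2 x2) (minus b2 y2)) }) ?S"
    proof (rule ensures_bind[OF C1.ensures_coordinates[OF given_point_mono[OF g(2) c1]]], clarify)
      fix ma1 mb1 c2 assume c12: "c1 \<sqsubseteq> c2" and n2: "represents c2 z u v ma1 a1" "represents c2 z u v mb1 b1"
      have c2: "c \<sqsubseteq> c2" using c1 c12 by (rule extends_trans)
      interpret C2: sheet z u v c2 Q h y using sheet_mono[OF c2] .
      show "ensures c2 (do {
         (x2, y2) \<leftarrow> coordinates Q h 2;
         (a2, b2) \<leftarrow> coordinates Q h 3;
         let minus = sub Q h; square_norm = (\<lambda>x y. add Q h (mul Q h x x) (mul Q h y y))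
         in intersect_circles Q h mx1 my1 (minus x2 mx1) (minus y2 my1)
           (square_norm (minus ma1 mx1) (minus mb1 my1)) (square_norm (minus a2 x2) (minus b2 y2)) }) ?S"
      proof (rule ensures_bind[OF C2.ensures_coordinates[OF given_point_mono[OF g(3) c2]]], clarify)
        fix mx2 my2 c3 assume c23: "c2 \<sqsubseteq> c3" and n3: "represents c3 z u v mx2 x2" "represents c3 z u v my2 y2"
        have c3: "c \<sqsubseteq> c3" using c2 c23 by (rule extends_trans)
        interpret C3: sheet z u v c3 Q h y using sheet_mono[OF c3] .
        show "ensures c3 (do {
           (a2, b2) \<leftarrow> coordinates Q h 3;
           let minus = sub Q h; square_norm = (\<lambda>x y. add Q h (mul Q h x x) (mul Q h y y))
           in intersect_circles Q h mx1 my1 (minus mx2 mx1) (minus my2 my1)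
             (square_norm (minus ma1 mx1) (minus mb1 my1)) (square_norm (minus a2 mx2) (minus b2 my2)) }) ?S"
        proof (rule ensures_bind[OF C3.ensures_coordinates[OF given_point_mono[OF g(4) c3]]], clarify)
          fix ma2 mb2 c4 assume c34: "c3 \<sqsubseteq> c4" and n4: "represents c4 z u v ma2 a2" "represents c4 z u v mb2 b2"
          have c4: "c \<sqsubseteq> c4" "c2 \<sqsubseteq> c4" "c1 \<sqsubseteq> c4" using c3 c23 c12 c34 by (blast intro: extends_trans)+
          interpret C4: sheet z u v c4 Q h y using sheet_mono[OF c4(1)] .
          note n = n1[THEN represents_mono[OF _ c4(3)]] n2[THEN represents_mono[OF _ c4(2)]]
            n3[THEN represents_mono[OF _ c34]] n4
          show "ensures c4 (let minus = sub Q h; square_norm = (\<lambda>x y. add Q h (mul Q h x x) (mul Q h y y))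
           in intersect_circles Q h mx1 my1 (minus mx2 mx1) (minus my2 my1)
             (square_norm (minus ma1 mx1) (minus mb1 my1)) (square_norm (minus ma2 mx2) (minus mb2 my2))) ?S"
            unfolding Let_def
          proof (rule C4.ensures_intersect_circles[OF _ _ _ _ _ _ diff E])
            show "C4.rep (add Q h (mul Q h (sub Q h ma1 mx1) (sub Q h ma1 mx1)) (mul Q h (sub Q h mb1 my1) (sub Q h mb1 my1))) R1"
              "C4.rep (add Q h (mul Q h (sub Q h ma2 mx2) (sub Q h ma2 mx2)) (mul Q h (sub Q h mb2 my2) (sub Q h mb2 my2))) R2"
              unfolding R1_def R2_def by (intro C4.rep_add C4.rep_mul C4.rep_sub n)+
          qed (intro C4.rep_sub n)+
        qed
      qed
    qed
  qed
qed

end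

lemma ensures_circle_construction:
  assumes g: "given_point c 0 O1" "given_point c 1 A1" "given_point c 2 O2" "given_point c 3 A2"
    and r: "A1 \<in> sphere O1 r1" "A2 \<in> sphere O2 r2" "0 < r1" "0 < r2"
    and ne: "sphere O1 r1 \<noteq> sphere O2 r2"
  shows "ensures c circle_construction (solves_circles (sphere O1 r1) (sphere O2 r2))"
  unfolding circle_construction_def
proof (rule ensures_bind[OF ensures_thin_triangle[OF g(1)]], clarify)
  fix j k c1 b d
  assume c1: "c \<sqsubseteq> c1" and jk: "given_point c1 j b" "given_point c1 k d"
    and "dist O1 b = 1" "dist O1 d = 1" "0 < dist b d" "dist b d < 1"
  then obtain z u v where fr: "frame u v" and sq: "computes_square c1 (triangle_square (give 0) (give j) (give k)) z u v"
    using triangle_square[OF computes_give[OF given_point_mono[OF g(1) c1]] computes_give computes_give] by blast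
  define Q where "Q = triangle_square (give 0) (give j) (give k)"
  interpret frame z u v by (rule fr)
  have bl: "computes c1 (bl Q) (P 0 0)" and tl: "computes c1 (tl Q) (P 0 0 + 1 *\<^sub>R v)"
    using sq unfolding Q_def[symmetric] computes_square_def by (simp_all add: pt_def)
  show "ensures c1 (let Q = triangle_square (give 0) (give j) (give k) in do {
       (_, s) \<leftarrow> rod (bl Q) (tl Q);
       i \<leftarrow> pick s;
       circles Q (give i) }) (solves_circles (sphere O1 r1) (sphere O2 r2))"
    unfolding Q_def[symmetric] Let_def
  proof (rule ensures_bind[OF ensures_rod[OF bl tl norm_v]]; clarify?)
    fix e s c2 assume c2: "c1 \<sqsubseteq> c2" and s: "given_stick c2 s (P 0 0, P 0 0 + v)"
    have v0: "v \<noteq> 0" using norm_v by auto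
    show "ensures c2 (do { i \<leftarrow> pick s; circles Q (give i) }) (solves_circles (sphere O1 r1) (sphere O2 r2))"
    proof (rule ensures_bind[OF ensures_pick[OF s v0]], elim exE conjE)
      fix i c3 y assume c3: "c2 \<sqsubseteq> c3" and y: "0 < y" "y < 1" and i: "given_point c3 i (P 0 0 + y *\<^sub>R v)"
      have "c1 \<sqsubseteq> c3" and cc3: "c \<sqsubseteq> c3" using c1 c2 c3 by (blast intro: extends_trans)+
      note g3 = g[THEN given_point_mono[OF _ cc3]]
      have "P 0 0 + y *\<^sub>R v = P 0 y" by (simp add: pt_def)
      then have "computes c3 (give i) (P 0 y)" using computes_give[OF i] by simp
      then interpret sheet z u v c3 Q "give i" y
        using y computes_square_mono[OF sq \<open>c1 \<sqsubseteq> c3\<close>] points_nonempty[OF g3(1)]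
        by unfold_locales (simp_all add: Q_def)
      obtain x1 y1 a1 b1 x2 y2 a2 b2 where eq: "O1 = P x1 y1" "A1 = P a1 b1" "O2 = P x2 y2" "A2 = P a2 b2"
        using P_surj by metis
      show "ensures c3 (circles Q (give i)) (solves_circles (sphere O1 r1) (sphere O2 r2))"
        using ensures_circles g3 r ne unfolding eq by blast
    qed
  qed simp_all
qed

theorem proposition8:
  "\<exists>K :: (bool \<times> nat list) construction.
     \<forall>(O1 :: point) (A1 :: point) (O2 :: point) (A2 :: point) (r1 :: real) (r2 :: real).
       0 < r1 \<and> 0 < r2 \<and> A1 \<in> sphere O1 r1 \<and> A2 \<in> sphere O2 r2 \<and> sphere O1 r1 \<noteq> sphere O2 r2 \<longrightarrow>
       achieves (solves_circles (sphere O1 r1) (sphere O2 r2)) K (Config [O1, A1, O2, A2] [])"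
proof (intro exI allI impI, elim conjE)
  fix O1 A1 O2 A2 :: point and r1 r2 :: real
  assume r: "0 < r1" "0 < r2" "A1 \<in> sphere O1 r1" "A2 \<in> sphere O2 r2" "sphere O1 r1 \<noteq> sphere O2 r2"
  let ?c = "Config [O1, A1, O2, A2] []"
  let ?Q = "solves_circles (sphere O1 r1) (sphere O2 r2)"
  have "given_point ?c 0 O1" "given_point ?c 1 A1" "given_point ?c 2 O2" "given_point ?c 3 A2"
    by (simp_all add: given_point_def numeral_eq_Suc)
  then have "ensures ?c circle_construction ?Q"
    using r by (intro ensures_circle_construction)
  \<comment> \<open>The construction starts with four points and no stick, hence the counts \<open>(4, 0)\<close>.\<close>
  then have "achieves (\<lambda>(r, n) c. n = counts c \<and> ?c \<sqsubseteq> c \<and> ?Q r c) (circle_construction (4, 0)) ?c"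
    unfolding ensures_def by (auto dest: spec[of _ "Config [O1, A1, O2, A2] []"] simp: counts_def numeral_eq_Suc)
  then show "achieves ?Q (seq (circle_construction (4, 0)) (\<lambda>(r, n). Finish r)) ?c"
    by (rule achieves_seq) (auto intro: achieves.finish)
qed

end
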